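(* Let $S$ be the unilateral shift on $H^2(\mathbb T)$ and let $\tau:B(H^2(\mathbb T))\to B(H^2(\mathbb T))$ be the map $\tau(X)=S^*XS$. Consider the $C^*$-dynamical system $(\mathbb T,L^\infty(\mathbb T),\alpha)$, where $\alpha$ is the natural action of $\mathbb T$ on $L^\infty(\mathbb T)$ given by $(\alpha(\lambda)f)(z)=f(\lambda^{-1}z)$ for $f\in L^\infty(\mathbb T)$, $\lambda\in\mathbb T$. Consider its covariant representation $(\pi,u)$ on $L^2(\mathbb T)$ given by $$\pi(f)=M_f,\qquad u(\lambda)=V_{\bar\lambda},\qquad f\in L^\infty(\mathbb T),\ \lambda\in\mathbb T.$$ Then the peripheral Poisson boundary of $\tau$ is equal to the $C^*$-algebra generated by the images of $\pi$ and $u$ in $B(L^2(\mathbb T))$, where the two are identified via the compression map $X\mapsto PXP|_{H^2(\mathbb T)}$ (which maps this $C^*$-algebra $*$-isomorphically onto $(\mathcal P(\tau),\circ)$).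
   Context: $\mathbb T$ is the unit circle with normalized Haar measure; $L^2(\mathbb T)$ has orthonormal basis $e_n(z)=z^n$, $n\in\mathbb Z$; $H^2(\mathbb T)$ is the closed span of $\{e_n:n\ge0\}$; $P$ is the orthogonal projection of $L^2(\mathbb T)$ onto $H^2(\mathbb T)$; $S e_n=e_{n+1}$ for $n\ge 0$. For $f\in L^\infty(\mathbb T)$, $M_f$ is multiplication by $f$ on $L^2(\mathbb T)$. For $\lambda\in\mathbb T$, $V_\lambda$ is the unitary on $L^2(\mathbb T)$ with $(V_\lambda f)(z)=f(\lambda z)$. Covariance of $(\pi,u)$ means $u(\lambda)\pi(f)u(\lambda)^*=\pi(\alpha(\lambda)f)$. Peripheral Poisson boundary: for Hilbert spaces $\mathcal H\subseteq\mathcal K$ with $p$ the orthogonal projection onto $\mathcal H$, an operator $x\in B(\mathcal H)$ is identified with $pxp\in B(\mathcal K)$. It is known that every normal unital completely positive map $\tau$ on a von Neumann algebra $\mathcal A\subseteq B(\mathcal H)$ has a minimal dilation $(\mathcal K,\mathcal B,\theta)$, unique up to unitary equivalence fixing $\mathcal H$ pointwise: $\mathcal K\supseteq\mathcal H$ is a Hilbert space; $\mathcal B\subseteq B(\mathcal K)$ is a von Neumann algebra with $\mathcal A=p\mathcal Bp$; $\theta:\mathcal B\to\mathcal B$ is a normal unital $*$-endomorphism; $\tau^n(x)=p\theta^n(x)p$ for all $x\in\mathcal A$, $n\in\mathbb Z_+$; $\mathcal K$ is the closed linear span of $\{\theta^n(x_n)\cdots\theta(x_1)h: x_i\in\mathcal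 A,\ h\in\mathcal H,\ n\in\mathbb Z_+\}$; and $\mathcal B$ is generated as a von Neumann algebra by $\{\theta^n(x):n\in\mathbb Z_+,x\in\mathcal A\}$. $\mathcal P(\tau)$ is the operator norm closure of $\mathrm{span}\{x\in\mathcal A:\tau(x)=\lambda x\text{ for some }\lambda\in\mathbb T\}$, and $\mathcal P(\theta)$ is defined in the same way from $\theta$ on $\mathcal B$; $\mathcal P(\theta)$ is a unital $C^*$-algebra. The compression $T:\mathcal P(\theta)\to\mathcal P(\tau)$, $T(z)=pzp$, is an isometric bijection, and $x\circ y:=T(T^{-1}(x)T^{-1}(y))$ makes $\mathcal P(\tau)$ (with unchanged norm and involution) a unital $C^*$-algebra, called the peripheral Poisson boundary of $\tau$. *)

theory Defs
  imports "HOL-Analysis.Analysis"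
begin

section \<open>Complex Hilbert spaces\<close>

class complex_vector = real_vector +
  fixes scaleC :: "complex \<Rightarrow> 'a \<Rightarrow> 'a" (infixr "*\<^sub>C" 75)
  assumes scaleC_add_right: "c *\<^sub>C (x + y) = c *\<^sub>C x + c *\<^sub>C y"
    and scaleC_add_left: "(c + d) *\<^sub>C x = c *\<^sub>C x + d *\<^sub>C x"
    and scaleC_scaleC: "c *\<^sub>C d *\<^sub>C x = (c * d) *\<^sub>C x"
    and scaleC_of_real: "complex_of_real r *\<^sub>C x = r *\<^sub>R x"

global_interpretation complex_vector:
  vector_space "scaleC :: complex \<Rightarrow> 'a \<Rightarrow> 'a::complex_vector"
  defines cspan = complex_vector.span
    and csubspace = complex_vector.subspace
  using scaleC_of_real[of 1]
  by unfold_locales (simp_all add: scaleC_add_right scaleC_add_left scaleC_scaleC)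

class complex_normed_vector = complex_vector + real_normed_vector +
  assumes norm_scaleC: "norm (c *\<^sub>C x) = norm c * norm x"

class complex_inner = complex_vector + real_inner +
  fixes cinner :: "'a \<Rightarrow> 'a \<Rightarrow> complex"
  assumes cinner_commute: "cinner x y = cnj (cinner y x)"
    and cinner_add_left: "cinner (x + y) z = cinner x z + cinner y z"
    and cinner_scaleC_left: "cinner (c *\<^sub>C x) y = c * cinner x y"
    and inner_eq_Re_cinner: "inner x y = Re (cinner x y)"
begin

lemma cinner_self: "cinner x x = complex_of_real ((norm x)\<^sup>2)"
proof -
  have "Im (cinner x x) = 0"
    using cinner_commute[of x x] by (metis cnj.simps(2) equal_neg_zero)
  moreover have "Re (cinner x x) = (norm x)\<^sup>2"
    by (simp add: inner_eq_Re_cinner[symmetric] power2_norm_eq_inner)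
  ultimately show ?thesis
    by (simp add: complex_eq_iff)
qed

subclass complex_normed_vector
proof
  fix c x
  have "cinner (c *\<^sub>C x) (c *\<^sub>C x) = (c * cnj c) * cinner x x"
    by (metis cinner_commute cinner_scaleC_left complex_cnj_mult mult.assoc)
  then have "complex_of_real ((norm (c *\<^sub>C x))\<^sup>2) = complex_of_real ((norm c * norm x)\<^sup>2)"
    by (simp add: cinner_self complex_norm_square power_mult_distrib del: of_real_power)
  then have "(norm (c *\<^sub>C x))\<^sup>2 = (norm c * norm x)\<^sup>2"
    using of_real_eq_iff by blast
  then show "norm (c *\<^sub>C x) = norm c * norm x"
    by (simp add: power2_eq_iff_nonneg)
qed

end

class chilbert_space = complex_inner + complete_space

instance chilbert_space \<subseteq> banach ..

lemma bounded_linear_scaleC: "bounded_linear (scaleC c :: 'a::complex_normed_vector \<Rightarrow> 'a)"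
proof (rule bounded_linear_intro[where K = "norm c"])
  show "c *\<^sub>C (r *\<^sub>R x) = r *\<^sub>R (c *\<^sub>C x)" for r and x :: 'a
    by (simp add: scaleC_of_real[symmetric] scaleC_scaleC mult.commute)
qed (simp_all add: scaleC_add_right norm_scaleC)

instantiation blinfun :: (real_normed_vector, complex_normed_vector) complex_normed_vector
begin

lift_definition scaleC_blinfun :: "complex \<Rightarrow> ('a \<Rightarrow>\<^sub>L 'b) \<Rightarrow> ('a \<Rightarrow>\<^sub>L 'b)"
  is "\<lambda>c T x. c *\<^sub>C T x"
  by (rule bounded_linear_compose[OF bounded_linear_scaleC])

instance
proof
  fix c d :: complex and r :: real and S T :: "'a \<Rightarrow>\<^sub>L 'b"
  show "c *\<^sub>C (S + T) = c *\<^sub>C S + c *\<^sub>C T"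
    by transfer (simp add: scaleC_add_right)
  show "(c + d) *\<^sub>C T = c *\<^sub>C T + d *\<^sub>C T"
    by transfer (simp add: scaleC_add_left)
  show "c *\<^sub>C d *\<^sub>C T = (c * d) *\<^sub>C T"
    by transfer (simp add: scaleC_scaleC)
  show "complex_of_real r *\<^sub>C T = r *\<^sub>R T"
    by transfer (simp add: scaleC_of_real)
  have app: "(c *\<^sub>C T) x = c *\<^sub>C T x" for c x and T :: "'a \<Rightarrow>\<^sub>L 'b"
    by (simp add: scaleC_blinfun.rep_eq)
  have le: "norm (c *\<^sub>C T) \<le> norm c * norm T" for c and T :: "'a \<Rightarrow>\<^sub>L 'b"
    by (rule norm_blinfun_bound)
      (auto simp: app norm_scaleC mult.assoc intro!: mult_left_mono norm_blinfun)
  have assoc: "inverse c *\<^sub>C c *\<^sub>C T = T" if "c \<noteq> 0"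
    using that by (intro blinfun_eqI) (simp add: app complex_vector.scale_scale)
  show "norm (c *\<^sub>C T) = norm c * norm T"
  proof (cases "c = 0")
    case False
    have "norm T \<le> inverse (norm c) * norm (c *\<^sub>C T)"
      using le[of "inverse c" "c *\<^sub>C T"] unfolding assoc[OF False] norm_inverse .
    then have "norm c * norm T \<le> norm (c *\<^sub>C T)"
      using False by (simp add: field_simps)
    then show ?thesis
      using le[of c T] by simp
  qed (use le[of 0 T] in simp)
qed

end


section \<open>Normalized Haar measure on the unit circle\<close>

text \<open>Normalized arc length; its rotation invariance is proved below.\<close>

definition haar :: "complex measure"
  where "haar = distr (uniform_measure lborel {0..<2 * pi}) (restrict_space borel (sphere 0 1)) cis"

lemma cis_measurable: "cis \<in> borel \<rightarrow>\<^sub>M restrict_space borel (sphere 0 1)"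
  by (rule measurable_restrict_space2)
     (auto intro!: borel_measurable_continuous_onI continuous_intros simp: cis_conv_exp)

lemma cis_measurable_unif:
  "cis \<in> uniform_measure lborel {0..<2 * pi} \<rightarrow>\<^sub>M restrict_space borel (sphere 0 1)"
  using cis_measurable by simp

lemma space_haar: "space haar = sphere 0 1"
  by (simp add: haar_def space_restrict_space)

lemma sets_haar: "sets haar = sets (restrict_space borel (sphere 0 1))"
  by (simp add: haar_def)

lemma emeasure_haar:
  assumes "A \<in> sets haar"
  shows "emeasure haar A = emeasure lborel ({0..<2 * pi} \<inter> cis -` A) / ennreal (2 * pi)"
proof -
  have m: "cis -` A \<in> sets borel"
    using measurable_sets[OF cis_measurable, of A] assms by (simp add: sets_haar)
  have "emeasure haar A = emeasure (uniform_measure lborel {0..<2 * pi}) (cis -` A)"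
    using assms emeasure_distr[OF cis_measurable_unif, of A]
    by (simp add: haar_def sets_haar)
  also have "\<dots> = emeasure lborel ({0..<2 * pi} \<inter> cis -` A) / ennreal (2 * pi)"
    using m by simp
  finally show ?thesis .
qed

lemma emeasure_haar_space: "emeasure haar (space haar) = 1"
proof -
  have "cis -` space haar = UNIV"
    by (auto simp: space_haar)
  then show ?thesis
    by (simp add: emeasure_haar divide_ennreal)
qed

lemma rotate_measurable:
  assumes "norm c = 1"
  shows "(\<lambda>z. c * z) \<in> haar \<rightarrow>\<^sub>M haar"
proof -
  have "(\<lambda>z. c * z) \<in> restrict_space borel (sphere 0 1) \<rightarrow>\<^sub>M restrict_space borel (sphere 0 1)"
    using assms
    by (intro measurable_restrict_space3)
       (auto simp: norm_mult)
  then show ?thesis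
    by (simp add: measurable_cong_sets[OF sets_haar sets_haar])
qed

lemma distr_rotate_haar:
  assumes "norm c = 1"
  shows "distr haar haar (\<lambda>z. c * z) = haar"
proof (rule measure_eqI)
  fix A assume "A \<in> sets (distr haar haar (\<lambda>z. c * z))"
  then have A: "A \<in> sets haar" by simp
  obtain t where t: "0 \<le> t" "t < 2 * pi" "c = cis t"
    using assms by (metis cis_Arg_unique complex_unimodular_polar cis_conv_exp cis.ctr)
  define E where "E = cis -` A"
  have E: "E \<in> sets borel"
    using measurable_sets[OF cis_measurable, of A] A by (simp add: sets_haar E_def)
  have per: "2 * pi + x \<in> E \<longleftrightarrow> x \<in> E" for x
    by (simp add: E_def cis_conv_exp[symmetric] flip: cis_mult)
  have shift: "emeasure lborel ((\<lambda>x. s + x) -` B) = emeasure lborel B" if "B \<in> sets borel"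
    for s :: real and B
  proof -
    have "emeasure lborel B = emeasure (distr lborel borel ((+) s)) B"
      by (simp add: lborel_distr_plus)
    then show ?thesis
      using that by (simp add: emeasure_distr)
  qed
  have "(\<lambda>z. c * z) -` A \<inter> space haar \<in> sets haar"
    by (rule measurable_sets[OF rotate_measurable[OF assms] A])
  then have "emeasure (distr haar haar (\<lambda>z. c * z)) A =
      emeasure lborel ({0..<2 * pi} \<inter> cis -` ((\<lambda>z. c * z) -` A \<inter> space haar)) / ennreal (2 * pi)"
    using A by (simp add: emeasure_distr rotate_measurable[OF assms] emeasure_haar)
  also have "{0..<2 * pi} \<inter> cis -` ((\<lambda>z. c * z) -` A \<inter> space haar) = (+) t -` ({t..<t + 2 * pi} \<inter> E)"
    by (auto simp: E_def space_haar t(3) cis_mult)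
  also have "emeasure lborel \<dots> = emeasure lborel ({t..<t + 2 * pi} \<inter> E)"
    using E by (intro shift) auto
  also have "{t..<t + 2 * pi} \<inter> E = ({t..<2 * pi} \<inter> E) \<union> ({2 * pi..<t + 2 * pi} \<inter> E)"
    using t by auto
  also have "emeasure lborel \<dots> =
      emeasure lborel ({t..<2 * pi} \<inter> E) + emeasure lborel ({2 * pi..<t + 2 * pi} \<inter> E)"
    using E by (intro plus_emeasure[symmetric]) auto
  also have "emeasure lborel ({2 * pi..<t + 2 * pi} \<inter> E) =
      emeasure lborel ((+) (2 * pi) -` ({2 * pi..<t + 2 * pi} \<inter> E))"
    using E by (intro shift[symmetric]) auto
  also have "(+) (2 * pi) -` ({2 * pi..<t + 2 * pi} \<inter> E) = {0..<t} \<inter> E"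
    using per by auto
  also have "emeasure lborel ({t..<2 * pi} \<inter> E) + emeasure lborel ({0..<t} \<inter> E) =
      emeasure lborel (({t..<2 * pi} \<inter> E) \<union> ({0..<t} \<inter> E))"
    using E by (intro plus_emeasure) auto
  also have "({t..<2 * pi} \<inter> E) \<union> ({0..<t} \<inter> E) = {0..<2 * pi} \<inter> E"
    using t by auto
  finally show "emeasure (distr haar haar (\<lambda>z. c * z)) A = emeasure haar A"
    using A by (simp add: emeasure_haar E_def)
qed simp


section \<open>The Hilbert space of square integrable functions modulo null sets\<close>

definition square_integrable :: "(complex \<Rightarrow> complex) \<Rightarrow> bool"
  where "square_integrable f \<longleftrightarrow>
    f \<in> borel_measurable haar \<and> integrable haar (\<lambda>z. (norm (f z))\<^sup>2)"

lemma finite_measure_haar: "finite_measure haar"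
  by (rule finite_measureI) (simp add: emeasure_haar_space)

lemma square_integrable_bound:
  assumes "f \<in> borel_measurable haar" "integrable haar g" "AE z in haar. (norm (f z))\<^sup>2 \<le> g z"
  shows "square_integrable f"
  unfolding square_integrable_def
proof (intro conjI assms(1) Bochner_Integration.integrable_bound[OF assms(2)])
  show "AE z in haar. norm ((norm (f z))\<^sup>2) \<le> norm (g z)"
    using assms(3) by eventually_elim auto
qed (use assms(1) in measurable)

lemma square_integrable_add:
  assumes "square_integrable f" "square_integrable g"
  shows "square_integrable (\<lambda>z. f z + g z)"
proof (rule square_integrable_bound)
  show "integrable haar (\<lambda>z. 2 * (norm (f z))\<^sup>2 + 2 * (norm (g z))\<^sup>2)"
    using assms by (simp add: square_integrable_def)
  have "(norm (a + b))\<^sup>2 \<le> 2 * (norm a)\<^sup>2 + 2 * (norm b)\<^sup>2" for a b :: complex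
  proof -
    have "(norm (a + b))\<^sup>2 \<le> (norm a + norm b)\<^sup>2"
      by (intro power_mono norm_triangle_ineq) auto
    also have "\<dots> \<le> 2 * (norm a)\<^sup>2 + 2 * (norm b)\<^sup>2"
      using zero_le_power2[of "norm a - norm b"] by (simp add: power2_sum power2_diff)
    finally show ?thesis .
  qed
  then show "AE z in haar. (norm (f z + g z))\<^sup>2 \<le> 2 * (norm (f z))\<^sup>2 + 2 * (norm (g z))\<^sup>2"
    by simp
qed (use assms in \<open>auto simp: square_integrable_def intro!: borel_measurable_add\<close>)

lemma square_integrable_scale:
  assumes "square_integrable f"
  shows "square_integrable (\<lambda>z. c * f z)"
  using assms by (auto simp: square_integrable_def norm_mult power_mult_distrib)

lemma square_integrable_zero: "square_integrable (\<lambda>_. 0)"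
  by (simp add: square_integrable_def)

lemma integrable_mult_cnj:
  assumes "square_integrable f" "square_integrable g"
  shows "integrable haar (\<lambda>z. f z * cnj (g z))"
proof (rule Bochner_Integration.integrable_bound)
  show "integrable haar (\<lambda>z. (norm (f z))\<^sup>2 + (norm (g z))\<^sup>2)"
    using assms by (simp add: square_integrable_def)
  have [measurable]: "f \<in> borel_measurable haar" "g \<in> borel_measurable haar"
    using assms by (auto simp: square_integrable_def)
  have "cnj \<in> borel_measurable borel"
    by (intro borel_measurable_continuous_onI continuous_intros)
  then show "(\<lambda>z. f z * cnj (g z)) \<in> borel_measurable haar"
    by measurable
  have "a * b \<le> a\<^sup>2 + b\<^sup>2" for a b :: real
    using zero_le_power2[of "a - b"] zero_le_power2[of "a + b"]
    by (simp add: power2_diff power2_sum)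
  then show "AE z in haar. norm (f z * cnj (g z)) \<le> norm ((norm (f z))\<^sup>2 + (norm (g z))\<^sup>2)"
    by (simp add: norm_mult)
qed

definition l2_rel :: "(complex \<Rightarrow> complex) \<Rightarrow> (complex \<Rightarrow> complex) \<Rightarrow> bool"
  where "l2_rel f g \<longleftrightarrow> square_integrable f \<and> square_integrable g \<and> (AE z in haar. f z = g z)"

quotient_type l2 = "complex \<Rightarrow> complex" / partial: l2_rel
proof (rule part_equivpI)
  show "\<exists>f. l2_rel f f"
    by (rule exI[of _ "\<lambda>_. 0"]) (simp add: l2_rel_def square_integrable_zero)
  show "symp l2_rel"
    by (auto simp: symp_def l2_rel_def)
  show "transp l2_rel"
    by (auto simp: transp_def l2_rel_def)
qed

lemma l2_relD:
  assumes "l2_rel f g"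
  shows "square_integrable f" "square_integrable g" "f \<in> borel_measurable haar"
    "g \<in> borel_measurable haar" "AE z in haar. f z = g z"
  using assms by (auto simp: l2_rel_def square_integrable_def)

instantiation l2 :: ab_group_add
begin
lift_definition zero_l2 :: l2 is "\<lambda>_. 0"
  by (simp add: l2_rel_def square_integrable_zero)
lift_definition plus_l2 :: "l2 \<Rightarrow> l2 \<Rightarrow> l2" is "\<lambda>f g z. f z + g z"
  by (auto simp: l2_rel_def intro: square_integrable_add)
lift_definition uminus_l2 :: "l2 \<Rightarrow> l2" is "\<lambda>f z. - f z"
  by (auto simp: l2_rel_def square_integrable_def)
definition minus_l2 :: "l2 \<Rightarrow> l2 \<Rightarrow> l2" where "f - g = f + - g" for f g :: l2
instance
proof
  fix f g h :: l2
  show "f + g + h = f + (g + h)" by transfer (auto simp: l2_rel_def add.assoc intro!: square_integrable_add)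
  show "f + g = g + f" by transfer (auto simp: l2_rel_def add.commute intro!: square_integrable_add)
  show "0 + f = f" by transfer (auto simp: l2_rel_def)
  show "- f + f = 0" by transfer (auto simp: l2_rel_def square_integrable_zero)
  show "f - g = f + - g" by (simp add: minus_l2_def)
qed
end

instantiation l2 :: complex_inner
begin

lift_definition scaleC_l2 :: "complex \<Rightarrow> l2 \<Rightarrow> l2" is "\<lambda>c f z. c * f z"
  by (auto simp: l2_rel_def intro: square_integrable_scale)

definition scaleR_l2 :: "real \<Rightarrow> l2 \<Rightarrow> l2"
  where "r *\<^sub>R f = complex_of_real r *\<^sub>C f" for f :: l2

lift_definition cinner_l2 :: "l2 \<Rightarrow> l2 \<Rightarrow> complex"
  is "\<lambda>f g. \<integral>z. f z * cnj (g z) \<partial>haar"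
proof -
  fix f f' g g' assume *: "l2_rel f f'" "l2_rel g g'"
  have [measurable]: "cnj \<in> borel_measurable borel"
    by (intro borel_measurable_continuous_onI continuous_intros)
  note [measurable] = l2_relD(3,4)[OF *(1)] l2_relD(3,4)[OF *(2)]
  show "(\<integral>z. f z * cnj (g z) \<partial>haar) = (\<integral>z. f' z * cnj (g' z) \<partial>haar)"
    by (rule integral_cong_AE) (use l2_relD(5)[OF *(1)] l2_relD(5)[OF *(2)] in auto)
qed

definition inner_l2 :: "l2 \<Rightarrow> l2 \<Rightarrow> real"
  where "inner f g = Re (cinner f g)" for f g :: l2
definition norm_l2 :: "l2 \<Rightarrow> real"
  where "norm f = sqrt (inner f f)" for f :: l2
definition sgn_l2 :: "l2 \<Rightarrow> l2"
  where "sgn f = inverse (norm f) *\<^sub>R f" for f :: l2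
definition dist_l2 :: "l2 \<Rightarrow> l2 \<Rightarrow> real"
  where "dist f g = norm (f - g)" for f g :: l2
definition uniformity_l2 :: "(l2 \<times> l2) filter"
  where "uniformity_l2 = (INF e\<in>{0<..}. principal {(f, g). dist f g < e})"
definition open_l2 :: "l2 set \<Rightarrow> bool"
  where "open_l2 U \<longleftrightarrow> (\<forall>f\<in>U. eventually (\<lambda>(f', g). f' = f \<longrightarrow> g \<in> U) uniformity)"

instance
proof
  fix f g h :: l2 and c d :: complex and r s :: real
  show CR: "c *\<^sub>C (f + g) = c *\<^sub>C f + c *\<^sub>C g"
    by transfer (auto simp: l2_rel_def distrib_left intro!: square_integrable_add square_integrable_scale)
  show CL: "(c + d) *\<^sub>C f = c *\<^sub>C f + d *\<^sub>C f" for c d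
    by transfer (auto simp: l2_rel_def distrib_right intro!: square_integrable_add square_integrable_scale)
  show CC: "c *\<^sub>C d *\<^sub>C f = (c * d) *\<^sub>C f" for c d
    by transfer (auto simp: l2_rel_def mult.assoc intro!: square_integrable_scale)
  show "complex_of_real r *\<^sub>C f = r *\<^sub>R f"
    by (simp add: scaleR_l2_def)
  have one: "1 *\<^sub>C f = f"
    by transfer (auto simp: l2_rel_def)
  show "r *\<^sub>R (f + g) = r *\<^sub>R f + r *\<^sub>R g"
    unfolding scaleR_l2_def
    by transfer (auto simp: l2_rel_def distrib_left intro!: square_integrable_add square_integrable_scale)
  show "(r + s) *\<^sub>R f = r *\<^sub>R f + s *\<^sub>R f"
    by (simp add: scaleR_l2_def CL)
  show "r *\<^sub>R s *\<^sub>R f = (r * s) *\<^sub>R f"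
    by (simp add: scaleR_l2_def CC)
  show "1 *\<^sub>R f = f"
    by (simp add: scaleR_l2_def one)
  show "sgn f = inverse (norm f) *\<^sub>R f" by (rule sgn_l2_def)
  show "dist f g = norm (f - g)" by (rule dist_l2_def)
  show "uniformity = (INF e\<in>{0<..}. principal {(f :: l2, g). dist f g < e})"
    by (rule uniformity_l2_def)
  show "open U \<longleftrightarrow> (\<forall>f\<in>U. eventually (\<lambda>(f', g). f' = f \<longrightarrow> g \<in> U) uniformity)" for U :: "l2 set"
    by (rule open_l2_def)
  show comm: "cinner f g = cnj (cinner g f)" for f g :: l2
    by transfer (simp add: mult.commute flip: Bochner_Integration.integral_cnj)
  show add: "cinner (f + g) h = cinner f h + cinner g h"
    by transfer
      (simp add: distrib_right l2_rel_def integrable_mult_cnj)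
  show scale: "cinner (c *\<^sub>C f) g = c * cinner f g" for c
    by transfer (simp add: mult.assoc)
  show "inner f g = Re (cinner f g)"
    by (rule inner_l2_def)
  show "inner f g = inner g f"
    unfolding inner_l2_def by (subst comm) simp
  show "inner (f + g) h = inner f h + inner g h"
    by (simp add: inner_l2_def add)
  show "inner (r *\<^sub>R f) g = r * inner f g"
    by (simp add: inner_l2_def scaleR_l2_def scale)
  have self: "Re (\<integral>z. f z * cnj (f z) \<partial>haar) = (\<integral>z. (norm (f z))\<^sup>2 \<partial>haar)"
    for f :: "complex \<Rightarrow> complex"
    by (simp add: complex_norm_square[symmetric] flip: of_real_power)
  show "0 \<le> inner f f"
    unfolding inner_l2_def
    by transfer (simp add: self)
  show "inner f f = 0 \<longleftrightarrow> f = 0"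
    unfolding inner_l2_def
  proof transfer
    fix f assume "l2_rel f f"
    then have "square_integrable f" by (simp add: l2_rel_def)
    then have "(\<integral>z. (norm (f z))\<^sup>2 \<partial>haar) = 0 \<longleftrightarrow> (AE z in haar. (norm (f z))\<^sup>2 = 0)"
      by (intro integral_nonneg_eq_0_iff_AE) (auto simp: square_integrable_def)
    then show "Re (\<integral>z. f z * cnj (f z) \<partial>haar) = 0 \<longleftrightarrow> l2_rel f (\<lambda>_. 0)"
      using \<open>square_integrable f\<close>
      unfolding self by (simp add: l2_rel_def square_integrable_zero)
  qed
  show "norm f = sqrt (inner f f)" by (rule norm_l2_def)
qed

end

lemma norm_l2_abs:
  assumes "square_integrable f"
  shows "(norm (abs_l2 f))\<^sup>2 = (\<integral>z. (norm (f z))\<^sup>2 \<partial>haar)"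
proof -
  have "(norm (abs_l2 f))\<^sup>2 = Re (cinner (abs_l2 f) (abs_l2 f))"
    by (simp add: cinner_self)
  also have "cinner (abs_l2 f) (abs_l2 f) = (\<integral>z. f z * cnj (f z) \<partial>haar)"
    using assms by (intro cinner_l2.abs_eq) (auto simp: l2_rel_def)
  finally show ?thesis
    by (simp add: complex_norm_square[symmetric] flip: of_real_power)
qed

lemma nn_integral_l2_abs:
  assumes "square_integrable f"
  shows "(\<integral>\<^sup>+z. ennreal ((norm (f z))\<^sup>2) \<partial>haar) = ennreal ((norm (abs_l2 f))\<^sup>2)"
  unfolding norm_l2_abs[OF assms]
  using assms by (intro nn_integral_eq_integral) (auto simp: square_integrable_def)

lemma l2_abs_cases:
  obtains f where "square_integrable f" "x = abs_l2 f"
  by (metis Quotient3_l2 Quotient3_def l2_rel_def)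

lemma l2_abs_diff:
  assumes "square_integrable f" "square_integrable g"
  shows "abs_l2 f - abs_l2 g = abs_l2 (\<lambda>z. f z - g z)"
    "square_integrable (\<lambda>z. f z - g z)"
proof -
  have "square_integrable (\<lambda>z. - g z)"
    using square_integrable_scale[OF assms(2), of "-1"] by simp
  then show "abs_l2 f - abs_l2 g = abs_l2 (\<lambda>z. f z - g z)"
      "square_integrable (\<lambda>z. f z - g z)"
    using assms square_integrable_add[of f "\<lambda>z. - g z"]
    by (simp_all add: minus_l2_def uminus_l2.abs_eq plus_l2.abs_eq l2_rel_def)
qed

text \<open>Riesz--Fischer: a rapidly convergent subsequence has almost everywhere convergent
  representatives, and Fatou's lemma identifies the limit.\<close>

instance l2 :: complete_space
proof
  fix X :: "nat \<Rightarrow> l2" assume X: "Cauchy X"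
  have "\<exists>F. \<forall>n. square_integrable (F n) \<and> X n = abs_l2 (F n)"
    by (intro choice allI) (metis l2_abs_cases)
  then obtain F where F: "\<And>n. square_integrable (F n)" "\<And>n. X n = abs_l2 (F n)"
    by blast
  have [measurable]: "F n \<in> borel_measurable haar" for n
    using F(1) by (simp add: square_integrable_def)
  have dist: "(\<integral>\<^sup>+z. ennreal ((norm (F m z - F n z))\<^sup>2) \<partial>haar) = ennreal ((norm (X m - X n))\<^sup>2)" for m n
    using l2_abs_diff[OF F(1) F(1), of m n] nn_integral_l2_abs by (simp add: F(2))
  have "\<exists>N. \<forall>m\<ge>N. \<forall>n\<ge>N. norm (X m - X n) < (1/2)^k" for k
    using X by (simp add: Cauchy_iff)
  then obtain N where N: "\<And>k m n. m \<ge> N k \<Longrightarrow> n \<ge> N k \<Longrightarrow> norm (X m - X n) < (1/2)^k"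
    by metis
  define r where "r k = (\<Sum>j\<le>k. N j) + k" for k
  have rN: "r k \<ge> N k" "r (Suc k) \<ge> N k" "r k \<ge> k" for k
  proof -
    have *: "N k \<le> (\<Sum>j\<le>k. N j)" by (rule member_le_sum) auto
    then show "r k \<ge> N k" "r (Suc k) \<ge> N k" "r k \<ge> k" by (auto simp: r_def)
  qed
  define d where "d k z = norm (F (r (Suc k)) z - F (r k) z)" for k z
  have [measurable]: "d k \<in> borel_measurable haar" for k
    unfolding d_def by measurable
  have d_le: "(\<integral>\<^sup>+z. ennreal (d k z) \<partial>haar) \<le> ennreal (2 * (1/2)^k)" for k
  proof -
    have "d k z \<le> 2^k * (d k z)\<^sup>2 + (1/2)^k" for z
    proof -
      have "0 \<le> 2^k * (d k z - (1/2)^k)\<^sup>2 + 2^k * (d k z)\<^sup>2"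
        by simp
      also have "\<dots> = 2 * (2^k * (d k z)\<^sup>2) - 2 * (2^k * (1/2)^k) * d k z + 2^k * (1/2)^k * (1/2)^k"
        by (simp add: power2_eq_square algebra_simps)
      also have "(2::real)^k * (1/2)^k = 1"
        by (simp flip: power_mult_distrib)
      finally show ?thesis
        using zero_le_power[of "1/2 :: real" k] by linarith
    qed
    then have "(\<integral>\<^sup>+z. ennreal (d k z) \<partial>haar) \<le>
        (\<integral>\<^sup>+z. ennreal (2^k) * ennreal ((d k z)\<^sup>2) + ennreal ((1/2)^k) \<partial>haar)"
      by (intro nn_integral_mono)
        (simp add: ennreal_mult[symmetric] ennreal_plus[symmetric] ennreal_leI del: ennreal_plus)
    also have "\<dots> = ennreal (2^k) * (\<integral>\<^sup>+z. ennreal ((d k z)\<^sup>2) \<partial>haar) + ennreal ((1/2)^k)"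
      by (simp add: nn_integral_add nn_integral_cmult emeasure_haar_space)
    also have "(\<integral>\<^sup>+z. ennreal ((d k z)\<^sup>2) \<partial>haar) \<le> ennreal (((1/2)^k)\<^sup>2)"
      unfolding d_def dist
      using N[OF rN(2) rN(1), of k] by (intro ennreal_leI power_mono) auto
    also have "ennreal (2^k) * ennreal (((1/2)^k)\<^sup>2) + ennreal ((1/2)^k) =
        ennreal (2^k * ((1/2)^k)\<^sup>2 + (1/2)^k)"
      by (simp add: ennreal_mult[symmetric] ennreal_plus[symmetric] del: ennreal_plus)
    also have "(2::real)^k * ((1/2)^k)\<^sup>2 + (1/2)^k = 2 * (1/2)^k"
      by (simp add: power2_eq_square mult.assoc[symmetric] flip: power_mult_distrib)
    finally show ?thesis by (simp add: add_mono mult_left_mono)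
  qed
  have "(\<integral>\<^sup>+z. (\<Sum>k. ennreal (d k z)) \<partial>haar) = (\<Sum>k. \<integral>\<^sup>+z. ennreal (d k z) \<partial>haar)"
    by (rule nn_integral_suminf) measurable
  also have "\<dots> \<le> (\<Sum>k. ennreal (2 * (1/2)^k))"
    by (intro suminf_le d_le summableI)
  also have "\<dots> < \<infinity>"
    by (subst suminf_ennreal2) (auto intro!: summable_mult summable_geometric)
  finally have "(\<integral>\<^sup>+z. (\<Sum>k. ennreal (d k z)) \<partial>haar) \<noteq> \<infinity>"
    by simp
  then have "AE z in haar. (\<Sum>k. ennreal (d k z)) \<noteq> \<infinity>"
    by (intro nn_integral_PInf_AE) auto
  then have conv: "AE z in haar. convergent (\<lambda>k. F (r k) z)"
  proof eventually_elim
    case (elim z)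
    have "summable (\<lambda>k. d k z)"
      using elim by (intro summable_suminf_not_top) (auto simp: d_def)
    then have "summable (\<lambda>k. F (r (Suc k)) z - F (r k) z)"
      unfolding d_def by (rule summable_norm_cancel)
    then have "convergent (\<lambda>n. F (r n) z - F (r 0) z)"
      using sum_lessThan_telescope[of "\<lambda>k. F (r k) z"] by (simp add: summable_iff_convergent)
    from convergent_add[OF this convergent_const[of "F (r 0) z"]] show ?case
      by simp
  qed
  define f where "f z = lim (\<lambda>k. F (r k) z)" for z
  have [measurable]: "f \<in> borel_measurable haar"
    unfolding f_def by measurable
  have fat: "(\<integral>\<^sup>+z. ennreal ((norm (f z - F n z))\<^sup>2) \<partial>haar) \<le> ennreal (((1/2)^k)\<^sup>2)"
    if "n \<ge> N k" for n k
  proof -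
    have "AE z in haar. ennreal ((norm (f z - F n z))\<^sup>2) =
        liminf (\<lambda>j. ennreal ((norm (F (r j) z - F n z))\<^sup>2))"
      using conv
    proof eventually_elim
      case (elim z)
      then have "(\<lambda>j. F (r j) z) \<longlonglongrightarrow> f z"
        by (simp add: f_def convergent_LIMSEQ_iff)
      then have "(\<lambda>j. ennreal ((norm (F (r j) z - F n z))\<^sup>2)) \<longlonglongrightarrow> ennreal ((norm (f z - F n z))\<^sup>2)"
        by (intro tendsto_intros)
      then show ?case
        by (intro lim_imp_Liminf[symmetric]) auto
    qed
    then have "(\<integral>\<^sup>+z. ennreal ((norm (f z - F n z))\<^sup>2) \<partial>haar) =
        (\<integral>\<^sup>+z. liminf (\<lambda>j. ennreal ((norm (F (r j) z - F n z))\<^sup>2)) \<partial>haar)"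
      by (rule nn_integral_cong_AE)
    also have "\<dots> \<le> liminf (\<lambda>j. \<integral>\<^sup>+z. ennreal ((norm (F (r j) z - F n z))\<^sup>2) \<partial>haar)"
      by (rule nn_integral_liminf) measurable
    also have "\<dots> \<le> ennreal (((1/2)^k)\<^sup>2)"
    proof (rule Liminf_le)
      show "\<forall>\<^sub>F j in sequentially.
          (\<integral>\<^sup>+z. ennreal ((norm (F (r j) z - F n z))\<^sup>2) \<partial>haar) \<le> ennreal (((1/2)^k)\<^sup>2)"
        unfolding eventually_sequentially
      proof (intro exI[of _ "N k"] allI impI)
        fix j assume "N k \<le> j"
        then have "r j \<ge> N k" using rN(3)[of j] by linarith
        then show "(\<integral>\<^sup>+z. ennreal ((norm (F (r j) z - F n z))\<^sup>2) \<partial>haar) \<le> ennreal (((1/2)^k)\<^sup>2)"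
          unfolding dist using N[OF _ that, of "r j"]
          by (intro ennreal_leI power_mono) (auto intro: less_imp_le)
      qed
    qed simp
    finally show ?thesis .
  qed
  have si: "square_integrable (\<lambda>z. f z - F n z)" if "n \<ge> N k" for n k
    unfolding square_integrable_def
  proof (intro conjI integrableI_bounded)
    show "(\<integral>\<^sup>+z. ennreal (norm ((norm (f z - F n z))\<^sup>2)) \<partial>haar) < \<infinity>"
      using fat[OF that] le_less_trans ennreal_less_top by fastforce
  qed measurable
  have "square_integrable (\<lambda>z. (f z - F (N 0) z) + F (N 0) z)"
    by (intro square_integrable_add si[of 0] F) simp
  then have f: "square_integrable f" by simp
  have "X \<longlonglongrightarrow> abs_l2 f"
  proof (rule LIMSEQ_I)
    fix e :: real assume "e > 0"
    then obtain k where k: "(1/2::real)^k < e"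
      using real_arch_pow_inv[of e "1/2"] by auto
    show "\<exists>no. \<forall>n\<ge>no. norm (X n - abs_l2 f) < e"
    proof (intro exI[of _ "N k"] allI impI)
      fix n assume n: "N k \<le> n"
      have "ennreal ((norm (abs_l2 f - X n))\<^sup>2) \<le> ennreal (((1/2)^k)\<^sup>2)"
        using fat[OF n] nn_integral_l2_abs[OF l2_abs_diff(2)[OF f F(1)[of n]]]
        by (simp add: F(2) l2_abs_diff(1)[OF f F(1)])
      then have "(norm (abs_l2 f - X n))\<^sup>2 \<le> ((1/2)^k)\<^sup>2"
        by (subst (asm) ennreal_le_iff) auto
      then have "norm (abs_l2 f - X n) \<le> (1/2)^k"
        by (rule power2_le_imp_le) simp
      then show "norm (X n - abs_l2 f) < e"
        using k by (simp add: norm_minus_commute)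
    qed
  qed
  then show "convergent X"
    by (rule convergentI)
qed

instance l2 :: chilbert_space ..


section \<open>Essentially bounded functions, operators on \<open>l2\<close>, and the Hardy space\<close>

definition essentially_bounded :: "(complex \<Rightarrow> complex) \<Rightarrow> bool"
  where "essentially_bounded f \<longleftrightarrow>
    f \<in> borel_measurable haar \<and> (\<exists>C. AE z in haar. norm (f z) \<le> C)"

definition linfty_rel :: "(complex \<Rightarrow> complex) \<Rightarrow> (complex \<Rightarrow> complex) \<Rightarrow> bool"
  where "linfty_rel f g \<longleftrightarrow>
    essentially_bounded f \<and> essentially_bounded g \<and> (AE z in haar. f z = g z)"

lemma essentially_bounded_const: "essentially_bounded (\<lambda>_. c)"
  by (auto simp: essentially_bounded_def)

lemma essentially_bounded_add:
  assumes "essentially_bounded f" "essentially_bounded g"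
  shows "essentially_bounded (\<lambda>z. f z + g z)"
proof -
  obtain C D where "AE z in haar. norm (f z) \<le> C" "AE z in haar. norm (g z) \<le> D"
    using assms by (auto simp: essentially_bounded_def)
  then have "AE z in haar. norm (f z + g z) \<le> C + D"
    by eventually_elim (rule norm_triangle_mono)
  then show ?thesis
    using assms by (auto simp: essentially_bounded_def intro!: borel_measurable_add)
qed

lemma essentially_bounded_mult:
  assumes "essentially_bounded f" "essentially_bounded g"
  shows "essentially_bounded (\<lambda>z. f z * g z)"
proof -
  obtain C D where "AE z in haar. norm (f z) \<le> C" "AE z in haar. norm (g z) \<le> D"
    using assms by (auto simp: essentially_bounded_def)
  then have "AE z in haar. norm (f z * g z) \<le> C * D"
    by eventually_elim (auto simp: norm_mult intro!: mult_mono intro: order_trans[OF norm_ge_zero])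
  then show ?thesis
    using assms by (auto simp: essentially_bounded_def intro!: borel_measurable_times)
qed

lemma essentially_bounded_uminus:
  "essentially_bounded f \<Longrightarrow> essentially_bounded (\<lambda>z. - f z)"
  by (auto simp: essentially_bounded_def)

lemma essentially_bounded_cnj:
  "essentially_bounded f \<Longrightarrow> essentially_bounded (\<lambda>z. cnj (f z))"
  unfolding essentially_bounded_def
  by (auto intro!: measurable_compose[of f haar borel cnj borel]
      borel_measurable_continuous_onI continuous_intros)

lemma AE_rotate:
  assumes "norm c = 1" "AE z in haar. P z"
  shows "AE z in haar. P (c * z)"
  using AE_distrD[OF rotate_measurable[OF assms(1)], of P] assms(2)
  unfolding distr_rotate_haar[OF assms(1)] .

lemma essentially_bounded_rotate:
  assumes "norm c = 1" "essentially_bounded f"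
  shows "essentially_bounded (\<lambda>z. f (c * z))"
proof -
  obtain C where "AE z in haar. norm (f z) \<le> C"
    using assms(2) by (auto simp: essentially_bounded_def)
  from AE_rotate[OF assms(1) this] show ?thesis
    using assms(2) measurable_compose[OF rotate_measurable[OF assms(1)], of f borel]
    by (auto simp: essentially_bounded_def)
qed

quotient_type linfty = "complex \<Rightarrow> complex" / partial: linfty_rel
proof (rule part_equivpI)
  show "\<exists>f. linfty_rel f f"
    by (rule exI[of _ "\<lambda>_. 0"]) (simp add: linfty_rel_def essentially_bounded_const)
  show "symp linfty_rel"
    by (auto simp: symp_def linfty_rel_def)
  show "transp linfty_rel"
    by (auto simp: transp_def linfty_rel_def)
qed

instantiation linfty :: "{comm_ring_1, complex_vector}"
begin

lift_definition zero_linfty :: linfty is "\<lambda>_. 0"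
  by (simp add: linfty_rel_def essentially_bounded_const)
lift_definition one_linfty :: linfty is "\<lambda>_. 1"
  by (simp add: linfty_rel_def essentially_bounded_const)
lift_definition plus_linfty :: "linfty \<Rightarrow> linfty \<Rightarrow> linfty" is "\<lambda>f g z. f z + g z"
  by (auto simp: linfty_rel_def intro: essentially_bounded_add)
lift_definition uminus_linfty :: "linfty \<Rightarrow> linfty" is "\<lambda>f z. - f z"
  by (auto simp: linfty_rel_def intro: essentially_bounded_uminus)
definition minus_linfty :: "linfty \<Rightarrow> linfty \<Rightarrow> linfty"
  where "f - g = f + - g" for f g :: linfty
lift_definition times_linfty :: "linfty \<Rightarrow> linfty \<Rightarrow> linfty" is "\<lambda>f g z. f z * g z"
  by (auto simp: linfty_rel_def intro: essentially_bounded_mult)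
lift_definition scaleC_linfty :: "complex \<Rightarrow> linfty \<Rightarrow> linfty" is "\<lambda>c f z. c * f z"
  by (auto simp: linfty_rel_def intro: essentially_bounded_mult essentially_bounded_const)
lift_definition scaleR_linfty :: "real \<Rightarrow> linfty \<Rightarrow> linfty" is "\<lambda>r f z. complex_of_real r * f z"
  by (auto simp: linfty_rel_def intro: essentially_bounded_mult essentially_bounded_const)

instance
proof
  note eb = essentially_bounded_const essentially_bounded_add essentially_bounded_mult
  fix f g h :: linfty and c d :: complex and r s :: real
  show "f + g + h = f + (g + h)" "f * g * h = f * (g * h)" "(f + g) * h = f * h + g * h"
    by (transfer, auto simp: linfty_rel_def algebra_simps intro!: eb)+
  show "f + g = g + f" "f * g = g * f"
    by (transfer, auto simp: linfty_rel_def algebra_simps intro!: eb)+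
  show "0 + f = f" "- f + f = 0" "1 * f = f"
    by (transfer, auto simp: linfty_rel_def intro!: eb)+
  show "f - g = f + - g"
    by (rule minus_linfty_def)
  show "(0 :: linfty) \<noteq> 1"
  proof transfer
    have "\<not> (AE z in haar. False)"
      using emeasure_haar_space
      by (simp add: AE_iff_measurable[of "space haar"])
    then show "\<not> linfty_rel (\<lambda>_. 0) (\<lambda>_. 1)"
      by (simp add: linfty_rel_def)
  qed
  show "c *\<^sub>C (f + g) = c *\<^sub>C f + c *\<^sub>C g" "(c + d) *\<^sub>C f = c *\<^sub>C f + d *\<^sub>C f"
      "c *\<^sub>C d *\<^sub>C f = (c * d) *\<^sub>C f" "complex_of_real r *\<^sub>C f = r *\<^sub>R f"
    by (transfer, auto simp: linfty_rel_def algebra_simps intro!: eb)+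
  show "r *\<^sub>R (f + g) = r *\<^sub>R f + r *\<^sub>R g" "(r + s) *\<^sub>R f = r *\<^sub>R f + s *\<^sub>R f"
      "r *\<^sub>R s *\<^sub>R f = (r * s) *\<^sub>R f" "1 *\<^sub>R f = f"
    by (transfer, auto simp: linfty_rel_def algebra_simps intro!: eb)+
qed

end

lift_definition linfty_cnj :: "linfty \<Rightarrow> linfty" is "\<lambda>f z. cnj (f z)"
  by (auto simp: linfty_rel_def intro: essentially_bounded_cnj)

text \<open>Rotation by \<open>c\<close> does not respect null sets unless \<open>\<bar>c\<bar> = 1\<close>; other values of \<open>c\<close> are
  irrelevant.\<close>

lift_definition linfty_rotate :: "complex \<Rightarrow> linfty \<Rightarrow> linfty"
  is "\<lambda>c f. if norm c = 1 then \<lambda>z. f (c * z) else f"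
proof -
  fix c and f g :: "complex \<Rightarrow> complex" assume "linfty_rel f g"
  then show "linfty_rel (if norm c = 1 then \<lambda>z. f (c * z) else f)
      (if norm c = 1 then \<lambda>z. g (c * z) else g)"
    using AE_rotate[of c "\<lambda>z. f z = g z"]
    by (auto simp: linfty_rel_def intro: essentially_bounded_rotate)
qed

lemma square_integrable_mult:
  assumes "essentially_bounded f" "square_integrable g"
  shows "square_integrable (\<lambda>z. f z * g z)"
proof -
  obtain C where C: "AE z in haar. norm (f z) \<le> C"
    using assms(1) by (auto simp: essentially_bounded_def)
  show ?thesis
  proof (rule square_integrable_bound)
    show "(\<lambda>z. f z * g z) \<in> borel_measurable haar" "integrable haar (\<lambda>z. C\<^sup>2 * (norm (g z))\<^sup>2)"
      using assms by (auto simp: essentially_bounded_def square_integrable_def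
          intro!: borel_measurable_times)
    show "AE z in haar. (norm (f z * g z))\<^sup>2 \<le> C\<^sup>2 * (norm (g z))\<^sup>2"
      using C by eventually_elim
        (auto simp: norm_mult power_mult_distrib intro!: mult_right_mono power_mono)
  qed
qed

lift_definition linfty_mult_l2 :: "linfty \<Rightarrow> l2 \<Rightarrow> l2" is "\<lambda>f g z. f z * g z"
  by (auto simp: l2_rel_def linfty_rel_def intro: square_integrable_mult)

lemma square_integrable_rotate:
  assumes "norm c = 1" "square_integrable f"
  shows "square_integrable (\<lambda>z. f (c * z))"
    "(\<integral>z. (norm (f (c * z)))\<^sup>2 \<partial>haar) = (\<integral>z. (norm (f z))\<^sup>2 \<partial>haar)"
proof -
  note m = rotate_measurable[OF assms(1)]
  have f: "f \<in> borel_measurable haar" and i: "integrable haar (\<lambda>z. (norm (f z))\<^sup>2)"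
    using assms(2) by (auto simp: square_integrable_def)
  then have n: "(\<lambda>z. (norm (f z))\<^sup>2) \<in> borel_measurable haar" by measurable
  show "square_integrable (\<lambda>z. f (c * z))"
    using measurable_compose[OF m f] integrable_distr_eq[OF m n] i
    by (simp add: square_integrable_def distr_rotate_haar[OF assms(1)])
  show "(\<integral>z. (norm (f (c * z)))\<^sup>2 \<partial>haar) = (\<integral>z. (norm (f z))\<^sup>2 \<partial>haar)"
    using integral_distr[OF m n] by (simp add: distr_rotate_haar[OF assms(1)])
qed

lift_definition l2_rotate :: "complex \<Rightarrow> l2 \<Rightarrow> l2"
  is "\<lambda>c f. if norm c = 1 then \<lambda>z. f (c * z) else f"
proof -
  fix c and f g :: "complex \<Rightarrow> complex" assume "l2_rel f g"
  then show "l2_rel (if norm c = 1 then \<lambda>z. f (c * z) else f)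
      (if norm c = 1 then \<lambda>z. g (c * z) else g)"
    using AE_rotate[of c "\<lambda>z. f z = g z"]
    by (auto simp: l2_rel_def intro: square_integrable_rotate)
qed

lemma l2_norm_mono:
  assumes "square_integrable f" "square_integrable g" "0 \<le> C"
    and "AE z in haar. norm (f z) \<le> C * norm (g z)"
  shows "norm (abs_l2 f) \<le> C * norm (abs_l2 g)"
proof (rule power2_le_imp_le)
  have "(\<integral>z. (norm (f z))\<^sup>2 \<partial>haar) \<le> (\<integral>z. C\<^sup>2 * (norm (g z))\<^sup>2 \<partial>haar)"
  proof (rule integral_mono_AE)
    show "AE z in haar. (norm (f z))\<^sup>2 \<le> C\<^sup>2 * (norm (g z))\<^sup>2"
      using assms(4) by eventually_elim (metis norm_ge_zero power_mono power_mult_distrib)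
  qed (use assms in \<open>auto simp: square_integrable_def\<close>)
  then show "(norm (abs_l2 f))\<^sup>2 \<le> (C * norm (abs_l2 g))\<^sup>2"
    using assms by (simp add: power_mult_distrib norm_l2_abs)
qed (use assms(3) in auto)

lemma bounded_linear_linfty_mult_l2: "bounded_linear (linfty_mult_l2 f)"
proof -
  obtain f' where f': "essentially_bounded f'" "f = abs_linfty f'"
    by (metis Quotient3_linfty Quotient3_def linfty_rel_def)
  obtain C where C: "AE z in haar. norm (f' z) \<le> C"
    using f'(1) by (auto simp: essentially_bounded_def)
  show ?thesis
  proof (rule bounded_linear_intro[where K = "max 0 C"])
    show "linfty_mult_l2 f (g + h) = linfty_mult_l2 f g + linfty_mult_l2 f h" for g h
      by transfer (auto simp: l2_rel_def linfty_rel_def distrib_left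
          intro!: square_integrable_add square_integrable_mult)
    show "linfty_mult_l2 f (r *\<^sub>R g) = r *\<^sub>R linfty_mult_l2 f g" for r g
      unfolding scaleR_l2_def
      by transfer (auto simp: l2_rel_def linfty_rel_def
          intro!: square_integrable_scale square_integrable_mult)
    show "norm (linfty_mult_l2 f g) \<le> norm g * max 0 C" for g
    proof -
      obtain g' where g': "square_integrable g'" "g = abs_l2 g'"
        by (rule l2_abs_cases)
      have "norm (abs_l2 (\<lambda>z. f' z * g' z)) \<le> max 0 C * norm (abs_l2 g')"
        using f' g' C
        by (intro l2_norm_mono square_integrable_mult)
          (auto simp: norm_mult elim!: eventually_mono intro!: mult_right_mono)
      then show ?thesis
        using f' g' by (simp add: linfty_mult_l2.abs_eq linfty_rel_def l2_rel_def mult.commute)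
    qed
  qed
qed

lemma bounded_linear_l2_rotate: "bounded_linear (l2_rotate c)"
proof (rule bounded_linear_intro[where K = 1])
  show "l2_rotate c (f + g) = l2_rotate c f + l2_rotate c g" for f g
    by transfer (auto simp: l2_rel_def intro!: square_integrable_add square_integrable_rotate)
  show "l2_rotate c (r *\<^sub>R f) = r *\<^sub>R l2_rotate c f" for r f
    unfolding scaleR_l2_def
    by transfer (auto simp: l2_rel_def intro!: square_integrable_scale square_integrable_rotate)
  show "norm (l2_rotate c f) \<le> norm f * 1" for f
  proof -
    obtain f' where f': "square_integrable f'" "f = abs_l2 f'"
      by (rule l2_abs_cases)
    show ?thesis
    proof (cases "norm c = 1")
      case True
      then have "(norm (l2_rotate c f))\<^sup>2 = (norm f)\<^sup>2"
        using f' square_integrable_rotate[OF True f'(1)]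
        by (simp add: l2_rotate.abs_eq l2_rel_def norm_l2_abs)
      then show ?thesis by simp
    next
      case False
      then show ?thesis
        using f' by (simp add: l2_rotate.abs_eq l2_rel_def)
    qed
  qed
qed

definition mult_op :: "linfty \<Rightarrow> (l2 \<Rightarrow>\<^sub>L l2)"
  where "mult_op f = Blinfun (linfty_mult_l2 f)"

lemma mult_op_apply: "mult_op f g = linfty_mult_l2 f g"
  by (simp add: mult_op_def bounded_linear_Blinfun_apply bounded_linear_linfty_mult_l2)

definition rot_op :: "complex \<Rightarrow> (l2 \<Rightarrow>\<^sub>L l2)"
  where "rot_op c = Blinfun (l2_rotate c)"

lemma rot_op_apply: "rot_op c g = l2_rotate c g"
  by (simp add: rot_op_def bounded_linear_Blinfun_apply bounded_linear_l2_rotate)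

lift_definition fourier_basis :: "int \<Rightarrow> l2" is "\<lambda>n z. z powi n"
proof -
  fix n :: int
  have sp: "AE z in haar. norm z = 1"
    by (rule AE_I2) (simp add: space_haar)
  have "square_integrable (\<lambda>z. z powi n)"
  proof (rule square_integrable_bound)
    have "(\<lambda>z::complex. z powi n) \<in> borel_measurable (restrict_space borel (sphere 0 1))"
    proof (rule borel_measurable_continuous_on_restrict)
      show "continuous_on (sphere 0 1) (\<lambda>z::complex. z powi n)"
        by (rule continuous_on_power_int) (auto intro: continuous_on_id)
    qed
    then show "(\<lambda>z. z powi n) \<in> borel_measurable haar"
      by (simp add: measurable_cong_sets[OF sets_haar refl])
    show "integrable haar (\<lambda>_. 1 :: real)"
      using finite_measure.integrable_const[OF finite_measure_haar] .
    show "AE z in haar. (norm (z powi n))\<^sup>2 \<le> 1"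
      using sp by eventually_elim (simp add: norm_power_int)
  qed
  then show "l2_rel (\<lambda>z. z powi n) (\<lambda>z. z powi n)"
    by (simp add: l2_rel_def)
qed

definition hardy_space :: "l2 set"
  where "hardy_space = closure (cspan (range (\<lambda>n::nat. fourier_basis (int n))))"

lemma csubspace_closure:
  fixes S :: "'a::complex_normed_vector set"
  assumes "csubspace S"
  shows "csubspace (closure S)"
proof -
  have "x + y \<in> closure S" if xy: "x \<in> closure S" "y \<in> closure S" for x y
  proof -
    obtain X where "\<And>n. X n \<in> S" "X \<longlonglongrightarrow> x"
      using xy(1) by (auto simp: closure_sequential)
    moreover obtain Y where "\<And>n. Y n \<in> S" "Y \<longlonglongrightarrow> y"
      using xy(2) by (auto simp: closure_sequential)
    ultimately show ?thesis
      unfolding closure_sequential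
      using assms by (intro exI[of _ "\<lambda>n. X n + Y n"])
        (auto intro: tendsto_add complex_vector.subspace_add)
  qed
  moreover have "c *\<^sub>C x \<in> closure S" if x: "x \<in> closure S" for c x
  proof -
    obtain X where "\<And>n. X n \<in> S" "X \<longlonglongrightarrow> x"
      using x by (auto simp: closure_sequential)
    then show ?thesis
      unfolding closure_sequential
      using assms bounded_linear.tendsto[OF bounded_linear_scaleC]
      by (intro exI[of _ "\<lambda>n. c *\<^sub>C X n"]) (auto intro: complex_vector.subspace_scale)
  qed
  moreover have "0 \<in> closure S"
    using assms closure_subset complex_vector.subspace_0 by blast
  ultimately show ?thesis
    by (simp add: complex_vector.subspace_def)
qed

lemma csubspace_hardy_space: "csubspace hardy_space"
  unfolding hardy_space_def by (intro csubspace_closure complex_vector.subspace_span)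

typedef hardy = hardy_space
  using complex_vector.subspace_0[OF csubspace_hardy_space] by blast

setup_lifting type_definition_hardy

instantiation hardy :: complex_inner
begin

lift_definition zero_hardy :: hardy is 0
  by (rule complex_vector.subspace_0[OF csubspace_hardy_space])
lift_definition plus_hardy :: "hardy \<Rightarrow> hardy \<Rightarrow> hardy" is "(+)"
  by (rule complex_vector.subspace_add[OF csubspace_hardy_space])
lift_definition uminus_hardy :: "hardy \<Rightarrow> hardy" is uminus
  by (rule complex_vector.subspace_neg[OF csubspace_hardy_space])
lift_definition minus_hardy :: "hardy \<Rightarrow> hardy \<Rightarrow> hardy" is "(-)"
  by (rule complex_vector.subspace_diff[OF csubspace_hardy_space])
lift_definition scaleC_hardy :: "complex \<Rightarrow> hardy \<Rightarrow> hardy" is "(*\<^sub>C)"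
  by (rule complex_vector.subspace_scale[OF csubspace_hardy_space])
lift_definition scaleR_hardy :: "real \<Rightarrow> hardy \<Rightarrow> hardy" is "(*\<^sub>R)"
  unfolding scaleC_of_real[symmetric]
  by (rule complex_vector.subspace_scale[OF csubspace_hardy_space])
lift_definition cinner_hardy :: "hardy \<Rightarrow> hardy \<Rightarrow> complex" is cinner .
lift_definition inner_hardy :: "hardy \<Rightarrow> hardy \<Rightarrow> real" is inner .
lift_definition norm_hardy :: "hardy \<Rightarrow> real" is norm .
definition sgn_hardy :: "hardy \<Rightarrow> hardy"
  where "sgn f = inverse (norm f) *\<^sub>R f" for f :: hardy
lift_definition dist_hardy :: "hardy \<Rightarrow> hardy \<Rightarrow> real" is dist .
definition uniformity_hardy :: "(hardy \<times> hardy) filter"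
  where "uniformity_hardy = (INF e\<in>{0<..}. principal {(f, g). dist f g < e})"
definition open_hardy :: "hardy set \<Rightarrow> bool"
  where "open_hardy U \<longleftrightarrow> (\<forall>f\<in>U. eventually (\<lambda>(f', g). f' = f \<longrightarrow> g \<in> U) uniformity)"

instance
proof
  fix f g h :: hardy and c d :: complex and r s :: real
  show "f + g + h = f + (g + h)" "f + g = g + f" "0 + f = f" "- f + f = 0" "f - g = f + - g"
    by (transfer, simp)+
  show "c *\<^sub>C (f + g) = c *\<^sub>C f + c *\<^sub>C g" "(c + d) *\<^sub>C f = c *\<^sub>C f + d *\<^sub>C f"
      "c *\<^sub>C d *\<^sub>C f = (c * d) *\<^sub>C f" "complex_of_real r *\<^sub>C f = r *\<^sub>R f"
    by (transfer, simp add: scaleC_add_right scaleC_add_left scaleC_scaleC scaleC_of_real)+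
  show "r *\<^sub>R (f + g) = r *\<^sub>R f + r *\<^sub>R g" "(r + s) *\<^sub>R f = r *\<^sub>R f + s *\<^sub>R f"
      "r *\<^sub>R s *\<^sub>R f = (r * s) *\<^sub>R f" "1 *\<^sub>R f = f"
    by (transfer, simp add: scaleR_add_right scaleR_add_left)+
  show "sgn f = inverse (norm f) *\<^sub>R f" by (rule sgn_hardy_def)
  show "dist f g = norm (f - g)" by transfer (rule dist_norm)
  show "uniformity = (INF e\<in>{0<..}. principal {(f :: hardy, g). dist f g < e})"
    by (rule uniformity_hardy_def)
  show "open U \<longleftrightarrow> (\<forall>f\<in>U. eventually (\<lambda>(f', g). f' = f \<longrightarrow> g \<in> U) uniformity)" for U :: "hardy set"
    by (rule open_hardy_def)
  show "cinner f g = cnj (cinner g f)"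
    by transfer (rule cinner_commute)
  show "cinner (f + g) h = cinner f h + cinner g h"
    by transfer (rule cinner_add_left)
  show "cinner (c *\<^sub>C f) g = c * cinner f g"
    by transfer (rule cinner_scaleC_left)
  show "inner f g = Re (cinner f g)"
    by transfer (rule inner_eq_Re_cinner)
  show "inner f g = inner g f"
    by transfer (rule inner_commute)
  show "inner (f + g) h = inner f h + inner g h"
    by transfer (rule inner_add_left)
  show "inner (r *\<^sub>R f) g = r * inner f g"
    by transfer simp
  show "0 \<le> inner f f"
    by transfer simp
  show "inner f f = 0 \<longleftrightarrow> f = 0"
    by transfer simp
  show "norm f = sqrt (inner f f)"
    by transfer (rule norm_eq_sqrt_inner)
qed

end

instance hardy :: complete_space
proof
  fix X :: "nat \<Rightarrow> hardy" assume "Cauchy X"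
  then have "Cauchy (\<lambda>n. Rep_hardy (X n))"
    by (simp add: Cauchy_def dist_hardy.rep_eq)
  then obtain L where L: "(\<lambda>n. Rep_hardy (X n)) \<longlonglongrightarrow> L"
    using Cauchy_convergent_iff convergent_def by blast
  moreover have "closed hardy_space"
    by (simp add: hardy_space_def)
  ultimately have "L \<in> hardy_space"
    using closed_sequentially[of hardy_space "\<lambda>n. Rep_hardy (X n)" L] Rep_hardy by simp
  then have "Rep_hardy (Abs_hardy L) = L"
    by (rule Abs_hardy_inverse)
  then have "X \<longlonglongrightarrow> Abs_hardy L"
    using L by (simp add: lim_sequentially dist_hardy.rep_eq)
  then show "convergent X"
    by (rule convergentI)
qed

instance hardy :: chilbert_space ..


section \<open>Operator algebras on a Hilbert space\<close>

definition bounded_ops :: "('a::chilbert_space \<Rightarrow>\<^sub>L 'b::chilbert_space) set"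
  where "bounded_ops = {T :: 'a \<Rightarrow>\<^sub>L 'b. \<forall>c x. T (c *\<^sub>C x) = c *\<^sub>C T x}"

text \<open>The operator described exists and is unique for every \<open>T \<in> bounded_ops\<close>, by the Riesz
  representation theorem.\<close>

definition adj :: "('a::chilbert_space \<Rightarrow>\<^sub>L 'b::chilbert_space) \<Rightarrow> ('b \<Rightarrow>\<^sub>L 'a)"
  where "adj T = (THE S :: 'b \<Rightarrow>\<^sub>L 'a. \<forall>x y. cinner (S x) y = cinner x (T y))"

definition orth_proj :: "'a::chilbert_space set \<Rightarrow> 'a \<Rightarrow> 'a"
  where "orth_proj M x = (THE y. y \<in> M \<and> (\<forall>m\<in>M. cinner (x - y) m = 0))"

definition unitary_op :: "('a::chilbert_space \<Rightarrow>\<^sub>L 'a) \<Rightarrow> bool"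
  where "unitary_op U \<longleftrightarrow>
    U \<in> bounded_ops \<and> adj U o\<^sub>L U = id_blinfun \<and> U o\<^sub>L adj U = id_blinfun"

definition cstar_subalgebra :: "('a::chilbert_space \<Rightarrow>\<^sub>L 'a) set \<Rightarrow> bool"
  where "cstar_subalgebra A \<longleftrightarrow>
    A \<subseteq> bounded_ops \<and> csubspace A \<and> (\<forall>S\<in>A. \<forall>T\<in>A. S o\<^sub>L T \<in> A) \<and> (\<forall>S\<in>A. adj S \<in> A) \<and> closed A"

definition cstar_generated :: "('a::chilbert_space \<Rightarrow>\<^sub>L 'a) set \<Rightarrow> ('a \<Rightarrow>\<^sub>L 'a) set"
  where "cstar_generated G = \<Inter>{A. cstar_subalgebra A \<and> G \<subseteq> A}"

definition commutant :: "('a::chilbert_space \<Rightarrow>\<^sub>L 'a) set \<Rightarrow> ('a \<Rightarrow>\<^sub>L 'a) set"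
  where "commutant M = {T \<in> bounded_ops. \<forall>S\<in>M. S o\<^sub>L T = T o\<^sub>L S}"

definition von_neumann_algebra :: "('a::chilbert_space \<Rightarrow>\<^sub>L 'a) set \<Rightarrow> bool"
  where "von_neumann_algebra M \<longleftrightarrow>
    M \<subseteq> bounded_ops \<and> (\<forall>S\<in>M. adj S \<in> M) \<and> commutant (commutant M) = M"

definition von_neumann_generated :: "('a::chilbert_space \<Rightarrow>\<^sub>L 'a) set \<Rightarrow> ('a \<Rightarrow>\<^sub>L 'a) set"
  where "von_neumann_generated G = \<Inter>{M. von_neumann_algebra M \<and> G \<subseteq> M}"

definition op_le :: "('a::chilbert_space \<Rightarrow>\<^sub>L 'a) \<Rightarrow> ('a \<Rightarrow>\<^sub>L 'a) \<Rightarrow> bool"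
  where "op_le S T \<longleftrightarrow> (\<forall>x. \<exists>r\<ge>0. cinner ((T - S) x) x = complex_of_real r)"

definition selfadjoint_part :: "('a::chilbert_space \<Rightarrow>\<^sub>L 'a) set \<Rightarrow> ('a \<Rightarrow>\<^sub>L 'a) set"
  where "selfadjoint_part M = {T \<in> M. adj T = T}"

definition is_op_sup ::
    "('a::chilbert_space \<Rightarrow>\<^sub>L 'a) set \<Rightarrow> ('a \<Rightarrow>\<^sub>L 'a) set \<Rightarrow> ('a \<Rightarrow>\<^sub>L 'a) \<Rightarrow> bool"
  where "is_op_sup M D s \<longleftrightarrow> s \<in> selfadjoint_part M \<and> (\<forall>d\<in>D. op_le d s) \<and>
    (\<forall>t\<in>selfadjoint_part M. (\<forall>d\<in>D. op_le d t) \<longrightarrow> op_le s t)"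

definition normal_on ::
    "('a::chilbert_space \<Rightarrow>\<^sub>L 'a) set \<Rightarrow> (('a \<Rightarrow>\<^sub>L 'a) \<Rightarrow> ('a \<Rightarrow>\<^sub>L 'a)) \<Rightarrow> bool"
  where "normal_on M \<theta> \<longleftrightarrow>
    (\<forall>D s. D \<noteq> {} \<and> D \<subseteq> selfadjoint_part M \<and>
      (\<forall>a\<in>D. \<forall>b\<in>D. \<exists>c\<in>D. op_le a c \<and> op_le b c) \<and> is_op_sup M D s
      \<longrightarrow> is_op_sup M (\<theta> ` D) (\<theta> s))"

definition unital_star_endomorphism ::
    "('a::chilbert_space \<Rightarrow>\<^sub>L 'a) set \<Rightarrow> (('a \<Rightarrow>\<^sub>L 'a) \<Rightarrow> ('a \<Rightarrow>\<^sub>L 'a)) \<Rightarrow> bool"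
  where "unital_star_endomorphism M \<theta> \<longleftrightarrow>
    \<theta> ` M \<subseteq> M \<and> \<theta> id_blinfun = id_blinfun \<and>
    (\<forall>c. \<forall>S\<in>M. \<theta> (c *\<^sub>C S) = c *\<^sub>C \<theta> S) \<and>
    (\<forall>S\<in>M. \<theta> (adj S) = adj (\<theta> S)) \<and>
    (\<forall>S\<in>M. \<forall>T\<in>M. \<theta> (S + T) = \<theta> S + \<theta> T \<and> \<theta> (S o\<^sub>L T) = \<theta> S o\<^sub>L \<theta> T)"


section \<open>Minimal dilations and the peripheral Poisson boundary\<close>

text \<open>The inclusion of Hilbert spaces \<open>H \<subseteq> K\<close> is an isometry \<open>J\<close> from \<open>H\<close> into \<open>K\<close>, so
  that the projection of \<open>K\<close> onto \<open>H\<close> is \<open>p = J J\<^sup>*\<close>, an operator \<open>x\<close> on \<open>H\<close> is identified with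
  \<open>J x J\<^sup>*\<close> (written \<open>p x p\<close> when \<open>H\<close> is a subspace), and the operator on \<open>H\<close> that is identified
  with \<open>p z p\<close> is \<open>J\<^sup>* z J\<close>.\<close>

definition isometric_embedding :: "('h::chilbert_space \<Rightarrow>\<^sub>L 'k::chilbert_space) \<Rightarrow> bool"
  where "isometric_embedding J \<longleftrightarrow> J \<in> bounded_ops \<and> (\<forall>h. norm (J h) = norm h)"

definition embed_op ::
    "('h::chilbert_space \<Rightarrow>\<^sub>L 'k::chilbert_space) \<Rightarrow> ('h \<Rightarrow>\<^sub>L 'h) \<Rightarrow> ('k \<Rightarrow>\<^sub>L 'k)"
  where "embed_op J x = J o\<^sub>L x o\<^sub>L adj J"

definition compress_op ::
    "('h::chilbert_space \<Rightarrow>\<^sub>L 'k::chilbert_space) \<Rightarrow> ('k \<Rightarrow>\<^sub>L 'k) \<Rightarrow> ('h \<Rightarrow>\<^sub>L 'h)"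
  where "compress_op J z = adj J o\<^sub>L z o\<^sub>L J"

text \<open>\<open>dilation_word J \<theta> [x\<^sub>n, \<dots>, x\<^sub>1] h\<close> is the vector \<open>\<theta>\<^sup>n(x\<^sub>n) \<cdots> \<theta>(x\<^sub>1) h\<close>.\<close>

fun dilation_word ::
    "('h::chilbert_space \<Rightarrow>\<^sub>L 'k::chilbert_space) \<Rightarrow> (('k \<Rightarrow>\<^sub>L 'k) \<Rightarrow> ('k \<Rightarrow>\<^sub>L 'k)) \<Rightarrow>
      ('h \<Rightarrow>\<^sub>L 'h) list \<Rightarrow> 'h \<Rightarrow> 'k"
  where
    "dilation_word J \<theta> [] h = J h"
  | "dilation_word J \<theta> (x # xs) h =
      (\<theta> ^^ length (x # xs)) (embed_op J x) (dilation_word J \<theta> xs h)"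

definition minimal_dilation ::
    "('h::chilbert_space \<Rightarrow>\<^sub>L 'h) set \<Rightarrow> (('h \<Rightarrow>\<^sub>L 'h) \<Rightarrow> ('h \<Rightarrow>\<^sub>L 'h)) \<Rightarrow>
      ('h \<Rightarrow>\<^sub>L 'k::chilbert_space) \<Rightarrow> ('k \<Rightarrow>\<^sub>L 'k) set \<Rightarrow> (('k \<Rightarrow>\<^sub>L 'k) \<Rightarrow> ('k \<Rightarrow>\<^sub>L 'k)) \<Rightarrow> bool"
  where "minimal_dilation A \<tau> J B \<theta> \<longleftrightarrow>
    isometric_embedding J \<and>
    von_neumann_algebra B \<and>
    embed_op J ` A = (\<lambda>z. embed_op J (compress_op J z)) ` B \<and>
    unital_star_endomorphism B \<theta> \<and>
    normal_on B \<theta> \<and>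
    (\<forall>x\<in>A. \<forall>n. (\<tau> ^^ n) x = compress_op J ((\<theta> ^^ n) (embed_op J x))) \<and>
    closure (cspan {dilation_word J \<theta> xs h | xs h. set xs \<subseteq> A}) = UNIV \<and>
    B = von_neumann_generated {(\<theta> ^^ n) (embed_op J x) | n x. x \<in> A}"

definition peripheral_space ::
    "('a::chilbert_space \<Rightarrow>\<^sub>L 'a) set \<Rightarrow> (('a \<Rightarrow>\<^sub>L 'a) \<Rightarrow> ('a \<Rightarrow>\<^sub>L 'a)) \<Rightarrow> ('a \<Rightarrow>\<^sub>L 'a) set"
  where "peripheral_space A \<tau> = closure (cspan {x \<in> A. \<exists>c. norm c = 1 \<and> \<tau> x = c *\<^sub>C x})"

definition peripheral_product ::
    "('h::chilbert_space \<Rightarrow>\<^sub>L 'k::chilbert_space) \<Rightarrow> ('k \<Rightarrow>\<^sub>L 'k) set \<Rightarrow> (('k \<Rightarrow>\<^sub>L 'k) \<Rightarrow> ('k \<Rightarrow>\<^sub>L 'k)) \<Rightarrow>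
      ('h \<Rightarrow>\<^sub>L 'h) \<Rightarrow> ('h \<Rightarrow>\<^sub>L 'h) \<Rightarrow> ('h \<Rightarrow>\<^sub>L 'h)"
  where "peripheral_product J B \<theta> x y =
    (let T_inv = inv_into (peripheral_space B \<theta>) (compress_op J)
     in compress_op J (T_inv x o\<^sub>L T_inv y))"

text \<open>The target is a space of operators with its own product \<open>prd\<close>, but with the linear
  structure, norm and involution of operators.\<close>

definition star_isomorphism ::
    "(('a::chilbert_space \<Rightarrow>\<^sub>L 'a) \<Rightarrow> ('b::chilbert_space \<Rightarrow>\<^sub>L 'b)) \<Rightarrow> ('a \<Rightarrow>\<^sub>L 'a) set \<Rightarrow>
      ('b \<Rightarrow>\<^sub>L 'b) set \<Rightarrow> (('b \<Rightarrow>\<^sub>L 'b) \<Rightarrow> ('b \<Rightarrow>\<^sub>L 'b) \<Rightarrow> ('b \<Rightarrow>\<^sub>L 'b)) \<Rightarrow> bool"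
  where "star_isomorphism \<phi> A P prd \<longleftrightarrow>
    bij_betw \<phi> A P \<and>
    (\<forall>X\<in>A. norm (\<phi> X) = norm X \<and> \<phi> (adj X) = adj (\<phi> X)) \<and>
    (\<forall>c. \<forall>X\<in>A. \<phi> (c *\<^sub>C X) = c *\<^sub>C \<phi> X) \<and>
    (\<forall>X\<in>A. \<forall>Y\<in>A. \<phi> (X + Y) = \<phi> X + \<phi> Y \<and> \<phi> (X o\<^sub>L Y) = prd (\<phi> X) (\<phi> Y))"


section \<open>The dynamical system, its covariant representation, and the shift\<close>

definition rotation_action :: "complex \<Rightarrow> linfty \<Rightarrow> linfty"
  where "rotation_action c = linfty_rotate (inverse c)"

text \<open>The circle acts as a discrete group: on \<^typ>\<open>linfty\<close> the orbit maps of
  \<^const>\<open>rotation_action\<close> are not norm continuous.\<close>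

definition circle_cstar_dynamical_system :: "(complex \<Rightarrow> linfty \<Rightarrow> linfty) \<Rightarrow> bool"
  where "circle_cstar_dynamical_system \<alpha> \<longleftrightarrow>
    (\<forall>c\<in>sphere 0 1. bij (\<alpha> c) \<and>
      (\<forall>f g. \<alpha> c (f + g) = \<alpha> c f + \<alpha> c g \<and> \<alpha> c (f * g) = \<alpha> c f * \<alpha> c g) \<and>
      (\<forall>f. \<alpha> c (linfty_cnj f) = linfty_cnj (\<alpha> c f)) \<and>
      (\<forall>d f. \<alpha> c (d *\<^sub>C f) = d *\<^sub>C \<alpha> c f)) \<and>
    \<alpha> 1 = id \<and>
    (\<forall>c\<in>sphere 0 1. \<forall>d\<in>sphere 0 1. \<alpha> (c * d) = \<alpha> c \<circ> \<alpha> d)"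

definition covariant_representation ::
    "(complex \<Rightarrow> linfty \<Rightarrow> linfty) \<Rightarrow> (linfty \<Rightarrow> ('a::chilbert_space \<Rightarrow>\<^sub>L 'a)) \<Rightarrow>
      (complex \<Rightarrow> ('a \<Rightarrow>\<^sub>L 'a)) \<Rightarrow> bool"
  where "covariant_representation \<alpha> \<pi> u \<longleftrightarrow>
    range \<pi> \<subseteq> bounded_ops \<and> \<pi> 1 = id_blinfun \<and>
    (\<forall>f g. \<pi> (f + g) = \<pi> f + \<pi> g \<and> \<pi> (f * g) = \<pi> f o\<^sub>L \<pi> g) \<and>
    (\<forall>f. \<pi> (linfty_cnj f) = adj (\<pi> f)) \<and>
    (\<forall>c f. \<pi> (c *\<^sub>C f) = c *\<^sub>C \<pi> f) \<and>
    (\<forall>c\<in>sphere 0 1. unitary_op (u c)) \<and>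
    (\<forall>c\<in>sphere 0 1. \<forall>d\<in>sphere 0 1. u (c * d) = u c o\<^sub>L u d) \<and>
    (\<forall>c\<in>sphere 0 1. \<forall>f. u c o\<^sub>L \<pi> f o\<^sub>L adj (u c) = \<pi> (\<alpha> c f))"

definition rot_rep :: "complex \<Rightarrow> (l2 \<Rightarrow>\<^sub>L l2)"
  where "rot_rep c = rot_op (cnj c)"

definition hardy_basis :: "nat \<Rightarrow> hardy"
  where "hardy_basis n = Abs_hardy (fourier_basis (int n))"

definition unilateral_shift :: "hardy \<Rightarrow>\<^sub>L hardy"
  where "unilateral_shift =
    (THE S :: hardy \<Rightarrow>\<^sub>L hardy. S \<in> bounded_ops \<and> (\<forall>n. S (hardy_basis n) = hardy_basis (Suc n)))"

definition shift_map :: "(hardy \<Rightarrow>\<^sub>L hardy) \<Rightarrow> (hardy \<Rightarrow>\<^sub>L hardy)"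
  where "shift_map X = adj unilateral_shift o\<^sub>L X o\<^sub>L unilateral_shift"

definition hardy_compression :: "(l2 \<Rightarrow>\<^sub>L l2) \<Rightarrow> (hardy \<Rightarrow>\<^sub>L hardy)"
  where "hardy_compression X = Blinfun (\<lambda>h. Abs_hardy
    (orth_proj hardy_space (X (orth_proj hardy_space (Rep_hardy h)))))"

end

theory Submission
  imports Defs
begin

text \<open>Write \<open>U\<close> for the bilateral shift on \<open>L\<^sup>2\<close> of the circle, \<open>J\<close> for the inclusion of the Hardy
  space, and \<open>\<theta>(X) = U\<^sup>* X U\<close>.  As the unilateral shift is the restriction of \<open>U\<close>, the
  endomorphism \<open>\<theta>\<close> of all bounded operators is a minimal dilation of \<open>\<tau>\<close>
  (\<open>shift_minimal_dilation\<close>); minimality comes down to the completeness of the trigonometric system.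
  The compression belonging to this dilation is \<open>hardy_compression\<close>, so the isomorphism follows from
  two facts; the dynamical system and its covariance are computed on representatives.

  The first one is that the generated algebra is the peripheral space of \<open>\<theta>\<close>.  Rotation by \<open>c\<close>
  satisfies \<open>V\<^sub>c U = c U V\<^sub>c\<close>.  Hence, if \<open>U\<^sup>* X U = c X\<close> with \<open>\<bar>c\<bar> = 1\<close>, then \<open>X V\<^sub>c\<^sup>*\<close> commutes with
  \<open>U\<close>; and the commutant of \<open>U\<close> consists of the multiplication operators
  (\<open>commutant_bilateral_shift\<close>).  So the eigenoperators are exactly the products \<open>M\<^sub>f V\<^sub>c\<close>, and these
  span the generated algebra densely.

  The second one concerns an arbitrary minimal dilation \<open>(J, B, \<theta>)\<close> of a unital map \<open>\<tau>\<close> on all bounded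
  operators: compression is an isometric bijection between the peripheral spaces of \<open>\<theta>\<close> and \<open>\<tau>\<close>
  (\<open>compress_bij\<close>), and the product that it induces does not depend on the dilation
  (\<open>peripheral_product_unique\<close>).  Everything rests on the projections \<open>p\<^sub>n = \<theta>\<^sup>n(J J\<^sup>*)\<close>, which
  increase strongly to the identity, and on the identity
  \<open>p\<^sub>m \<theta>\<^sup>n(x) p\<^sub>m = \<theta>\<^sup>m(\<tau>\<^sup>n\<^sup>-\<^sup>m(x))\<close>.
  If \<open>\<tau>(x) = c x\<close>, the operators \<open>c\<^sup>-\<^sup>n \<theta>\<^sup>n(x)\<close> are therefore compressions of one another, and their strong
  limit is an eigenoperator of \<open>\<theta>\<close> over \<open>x\<close>.  Compression does not decrease the norm of a linear
  combination \<open>z\<close> of eigenoperators because \<open>\<theta>\<^sup>n(z)\<close> returns close to \<open>z\<close> for suitable large \<open>n\<close>, while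
  \<open>p\<^sub>n \<theta>\<^sup>n(z) p\<^sub>n\<close> is the image of the compression of \<open>z\<close> under a homomorphism, and homomorphisms
  are contractive (\<open>star_homomorphism_contractive\<close>).  Finally, for eigenoperators \<open>x\<close> and \<open>y\<close> with
  eigenvalues \<open>c\<close> and \<open>d\<close> the induced product is the strong limit of \<open>(c d)\<^sup>-\<^sup>n \<tau>\<^sup>n(x y)\<close>, which is
  expressed by \<open>\<tau>\<close> alone.\<close>

section \<open>Hilbert space preliminaries\<close>

lemma cinner_add_right: "cinner x (y + z) = cinner x y + cinner x (z :: 'a::complex_inner)"
  by (metis cinner_add_left cinner_commute complex_cnj_add)

lemma cinner_scaleC_right: "cinner x (c *\<^sub>C y) = cnj c * cinner x (y :: 'a::complex_inner)"
  by (metis cinner_commute cinner_scaleC_left complex_cnj_mult)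

lemma cinner_zero_left [simp]: "cinner 0 (x :: 'a::complex_inner) = 0"
  using cinner_add_left[of 0 0 x] by simp

lemma cinner_zero_right [simp]: "cinner (x :: 'a::complex_inner) 0 = 0"
  using cinner_add_right[of x 0 0] by simp

lemma cinner_minus_left: "cinner (- x) y = - cinner x (y :: 'a::complex_inner)"
  using cinner_add_left[of x "- x" y] by (simp add: eq_neg_iff_add_eq_0 add.commute)

lemma cinner_diff_left: "cinner (x - y) z = cinner x z - cinner y (z :: 'a::complex_inner)"
  using cinner_add_left[of x "- y" z] by (simp add: cinner_minus_left)

lemma cinner_diff_right: "cinner x (y - z) = cinner x y - cinner x (z :: 'a::complex_inner)"
  by (metis cinner_diff_left cinner_commute complex_cnj_diff)

lemmas cinner_simps = cinner_add_left cinner_add_right cinner_diff_left cinner_diff_right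
  cinner_scaleC_left cinner_scaleC_right

lemma scaleC_minus_one [simp]: "(- 1) *\<^sub>C x = - (x :: 'a::complex_vector)"
  using complex_vector.scale_minus_left[of 1 x] by simp

lemma cinner_eq_zero_iff [simp]: "cinner x x = 0 \<longleftrightarrow> (x :: 'a::complex_inner) = 0"
  by (simp add: cinner_self)

lemma cinner_ext:
  assumes "\<And>z. cinner x z = cinner y (z :: 'a::complex_inner)"
  shows "x = y"
  using assms[of "x - y"] cinner_eq_zero_iff[of "x - y"] by (simp add: cinner_diff_left)

text \<open>Rotating \<open>x\<close> by a phase makes the inner product real, which reduces the inequality to the
  real one.\<close>

lemma norm_cinner_le: "norm (cinner x y) \<le> norm x * norm (y :: 'a::complex_inner)"
proof (cases "cinner x y = 0")
  case False
  define z where "z = cinner x y"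
  define c where "c = cnj z / complex_of_real (norm z)"
  have z: "norm z \<noteq> 0" using False by (simp add: z_def)
  then have c: "norm c = 1"
    by (simp add: c_def norm_divide)
  have "c * z = complex_of_real ((norm z)\<^sup>2) / complex_of_real (norm z)"
    unfolding complex_norm_square by (simp add: c_def mult.commute)
  also have "\<dots> = norm z"
    using z by (simp add: power2_eq_square)
  finally have "c * cinner x y = norm (cinner x y)"
    by (simp add: z_def)
  then have "norm (cinner x y) = inner (c *\<^sub>C x) y"
    by (simp add: inner_eq_Re_cinner cinner_scaleC_left)
  also have "\<dots> \<le> norm (c *\<^sub>C x) * norm y"
    by (rule norm_cauchy_schwarz)
  finally show ?thesis
    by (simp add: norm_scaleC c)
qed simp

lemma bounded_bilinear_cinner:
  "bounded_bilinear (cinner :: 'a::complex_inner \<Rightarrow> 'a \<Rightarrow> complex)"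
proof
  fix a a' b b' :: 'a and r :: real
  show "cinner (r *\<^sub>R a) b = r *\<^sub>R cinner a b" "cinner a (r *\<^sub>R b) = r *\<^sub>R cinner a b"
    by (simp_all add: scaleC_of_real[symmetric] cinner_simps scaleR_conv_of_real)
  show "\<exists>K. \<forall>a b. norm (cinner a (b :: 'a)) \<le> norm a * norm b * K"
    by (intro exI[of _ 1]) (simp add: norm_cinner_le)
qed (simp_all add: cinner_simps)

lemma tendsto_scaleC:
  "(f \<longlongrightarrow> l) F \<Longrightarrow> ((\<lambda>x. c *\<^sub>C f x) \<longlongrightarrow> c *\<^sub>C (l :: 'a::complex_normed_vector)) F"
  by (rule bounded_linear.tendsto[OF bounded_linear_scaleC])

lemma subset_closed_span: "E \<subseteq> closure (cspan (E :: 'a::complex_normed_vector set))"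
  using complex_vector.span_superset closure_subset by (rule order_trans)

lemma csubspace_closed_span: "csubspace (closure (cspan (E :: 'a::complex_normed_vector set)))"
  by (intro csubspace_closure complex_vector.subspace_span)

lemma norm_diff_scaleR_square:
  "(norm (v - t *\<^sub>R m))\<^sup>2 = (norm v)\<^sup>2 - 2 * t * inner v m + t * (t * (norm (m :: 'a::real_inner))\<^sup>2)"
  by (simp add: power2_norm_eq_inner inner_diff_left inner_diff_right inner_commute)

text \<open>A minimizing sequence for the distance to \<open>M\<close> is Cauchy by the parallelogram law.\<close>

lemma orthogonal_decomposition:
  fixes x :: "'a::chilbert_space"
  assumes M: "csubspace M" and cl: "closed M"
  obtains y where "y \<in> M" "\<And>m. m \<in> M \<Longrightarrow> cinner (x - y) m = 0"
proof -
  have M0: "0 \<in> M" and Madd: "\<And>a b. a \<in> M \<Longrightarrow> b \<in> M \<Longrightarrow> a + b \<in> M"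
    and Msc: "\<And>c a. a \<in> M \<Longrightarrow> c *\<^sub>C a \<in> M"
    using M by (auto simp: complex_vector.subspace_def)
  have MscR: "r *\<^sub>R a \<in> M" if "a \<in> M" for r a
    using Msc[OF that, of "complex_of_real r"] by (simp add: scaleC_of_real)
  define d where "d = infdist x M"
  have d0: "0 \<le> d" by (simp add: d_def infdist_nonneg)
  have dle: "d \<le> norm (x - y)" if "y \<in> M" for y
    using infdist_le[OF that, of x] by (simp add: d_def dist_norm)
  have "\<exists>y\<in>M. norm (x - y) < sqrt (d\<^sup>2 + inverse (Suc n))" for n
  proof -
    have "d < sqrt (d\<^sup>2 + inverse (Suc n))"
      by (rule real_less_rsqrt) simp
    then obtain y where "y \<in> M" "dist x y < sqrt (d\<^sup>2 + inverse (Suc n))"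
      using cInf_lessD[of "dist x ` M"] M0 infdist_notempty[of M x] unfolding d_def
      by (metis (no_types, lifting) empty_iff imageE image_is_empty)
    then show ?thesis by (auto simp: dist_norm)
  qed
  then obtain Y where Y: "\<And>n. Y n \<in> M" "\<And>n. norm (x - Y n) < sqrt (d\<^sup>2 + inverse (Suc n))"
    by metis
  have Y2: "(norm (x - Y n))\<^sup>2 \<le> d\<^sup>2 + inverse (Suc n)" for n
  proof -
    have "(norm (x - Y n))\<^sup>2 \<le> (sqrt (d\<^sup>2 + inverse (Suc n)))\<^sup>2"
      by (intro power_mono less_imp_le[OF Y(2)]) simp
    then show ?thesis by simp
  qed
  have par: "(norm (Y m - Y n))\<^sup>2 \<le> 2 * (inverse (Suc m) + inverse (Suc n))" for m n
  proof -
    let ?a = "x - Y m" and ?b = "x - Y n"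
    have "(1/2) *\<^sub>R (Y m + Y n) \<in> M"
      using Y(1) Madd MscR by blast
    then have "d \<le> norm (x - (1/2) *\<^sub>R (Y m + Y n))"
      by (rule dle)
    also have "x - (1/2) *\<^sub>R (Y m + Y n) = (1/2) *\<^sub>R (?a + ?b)"
      by (simp add: algebra_simps flip: scaleR_add_left)
    finally have "2 * d \<le> norm (?a + ?b)"
      by simp
    then have "4 * d\<^sup>2 \<le> (norm (?a + ?b))\<^sup>2"
      using power_mono[of "2 * d" "norm (?a + ?b)" 2] d0 by (simp add: power_mult_distrib)
    moreover have "(norm (?a - ?b))\<^sup>2 + (norm (?a + ?b))\<^sup>2 = 2 * (norm ?a)\<^sup>2 + 2 * (norm ?b)\<^sup>2"
      by (simp add: power2_norm_eq_inner inner_simps inner_commute)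
    moreover have "norm (?a - ?b) = norm (Y m - Y n)"
      by (simp add: norm_minus_commute)
    ultimately show ?thesis
      using Y2[of m] Y2[of n] by (simp del: inverse_eq_divide)
  qed
  have "Cauchy Y"
  proof (rule CauchyI)
    fix e :: real assume e: "0 < e"
    then have "\<forall>\<^sub>F n in sequentially. inverse (real (Suc n)) < e\<^sup>2 / 4"
      by (intro order_tendstoD(2)[OF LIMSEQ_inverse_real_of_nat]) simp
    then obtain N where N: "\<And>n. n \<ge> N \<Longrightarrow> inverse (real (Suc n)) < e\<^sup>2 / 4"
      by (auto simp: eventually_sequentially)
    show "\<exists>N. \<forall>m\<ge>N. \<forall>n\<ge>N. norm (Y m - Y n) < e"
    proof (intro exI[of _ N] allI impI)
      fix m n assume mn: "N \<le> m" "N \<le> n"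
      then have "(norm (Y m - Y n))\<^sup>2 < e\<^sup>2"
        using par[of m n] N[OF mn(1)] N[OF mn(2)] by argo
      then show "norm (Y m - Y n) < e"
        using e by (intro power_less_imp_less_base[of _ 2 e]) auto
    qed
  qed
  then obtain y where y: "Y \<longlonglongrightarrow> y"
    using Cauchy_convergent_iff convergent_def by blast
  have yM: "y \<in> M"
    using closed_sequentially[OF cl] Y(1) y by blast
  have "(norm (x - y))\<^sup>2 \<le> d\<^sup>2 + 0"
  proof (rule LIMSEQ_le)
    show "(\<lambda>n. (norm (x - Y n))\<^sup>2) \<longlonglongrightarrow> (norm (x - y))\<^sup>2"
      by (intro tendsto_intros y)
    show "(\<lambda>n. d\<^sup>2 + inverse (real (Suc n))) \<longlonglongrightarrow> d\<^sup>2 + 0"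
      by (intro tendsto_add tendsto_const LIMSEQ_inverse_real_of_nat)
  qed (use Y2 in auto)
  then have xy: "(norm (x - y))\<^sup>2 \<le> (norm (x - m))\<^sup>2" if "m \<in> M" for m
    using power_mono[OF dle[OF that] d0, of 2] by linarith
  have re: "inner (x - y) m = 0" if m: "m \<in> M" for m
  proof (cases "m = 0")
    case False
    define t where "t = inner (x - y) m / (norm m)\<^sup>2"
    have "(norm (x - y))\<^sup>2 \<le> (norm (x - (y + t *\<^sub>R m)))\<^sup>2"
      by (intro xy Madd yM MscR m)
    also have "x - (y + t *\<^sub>R m) = (x - y) - t *\<^sub>R m" by simp
    also have "(norm ((x - y) - t *\<^sub>R m))\<^sup>2
        = (norm (x - y))\<^sup>2 - 2 * t * inner (x - y) m + t * (t * (norm m)\<^sup>2)"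
      by (rule norm_diff_scaleR_square)
    also have "t * (norm m)\<^sup>2 = inner (x - y) m"
      using False by (simp add: t_def)
    finally have "t * inner (x - y) m \<le> 0" by simp
    then have "(inner (x - y) m)\<^sup>2 / (norm m)\<^sup>2 \<le> 0"
      by (simp add: t_def power2_eq_square)
    then show ?thesis
      using False by (simp add: divide_le_0_iff)
  qed simp
  have "cinner (x - y) m = 0" if m: "m \<in> M" for m
  proof -
    have "Re (cinner (x - y) m) = 0" "Re (cinner (x - y) (\<i> *\<^sub>C m)) = 0"
      using re[OF m] re[OF Msc[OF m]] by (simp_all add: inner_eq_Re_cinner)
    then show ?thesis
      by (simp add: cinner_scaleC_right complex_eq_iff)
  qed
  then show thesis using that yM by blast
qed

lemma dense_csubspaceI:
  fixes M :: "'a::chilbert_space set"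
  assumes "csubspace M" "\<And>x. (\<And>m. m \<in> M \<Longrightarrow> cinner x m = 0) \<Longrightarrow> x = 0"
  shows "closure M = UNIV"
proof -
  have "x \<in> closure M" for x
  proof -
    obtain y where y: "y \<in> closure M" "\<And>m. m \<in> closure M \<Longrightarrow> cinner (x - y) m = 0"
      using orthogonal_decomposition[OF csubspace_closure[OF assms(1)] closed_closure, of x] by blast
    have "x - y = 0"
      using assms(2) y(2) closure_subset by blast
    then show ?thesis using y(1) by simp
  qed
  then show ?thesis by blast
qed

text \<open>The representing vector is a multiple of a vector \<open>w\<close> orthogonal to the kernel, because
  \<open>f w *\<^sub>C x - f x *\<^sub>C w\<close> lies in the kernel for every \<open>x\<close>.\<close>

lemma riesz_representation:
  fixes f :: "'a::chilbert_space \<Rightarrow> complex"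
  assumes "bounded_linear f" "\<And>c x. f (c *\<^sub>C x) = c * f x"
  obtains y where "\<And>x. f x = cinner x y"
proof (cases "\<forall>x. f x = 0")
  case True
  then show thesis using that[of 0] by simp
next
  case False
  interpret f: bounded_linear f by fact
  define K where "K = {x. f x = 0}"
  obtain x0 where x0: "f x0 \<noteq> 0" using False by blast
  have "csubspace K"
    by (auto simp: K_def complex_vector.subspace_def f.zero f.add assms(2))
  moreover have "closed K"
    unfolding K_def by (intro closed_Collect_eq continuous_intros f.continuous_on)
  ultimately obtain k where k: "k \<in> K" "\<And>m. m \<in> K \<Longrightarrow> cinner (x0 - k) m = 0"
    using orthogonal_decomposition[of K x0] by blast
  define w where "w = x0 - k"
  have fw: "f w \<noteq> 0" using x0 k(1) by (simp add: w_def f.diff K_def)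
  then have w: "cinner w w \<noteq> 0" using f.zero by auto
  have "f x = cinner x (cnj (f w / cinner w w) *\<^sub>C w)" for x
  proof -
    have "f w *\<^sub>C x - f x *\<^sub>C w \<in> K"
      by (simp add: K_def f.diff assms(2))
    then have "cinner w (f w *\<^sub>C x - f x *\<^sub>C w) = 0"
      using k(2) by (simp add: w_def)
    then have "cinner (f w *\<^sub>C x - f x *\<^sub>C w) w = 0"
      using cinner_commute by (metis complex_cnj_zero)
    then show ?thesis
      using w by (simp add: cinner_simps field_simps)
  qed
  then show thesis using that by blast
qed

section \<open>Bounded operators and adjoints\<close>

lemma bounded_ops_scaleC: "T \<in> bounded_ops \<Longrightarrow> T (c *\<^sub>C x) = c *\<^sub>C T x"
  by (simp add: bounded_ops_def)

lemma scaleC_blinfun_apply [simp]: "blinfun_apply (c *\<^sub>C T) x = c *\<^sub>C blinfun_apply T x"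
  by (simp add: scaleC_blinfun.rep_eq)

lemma bounded_ops_id [simp]: "id_blinfun \<in> bounded_ops"
  by (simp add: bounded_ops_def)

lemma csubspace_bounded_ops: "csubspace bounded_ops"
  by (auto simp: complex_vector.subspace_def bounded_ops_def blinfun.add_left scaleC_add_right
      scaleC_scaleC mult.commute)

lemma bounded_ops_compose [simp]:
  "S \<in> bounded_ops \<Longrightarrow> T \<in> bounded_ops \<Longrightarrow> S o\<^sub>L T \<in> bounded_ops"
  by (simp add: bounded_ops_def)

lemma bounded_ops_zero [simp]: "0 \<in> bounded_ops"
  and bounded_ops_add [simp]: "S \<in> bounded_ops \<Longrightarrow> T \<in> bounded_ops \<Longrightarrow> S + T \<in> bounded_ops"
  and bounded_ops_diff [simp]: "S \<in> bounded_ops \<Longrightarrow> T \<in> bounded_ops \<Longrightarrow> S - T \<in> bounded_ops"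
  and bounded_ops_scale [simp]: "S \<in> bounded_ops \<Longrightarrow> c *\<^sub>C S \<in> bounded_ops"
  using csubspace_bounded_ops
  by (auto intro: complex_vector.subspace_0 complex_vector.subspace_add
      complex_vector.subspace_diff complex_vector.subspace_scale)

lemma tendsto_blinfun_apply:
  "(T \<longlongrightarrow> T') F \<Longrightarrow> ((\<lambda>n. blinfun_apply (T n) x) \<longlongrightarrow> blinfun_apply T' x) F"
  by (intro tendsto_intros)

lemma bounded_ops_strong_limit:
  assumes "\<And>n. T n \<in> bounded_ops" "\<And>x. (\<lambda>n. blinfun_apply (T n) x) \<longlonglongrightarrow> blinfun_apply T' x"
  shows "T' \<in> bounded_ops"
  unfolding bounded_ops_def
proof (clarify)
  fix c x
  have "(\<lambda>n. T n (c *\<^sub>C x)) \<longlonglongrightarrow> c *\<^sub>C T' x"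
    using tendsto_scaleC[OF assms(2)] by (simp add: bounded_ops_scaleC[OF assms(1)])
  then show "T' (c *\<^sub>C x) = c *\<^sub>C T' x"
    using assms(2) LIMSEQ_unique by blast
qed

lemma closed_bounded_ops: "closed (bounded_ops :: ('a::chilbert_space \<Rightarrow>\<^sub>L 'b::chilbert_space) set)"
  unfolding closed_sequential_limits
  using bounded_ops_strong_limit tendsto_blinfun_apply by blast

lemma blinfun_compose_algebra:
  "(S + T) o\<^sub>L R = (S o\<^sub>L R) + (T o\<^sub>L R)" "R' o\<^sub>L (S + T) = (R' o\<^sub>L S) + (R' o\<^sub>L T)"
  "(S - T) o\<^sub>L R = (S o\<^sub>L R) - (T o\<^sub>L R)" "R' o\<^sub>L (S - T) = (R' o\<^sub>L S) - (R' o\<^sub>L T)"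
  by (auto intro!: blinfun_eqI simp: blinfun.add_left blinfun.add_right blinfun.diff_left
      blinfun.diff_right)

lemma blinfun_compose_scaleC:
  "(c *\<^sub>C S) o\<^sub>L R = c *\<^sub>C (S o\<^sub>L R)"
  "S \<in> bounded_ops \<Longrightarrow> S o\<^sub>L (c *\<^sub>C R) = c *\<^sub>C (S o\<^sub>L R)"
  by (auto intro!: blinfun_eqI simp: bounded_ops_scaleC)

lemma blinfun_compose_id [simp]: "S o\<^sub>L id_blinfun = S" "id_blinfun o\<^sub>L S = S"
  by (auto intro!: blinfun_eqI)

lemma blinfun_compose_assoc: "(S o\<^sub>L T) o\<^sub>L R = S o\<^sub>L (T o\<^sub>L R)"
  by (rule blinfun_eqI) simp

lemma blinfun_compose_eqD: "S o\<^sub>L T = R \<Longrightarrow> blinfun_apply S (blinfun_apply T x) = blinfun_apply R x"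
  by auto

lemma blinfun_compose_zeros: "S o\<^sub>L 0 = 0" "0 o\<^sub>L S = 0"
  by (rule blinfun_eqI, simp)+

lemma adj_eqI:
  fixes T :: "'a::chilbert_space \<Rightarrow>\<^sub>L 'b::chilbert_space"
  assumes "\<And>x y. cinner (blinfun_apply S x) y = cinner x (T y)"
  shows "adj T = S"
  unfolding adj_def
proof (rule the_equality)
  fix S' :: "'b \<Rightarrow>\<^sub>L 'a" assume "\<forall>x y. cinner (S' x) y = cinner x (T y)"
  then show "S' = S"
    using assms by (intro blinfun_eqI cinner_ext) simp
qed (use assms in simp)

lemma adj_exists:
  fixes T :: "'a::chilbert_space \<Rightarrow>\<^sub>L 'b::chilbert_space"
  assumes "T \<in> bounded_ops"
  obtains S where "\<And>x y. cinner (blinfun_apply S x) y = cinner x (T y)"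
proof -
  have "\<exists>s. \<forall>y. cinner (T y) x = cinner y s" for x
    using riesz_representation[of "\<lambda>y. cinner (T y) x"]
      bounded_linear_compose[OF bounded_bilinear.bounded_linear_left[OF bounded_bilinear_cinner]
        blinfun.bounded_linear_right[of T], of x]
    by (metis bounded_ops_scaleC[OF assms] cinner_scaleC_left)
  then obtain s where s: "\<And>x y. cinner (T y) x = cinner y (s x)"
    by metis
  have s': "cinner (s x) y = cinner x (T y)" for x y
    using s[of y x] cinner_commute by metis
  have "bounded_linear s"
  proof (rule bounded_linear_intro[where K = "norm T"])
    show "s (x + y) = s x + s y" for x y
      by (rule cinner_ext) (simp add: s' cinner_add_left)
    show "s (r *\<^sub>R x) = r *\<^sub>R s x" for r x
      by (rule cinner_ext) (simp add: s' cinner_scaleC_left flip: scaleC_of_real)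
    show "norm (s x) \<le> norm x * norm T" for x
    proof (cases "s x = 0")
      case False
      have "(norm (s x))\<^sup>2 = norm (cinner (s x) (s x))"
        by (simp add: cinner_self norm_power)
      also have "\<dots> \<le> norm x * norm (T (s x))"
        unfolding s' by (rule norm_cinner_le)
      also have "\<dots> \<le> norm x * (norm T * norm (s x))"
        by (intro mult_left_mono norm_blinfun) simp
      finally show ?thesis
        using False by (simp add: power2_eq_square mult.assoc)
    qed simp
  qed
  then show thesis
    using that[of "Blinfun s"] s' by (simp add: bounded_linear_Blinfun_apply)
qed

lemma cinner_adj_left: "T \<in> bounded_ops \<Longrightarrow> cinner (adj T x) y = cinner x (T y)"
  by (metis adj_eqI adj_exists)

lemma cinner_adj_right: "T \<in> bounded_ops \<Longrightarrow> cinner x (adj T y) = cinner (T x) y"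
  by (metis cinner_adj_left cinner_commute)

lemma bounded_opsI: "(\<And>c x. blinfun_apply T (c *\<^sub>C x) = c *\<^sub>C blinfun_apply T x) \<Longrightarrow> T \<in> bounded_ops"
  by (simp add: bounded_ops_def)

lemma adj_in_bounded_ops [simp]: "T \<in> bounded_ops \<Longrightarrow> adj T \<in> bounded_ops"
  by (intro bounded_opsI cinner_ext) (simp add: cinner_adj_left cinner_scaleC_left)

lemma adj_adj [simp]: "T \<in> bounded_ops \<Longrightarrow> adj (adj T) = T"
  by (rule adj_eqI) (simp add: cinner_adj_right)

lemma adj_compose:
  "S \<in> bounded_ops \<Longrightarrow> T \<in> bounded_ops \<Longrightarrow> adj (S o\<^sub>L T) = adj T o\<^sub>L adj S"
  by (rule adj_eqI) (simp add: cinner_adj_left)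

lemma adj_add: "S \<in> bounded_ops \<Longrightarrow> T \<in> bounded_ops \<Longrightarrow> adj (S + T) = adj S + adj T"
  by (rule adj_eqI) (simp add: cinner_adj_left blinfun.add_left cinner_simps)

lemma adj_scaleC: "T \<in> bounded_ops \<Longrightarrow> adj (c *\<^sub>C T) = cnj c *\<^sub>C adj T"
  by (rule adj_eqI) (simp add: cinner_adj_left cinner_simps)

lemma adj_id [simp]: "adj id_blinfun = id_blinfun"
  by (rule adj_eqI) simp

lemma norm_adj_le:
  assumes "T \<in> bounded_ops"
  shows "norm (adj T) \<le> norm T"
proof (rule norm_blinfun_bound)
  fix x
  show "norm (adj T x) \<le> norm T * norm x"
  proof (cases "adj T x = 0")
    case False
    have "(norm (adj T x))\<^sup>2 = norm (cinner (adj T x) (adj T x))"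
      by (simp add: cinner_self norm_power)
    also have "\<dots> \<le> norm x * norm (T (adj T x))"
      unfolding cinner_adj_left[OF assms] by (rule norm_cinner_le)
    also have "\<dots> \<le> norm x * (norm T * norm (adj T x))"
      by (intro mult_left_mono norm_blinfun) simp
    finally show ?thesis
      using False by (simp add: power2_eq_square mult.commute)
  qed simp
qed simp

lemma norm_adj [simp]: "T \<in> bounded_ops \<Longrightarrow> norm (adj T) = norm T"
  by (metis adj_adj adj_in_bounded_ops norm_adj_le order_antisym)

section \<open>Contractivity of homomorphisms of operator algebras\<close>

lemma neumann_inverse:
  fixes a :: "'a::chilbert_space \<Rightarrow>\<^sub>L 'a"
  assumes a: "a \<in> bounded_ops" "norm a < 1"
  obtains r where "r \<in> bounded_ops" "r o\<^sub>L (id_blinfun - a) = id_blinfun"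
proof -
  define p where "p n = ((\<lambda>b. b o\<^sub>L a) ^^ n) id_blinfun" for n
  have p0: "p 0 = id_blinfun" and pS: "p (Suc n) = p n o\<^sub>L a" for n
    by (simp_all add: p_def)
  have pb: "p n \<in> bounded_ops" for n
    by (induction n) (simp_all add: p0 pS a)
  have pn: "norm (p n) \<le> norm a ^ n" for n
  proof (induction n)
    case 0
    show ?case by (auto simp: p0 intro!: norm_blinfun_bound)
  next
    case (Suc n)
    have "norm (p (Suc n)) \<le> norm (p n) * norm a"
      unfolding pS by (rule norm_blinfun_compose)
    also have "\<dots> \<le> norm a ^ n * norm a"
      by (intro mult_right_mono Suc) simp
    finally show ?case by (simp add: mult.commute)
  qed
  have sm: "summable p"
    by (rule summable_comparison_test'[where g = "\<lambda>n. norm a ^ n" and N = 0])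
      (use a(2) pn in \<open>auto intro!: summable_geometric\<close>)
  define r where "r = suminf p"
  have "(\<lambda>n. sum p {..<n}) \<longlonglongrightarrow> r"
    unfolding r_def by (rule summable_LIMSEQ[OF sm])
  moreover have "sum p {..<n} \<in> bounded_ops" for n
    by (rule complex_vector.subspace_sum[OF csubspace_bounded_ops]) (rule pb)
  ultimately have "r \<in> bounded_ops"
    using bounded_ops_strong_limit[of "\<lambda>n. sum p {..<n}" r] tendsto_blinfun_apply by blast
  moreover have "r o\<^sub>L a = (\<Sum>n. p n o\<^sub>L a)"
    unfolding r_def
    by (rule bounded_linear.suminf[OF bounded_bilinear.bounded_linear_left[OF
          bounded_bilinear_blinfun_compose] sm])
  then have "r o\<^sub>L a = r - id_blinfun"
    using suminf_split_head[OF sm] by (simp add: pS p0 r_def)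
  ultimately show thesis
    using that by (simp add: blinfun_compose_algebra)
qed

text \<open>If \<open>norm d > norm x\<close> for \<open>d = \<rho> x\<close>, then \<open>1 - x\<^sup>*x / (norm d)\<^sup>2\<close> has an inverse by the
  Neumann series, and \<open>\<rho>\<close> carries it to a left inverse of \<open>1 - d\<^sup>*d / (norm d)\<^sup>2\<close>.  But vectors at
  which \<open>d\<close> almost attains its norm are almost annihilated by the latter operator.\<close>

lemma star_homomorphism_contractive:
  fixes \<rho> :: "('a::chilbert_space \<Rightarrow>\<^sub>L 'a) \<Rightarrow> ('b::chilbert_space \<Rightarrow>\<^sub>L 'b)"
  assumes ops: "\<And>x. x \<in> bounded_ops \<Longrightarrow> \<rho> x \<in> bounded_ops"
    and add: "\<And>x y. x \<in> bounded_ops \<Longrightarrow> y \<in> bounded_ops \<Longrightarrow> \<rho> (x + y) = \<rho> x + \<rho> y"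
    and scale: "\<And>c x. x \<in> bounded_ops \<Longrightarrow> \<rho> (c *\<^sub>C x) = c *\<^sub>C \<rho> x"
    and mult: "\<And>x y. x \<in> bounded_ops \<Longrightarrow> y \<in> bounded_ops \<Longrightarrow> \<rho> (x o\<^sub>L y) = \<rho> x o\<^sub>L \<rho> y"
    and adj: "\<And>x. x \<in> bounded_ops \<Longrightarrow> \<rho> (adj x) = adj (\<rho> x)"
    and x: "x \<in> bounded_ops"
  shows "norm (\<rho> x) \<le> norm x"
proof (rule ccontr)
  assume "\<not> norm (\<rho> x) \<le> norm x"
  define d where "d = \<rho> x"
  then have less: "norm x < norm d" using \<open>\<not> _\<close> by simp
  have d: "d \<in> bounded_ops" by (simp add: d_def ops x)
  define M where "M = (norm d)\<^sup>2"
  have d0: "0 < norm d" using less by (rule le_less_trans[OF norm_ge_zero])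
  then have M: "0 < M" by (simp add: M_def)
  define c where "c = complex_of_real (1 / M) *\<^sub>C (adj x o\<^sub>L x)"
  have c: "c \<in> bounded_ops" by (simp add: c_def x)
  have "norm c = norm (adj x o\<^sub>L x) / M"
    unfolding c_def norm_scaleC norm_of_real using M by simp
  also have "\<dots> \<le> (norm x)\<^sup>2 / M"
    using M norm_blinfun_compose[of "adj x" x] x
    by (intro divide_right_mono) (simp_all add: power2_eq_square)
  also have "\<dots> < 1"
    using M less power_strict_mono[of "norm x" "norm d" 2] by (simp add: M_def)
  finally obtain r where r: "r \<in> bounded_ops" "r o\<^sub>L (id_blinfun - c) = id_blinfun"
    using neumann_inverse[OF c] by blast
  define q where "q = \<rho> id_blinfun"
  have mul_q: "\<rho> y o\<^sub>L q = \<rho> y" "q o\<^sub>L \<rho> y = \<rho> y" if "y \<in> bounded_ops" for y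
    using mult[OF that bounded_ops_id] mult[OF bounded_ops_id that] by (simp_all add: q_def)
  have rc: "\<rho> c = complex_of_real (1 / M) *\<^sub>C (adj d o\<^sub>L d)"
    by (simp add: c_def scale x mult adj d_def)
  have "q = \<rho> (r o\<^sub>L (id_blinfun + (-1) *\<^sub>C c))"
    using r by (simp add: q_def)
  also have "\<dots> = \<rho> r o\<^sub>L (q - \<rho> c)"
    using r(1) c by (simp only: mult add scale bounded_ops_add bounded_ops_scale bounded_ops_id)
      (simp add: q_def)
  finally have "q = \<rho> r - (\<rho> r o\<^sub>L \<rho> c)"
    using mul_q[OF r(1)] by (simp add: blinfun_compose_algebra)
  then have q: "\<rho> r o\<^sub>L \<rho> c = \<rho> r - q"
    by simp
  \<comment> \<open>\<open>\<rho> r\<close> is a left inverse only on the range of the projection \<open>q\<close>; on the kernel of \<open>q\<close>, where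
    \<open>\<rho> c\<close> vanishes, the identity takes over.\<close>
  define R where "R = \<rho> r + (id_blinfun - q)"
  have "R o\<^sub>L (id_blinfun - \<rho> c) = id_blinfun"
    using q mul_q[OF c] by (simp add: R_def blinfun_compose_algebra)
  then have R: "k = R (k - \<rho> c k)" for k
    by (metis blinfun_apply_blinfun_compose blinfun.diff_left blinfun_apply_id_blinfun id_apply)
  \<comment> \<open>A vector \<open>k\<close> at which \<open>d\<close> attains its norm up to the factor \<open>sqrt (1 - e)\<close> will satisfy
    \<open>(norm k)\<^sup>2 \<le> (norm R)\<^sup>2 * e * (norm k)\<^sup>2\<close>, which is impossible for this \<open>e\<close>.\<close>
  define e where "e = 1 / (4 * ((norm R)\<^sup>2 + 1))"
  have e: "0 < e"
    by (simp add: e_def add_nonneg_pos)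
  have e1: "e \<le> 1"
    unfolding e_def by (intro divide_le_eq_1[THEN iffD2]) (simp add: add_nonneg_pos)
  have "norm d * sqrt (1 - e) < norm d"
    using d0 e by simp
  moreover have "norm d \<le> s" if "0 \<le> s" "\<And>k. norm (d k) \<le> s * norm k" for s
    using that by (rule norm_blinfun_bound)
  moreover have "0 \<le> norm d * sqrt (1 - e)"
    using e1 by simp
  ultimately obtain k where k: "norm d * sqrt (1 - e) * norm k < norm (d k)"
    by (meson not_le)
  have k0: "0 < norm k"
    using k by (cases "k = 0") auto
  have "(norm d * sqrt (1 - e) * norm k)\<^sup>2 < (norm (d k))\<^sup>2"
    using k e1 by (intro power_strict_mono) auto
  then have k2: "M * (1 - e) * (norm k)\<^sup>2 < (norm (d k))\<^sup>2"
    using e1 by (simp add: power_mult_distrib M_def)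
  define w where "w = adj d (d k)"
  have "norm w \<le> norm d * norm (d k)"
    using norm_blinfun[of "adj d" "d k"] d by (simp add: w_def)
  then have w: "(norm w)\<^sup>2 \<le> M * (norm (d k))\<^sup>2"
    unfolding M_def power_mult_distrib[symmetric] by (rule power_mono) simp
  have ip: "inner k w = (norm (d k))\<^sup>2"
    using d by (simp add: w_def inner_eq_Re_cinner cinner_adj_right cinner_self)
  have "(norm (k - (1 / M) *\<^sub>R w))\<^sup>2
      = (norm k)\<^sup>2 - 2 * (1 / M) * inner k w + (1 / M) * ((1 / M) * (norm w)\<^sup>2)"
    by (rule norm_diff_scaleR_square)
  also have "\<dots> \<le> (norm k)\<^sup>2 - 2 * (1 / M) * inner k w + (1 / M) * ((1 / M) * (M * (norm (d k))\<^sup>2))"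
    using w M by (intro add_left_mono mult_left_mono) auto
  also have "\<dots> = (norm k)\<^sup>2 - (norm (d k))\<^sup>2 / M"
    using M by (simp add: ip)
  also have "\<dots> < e * (norm k)\<^sup>2"
    using k2 M by (simp add: field_simps)
  finally have small: "(norm (k - \<rho> c k))\<^sup>2 < e * (norm k)\<^sup>2"
    by (simp add: rc w_def scaleC_of_real blinfun.scaleR_left del: of_real_divide)
  have "norm k \<le> norm R * norm (k - \<rho> c k)"
    using norm_blinfun[of R "k - \<rho> c k"] R[of k] by simp
  then have "(norm k)\<^sup>2 \<le> (norm R)\<^sup>2 * (norm (k - \<rho> c k))\<^sup>2"
    unfolding power_mult_distrib[symmetric] by (rule power_mono) simp
  also have "\<dots> \<le> (norm R)\<^sup>2 * (e * (norm k)\<^sup>2)"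
    using small by (intro mult_left_mono) auto
  finally have "1 \<le> (norm R)\<^sup>2 * e"
    using k0 by (simp add: mult.assoc[symmetric])
  moreover have "a * (1 / (4 * (a + 1))) < 1" if "0 \<le> a" for a :: real
    using that by (simp add: field_simps)
  ultimately show False
    unfolding e_def by (meson not_le zero_le_power2)
qed

section \<open>Isometric embeddings and von Neumann algebras\<close>

text \<open>Norms determine real inner products by polarization, and \<open>x\<close> and \<open>\<i> x\<close> together determine
  complex ones.\<close>

lemma isometric_embedding_adj_compose:
  fixes J :: "'h::chilbert_space \<Rightarrow>\<^sub>L 'k::chilbert_space"
  assumes "isometric_embedding J"
  shows "adj J o\<^sub>L J = id_blinfun"
proof -
  have J: "J \<in> bounded_ops" and n: "\<And>h. norm (J h) = norm h"
    using assms by (auto simp: isometric_embedding_def)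
  have re: "inner (J x) (J y) = inner x y" for x y
  proof -
    have "inner a b = ((norm (a + b))\<^sup>2 - (norm a)\<^sup>2 - (norm b)\<^sup>2) / 2" for a b :: "'c::real_inner"
      by (simp add: power2_norm_eq_inner inner_add_left inner_add_right inner_commute)
    then show ?thesis
      by (metis n blinfun.add_right)
  qed
  have "cinner (J x) (J y) = cinner x y" for x y
  proof -
    have "Re (cinner (J x) (J y)) = Re (cinner x y)"
      using re[of x y] by (simp add: inner_eq_Re_cinner)
    moreover have "Re (cinner (J x) (J (\<i> *\<^sub>C y))) = Re (cinner x (\<i> *\<^sub>C y))"
      using re[of x "\<i> *\<^sub>C y"] by (simp add: inner_eq_Re_cinner)
    ultimately show ?thesis
      by (simp add: bounded_ops_scaleC[OF J] cinner_scaleC_right complex_eq_iff)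
  qed
  then show ?thesis
    by (intro blinfun_eqI cinner_ext) (simp add: cinner_adj_left[OF J])
qed

lemma isometric_embedding_adj_apply:
  "isometric_embedding J \<Longrightarrow> blinfun_apply (adj J) (blinfun_apply J h) = h"
  using blinfun_compose_eqD[OF isometric_embedding_adj_compose, of J h] by simp

lemma isometric_embedding_norm_le:
  fixes J :: "'h::chilbert_space \<Rightarrow>\<^sub>L 'k::chilbert_space"
  assumes "isometric_embedding J"
  shows "norm J \<le> 1" "norm (adj J) \<le> 1"
proof -
  show "norm J \<le> 1"
    using assms by (intro norm_blinfun_bound) (auto simp: isometric_embedding_def)
  then show "norm (adj J) \<le> 1"
    using assms by (simp add: isometric_embedding_def)
qed

lemma compress_op_apply: "compress_op J z h = adj J (z (J h))"
  by (simp add: compress_op_def)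

lemma embed_op_apply: "embed_op J x k = J (x (adj J k))"
  by (simp add: embed_op_def)

lemma compress_embed_op: "isometric_embedding J \<Longrightarrow> compress_op J (embed_op J x) = x"
  by (intro blinfun_eqI) (simp add: compress_op_apply embed_op_apply isometric_embedding_adj_apply)

lemma bounded_linear_compress_op: "bounded_linear (compress_op J)"
  unfolding compress_op_def
  by (rule bounded_linear_compose[OF
        bounded_bilinear.bounded_linear_left[OF bounded_bilinear_blinfun_compose]
        bounded_bilinear.bounded_linear_right[OF bounded_bilinear_blinfun_compose]])

lemma compress_op_add: "compress_op J (z + w) = compress_op J z + compress_op J w"
  by (simp add: compress_op_def blinfun_compose_algebra)

lemma compress_op_scaleC:
  "J \<in> bounded_ops \<Longrightarrow> compress_op J (c *\<^sub>C z) = c *\<^sub>C compress_op J z"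
  by (simp add: compress_op_def blinfun_compose_scaleC)

lemma compress_op_in_bounded_ops:
  "J \<in> bounded_ops \<Longrightarrow> z \<in> bounded_ops \<Longrightarrow> compress_op J z \<in> bounded_ops"
  by (simp add: compress_op_def)

lemma compress_op_adj:
  "J \<in> bounded_ops \<Longrightarrow> z \<in> bounded_ops \<Longrightarrow> compress_op J (adj z) = adj (compress_op J z)"
  by (simp add: compress_op_def adj_compose blinfun_compose_assoc)

lemma norm_compress_op_le:
  assumes "isometric_embedding J"
  shows "norm (compress_op J z) \<le> norm z"
proof (rule norm_blinfun_bound)
  fix h
  have "norm (compress_op J z h) \<le> norm (adj J) * norm (z (J h))"
    unfolding compress_op_apply by (rule norm_blinfun)
  also have "\<dots> \<le> 1 * norm (z (J h))"
    by (intro mult_right_mono isometric_embedding_norm_le assms) simp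
  also have "\<dots> \<le> norm z * norm h"
    using norm_blinfun[of z "J h"] assms by (simp add: isometric_embedding_def)
  finally show "norm (compress_op J z h) \<le> norm z * norm h" .
qed simp

lemma embed_op_hom:
  assumes "isometric_embedding J"
  shows "x \<in> bounded_ops \<Longrightarrow> embed_op J x \<in> bounded_ops"
    and "embed_op J (x + y) = embed_op J x + embed_op J y"
    and "embed_op J (c *\<^sub>C x) = c *\<^sub>C embed_op J x"
    and "embed_op J (x o\<^sub>L y) = embed_op J x o\<^sub>L embed_op J y"
    and "x \<in> bounded_ops \<Longrightarrow> embed_op J (adj x) = adj (embed_op J x)"
proof -
  have J: "J \<in> bounded_ops" using assms by (simp add: isometric_embedding_def)
  note JJ = isometric_embedding_adj_apply[OF assms]
  show "x \<in> bounded_ops \<Longrightarrow> embed_op J x \<in> bounded_ops"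
    "x \<in> bounded_ops \<Longrightarrow> embed_op J (adj x) = adj (embed_op J x)"
    using J by (simp_all add: embed_op_def adj_compose blinfun_compose_assoc)
  show "embed_op J (x + y) = embed_op J x + embed_op J y"
    "embed_op J (c *\<^sub>C x) = c *\<^sub>C embed_op J x"
    "embed_op J (x o\<^sub>L y) = embed_op J x o\<^sub>L embed_op J y"
    by (auto intro!: blinfun_eqI simp: embed_op_apply blinfun.add_left blinfun.add_right JJ
        bounded_ops_scaleC[OF J])
qed

lemma embed_compress_op:
  "embed_op J (compress_op J z) = (embed_op J id_blinfun o\<^sub>L z) o\<^sub>L embed_op J id_blinfun"
  by (intro blinfun_eqI) (simp add: embed_op_apply compress_op_apply)

lemma commutantD: "T \<in> commutant M \<Longrightarrow> S \<in> M \<Longrightarrow> S o\<^sub>L T = T o\<^sub>L S"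
  by (simp add: commutant_def)

lemma commutant_subset: "commutant M \<subseteq> bounded_ops"
  by (auto simp: commutant_def)

lemma commutant_algebra:
  assumes M: "M \<subseteq> bounded_ops" and S: "S \<in> commutant M" and T: "T \<in> commutant M"
  shows "id_blinfun \<in> commutant M" "S + T \<in> commutant M" "c *\<^sub>C S \<in> commutant M"
    "S o\<^sub>L T \<in> commutant M"
proof -
  have ST: "S \<in> bounded_ops" "T \<in> bounded_ops"
    using S T by (auto simp: commutant_def)
  show "id_blinfun \<in> commutant M"
    by (simp add: commutant_def)
  show "S + T \<in> commutant M"
    using ST S T by (auto simp: commutant_def blinfun_compose_algebra)
  show "c *\<^sub>C S \<in> commutant M"
    using ST S M by (auto simp: commutant_def blinfun_compose_scaleC)
  have "R o\<^sub>L (S o\<^sub>L T) = (S o\<^sub>L T) o\<^sub>L R" if "R \<in> M" for R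
    using commutantD[OF S that] commutantD[OF T that]
    by (metis blinfun_compose_assoc)
  then show "S o\<^sub>L T \<in> commutant M"
    using ST by (simp add: commutant_def)
qed

lemma commutant_strong_limit:
  assumes T: "\<And>n. T n \<in> commutant M" and lim: "\<And>x. (\<lambda>n. blinfun_apply (T n) x) \<longlonglongrightarrow> blinfun_apply T' x"
  shows "T' \<in> commutant M"
proof -
  have "T' \<in> bounded_ops"
    using T commutant_subset by (intro bounded_ops_strong_limit[OF _ lim]) blast
  moreover have "S o\<^sub>L T' = T' o\<^sub>L S" if S: "S \<in> M" for S
  proof (rule blinfun_eqI)
    fix x
    have "(\<lambda>n. S (T n x)) \<longlonglongrightarrow> S (T' x)"
      by (rule bounded_linear.tendsto[OF blinfun.bounded_linear_right lim])
    moreover have "S (T n x) = T n (S x)" for n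
      using blinfun_compose_eqD[OF commutantD[OF T S]] by simp
    ultimately have "(\<lambda>n. T n (S x)) \<longlonglongrightarrow> S (T' x)" by simp
    then show "(S o\<^sub>L T') x = (T' o\<^sub>L S) x"
      using LIMSEQ_unique[OF lim] by simp
  qed
  ultimately show ?thesis by (simp add: commutant_def)
qed

lemma von_neumann_algebra_closed:
  assumes B: "von_neumann_algebra B"
  shows "id_blinfun \<in> B" "B \<subseteq> bounded_ops"
    and "S \<in> B \<Longrightarrow> T \<in> B \<Longrightarrow> S + T \<in> B" "S \<in> B \<Longrightarrow> c *\<^sub>C S \<in> B"
    "S \<in> B \<Longrightarrow> T \<in> B \<Longrightarrow> S o\<^sub>L T \<in> B" "S \<in> B \<Longrightarrow> adj S \<in> B"
  using B commutant_algebra[of "commutant B"] commutant_subset[of B]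
    commutant_algebra(1)[of "commutant B" id_blinfun id_blinfun]
  unfolding von_neumann_algebra_def by (auto simp: commutant_def)

lemma von_neumann_algebra_strong_limit:
  assumes "von_neumann_algebra B" "\<And>n. T n \<in> B"
    "\<And>x. (\<lambda>n. blinfun_apply (T n) x) \<longlonglongrightarrow> blinfun_apply T' x"
  shows "T' \<in> B"
  using commutant_strong_limit[of T "commutant B" T'] assms
  by (simp add: von_neumann_algebra_def)

lemma strong_limit_exists:
  fixes T :: "nat \<Rightarrow> 'a::banach \<Rightarrow>\<^sub>L 'b::banach"
  assumes bd: "\<And>n. norm (T n) \<le> K" and conv: "\<And>x. convergent (\<lambda>n. T n x)"
  obtains T' where "\<And>x. (\<lambda>n. T n x) \<longlonglongrightarrow> blinfun_apply T' x"
proof -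
  define f where "f x = lim (\<lambda>n. T n x)" for x
  have f: "(\<lambda>n. T n x) \<longlonglongrightarrow> f x" for x
    using conv[of x] by (simp add: f_def convergent_LIMSEQ_iff)
  have "bounded_linear f"
  proof (rule bounded_linear_intro[where K = K])
    show "f (x + y) = f x + f y" for x y
      using tendsto_add[OF f[of x] f[of y]] f[of "x + y"]
      by (simp add: blinfun.add_right LIMSEQ_unique)
    show "f (r *\<^sub>R x) = r *\<^sub>R f x" for r x
      using tendsto_scaleR[OF tendsto_const f[of x]] f[of "r *\<^sub>R x"]
      by (simp add: blinfun.scaleR_right LIMSEQ_unique)
    show "norm (f x) \<le> norm x * K" for x
    proof (rule LIMSEQ_le_const2[OF tendsto_norm[OF f]], intro exI allI impI)
      fix n
      have "norm (T n x) \<le> norm (T n) * norm x" by (rule norm_blinfun)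
      also have "\<dots> \<le> K * norm x" by (intro mult_right_mono bd) simp
      finally show "norm (T n x) \<le> norm x * K" by (simp add: mult.commute)
    qed
  qed
  then show thesis
    using that[of "Blinfun f"] f by (simp add: bounded_linear_Blinfun_apply)
qed

lemma unital_star_endomorphism_funpow:
  assumes B: "id_blinfun \<in> B" and th: "unital_star_endomorphism B \<theta>"
  shows "unital_star_endomorphism B (\<theta> ^^ n)"
proof (induction n)
  case 0
  show ?case by (simp add: unital_star_endomorphism_def)
next
  case (Suc n)
  have in_B: "(\<theta> ^^ n) S \<in> B" if "S \<in> B" for S
    using Suc that by (auto simp: unital_star_endomorphism_def)
  show ?case
    using th Suc by (auto simp: unital_star_endomorphism_def in_B)
qed

section \<open>Minimal dilations of unital maps on all bounded operators\<close>

text \<open>The algebra is that of all bounded operators on \<open>H\<close>, so that inverses of its elements, as used for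
  contractivity, lie in it.\<close>

locale unital_dilation =
  fixes \<tau> :: "('h::chilbert_space \<Rightarrow>\<^sub>L 'h) \<Rightarrow> ('h \<Rightarrow>\<^sub>L 'h)" and J :: "'h \<Rightarrow>\<^sub>L 'k::chilbert_space"
    and B \<theta>
  assumes dilation: "minimal_dilation bounded_ops \<tau> J B \<theta>"
    and tau_id: "\<tau> id_blinfun = id_blinfun"
begin

lemma J_isometric: "isometric_embedding J"
  and vn: "von_neumann_algebra B"
  and endo: "unital_star_endomorphism B \<theta>"
  and dil: "x \<in> bounded_ops \<Longrightarrow> (\<tau> ^^ n) x = compress_op J ((\<theta> ^^ n) (embed_op J x))"
  and dense: "closure (cspan {dilation_word J \<theta> xs h | xs h. set xs \<subseteq> bounded_ops}) = UNIV"
  using dilation unfolding minimal_dilation_def by blast+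

lemma J_ops: "J \<in> bounded_ops"
  using J_isometric by (simp add: isometric_embedding_def)

lemmas J_adj_J = isometric_embedding_adj_apply[OF J_isometric]

lemmas B_closed = von_neumann_algebra_closed[OF vn]

lemma B_ops: "z \<in> B \<Longrightarrow> z \<in> bounded_ops"
  using B_closed(2) by blast

lemma embed_in_B: "x \<in> bounded_ops \<Longrightarrow> embed_op J x \<in> B"
proof -
  assume x: "x \<in> bounded_ops"
  have "B = von_neumann_generated {(\<theta> ^^ n) (embed_op J x) | n x. x \<in> bounded_ops}"
    using dilation by (simp add: minimal_dilation_def)
  moreover have "embed_op J x \<in> {(\<theta> ^^ n) (embed_op J x) | n x. x \<in> bounded_ops}"
    using x by (intro CollectI exI[of _ 0] exI[of _ x]) simp
  ultimately show ?thesis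
    by (auto simp: von_neumann_generated_def)
qed

lemma funpow_endo:
  shows "S \<in> B \<Longrightarrow> (\<theta> ^^ n) S \<in> B"
    and "S \<in> B \<Longrightarrow> (\<theta> ^^ n) (c *\<^sub>C S) = c *\<^sub>C (\<theta> ^^ n) S"
    and "S \<in> B \<Longrightarrow> (\<theta> ^^ n) (adj S) = adj ((\<theta> ^^ n) S)"
    and "S \<in> B \<Longrightarrow> T \<in> B \<Longrightarrow> (\<theta> ^^ n) (S + T) = (\<theta> ^^ n) S + (\<theta> ^^ n) T"
    and "S \<in> B \<Longrightarrow> T \<in> B \<Longrightarrow> (\<theta> ^^ n) (S o\<^sub>L T) = (\<theta> ^^ n) S o\<^sub>L (\<theta> ^^ n) T"
  using unital_star_endomorphism_funpow[OF B_closed(1) endo, of n]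
  by (auto simp: unital_star_endomorphism_def)

text \<open>The \<open>n\<close>-th translate in \<open>B\<close> of the copy of the operators on \<open>H\<close>, and its unit.\<close>

definition lift :: "nat \<Rightarrow> ('h \<Rightarrow>\<^sub>L 'h) \<Rightarrow> ('k \<Rightarrow>\<^sub>L 'k)"
  where "lift n x = (\<theta> ^^ n) (embed_op J x)"

abbreviation proj :: "nat \<Rightarrow> 'k \<Rightarrow>\<^sub>L 'k"
  where "proj n \<equiv> lift n id_blinfun"

lemma lift_hom:
  shows "x \<in> bounded_ops \<Longrightarrow> lift n x \<in> B"
    and "x \<in> bounded_ops \<Longrightarrow> lift n (c *\<^sub>C x) = c *\<^sub>C lift n x"
    and "x \<in> bounded_ops \<Longrightarrow> lift n (adj x) = adj (lift n x)"
    and "x \<in> bounded_ops \<Longrightarrow> y \<in> bounded_ops \<Longrightarrow> lift n (x + y) = lift n x + lift n y"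
    and "x \<in> bounded_ops \<Longrightarrow> y \<in> bounded_ops \<Longrightarrow> lift n (x o\<^sub>L y) = lift n x o\<^sub>L lift n y"
  by (simp_all add: lift_def funpow_endo embed_in_B embed_op_hom[OF J_isometric])

lemma lift_ops: "x \<in> bounded_ops \<Longrightarrow> lift n x \<in> bounded_ops"
  using lift_hom(1) B_ops by blast

lemma norm_lift_le: "x \<in> bounded_ops \<Longrightarrow> norm (lift n x) \<le> norm x"
  by (rule star_homomorphism_contractive) (simp_all add: lift_hom lift_ops)

lemma funpow_lift: "(\<theta> ^^ m) (lift n x) = lift (m + n) x"
  by (simp add: lift_def funpow_add)

lemma compress_lift: "x \<in> bounded_ops \<Longrightarrow> compress_op J (lift n x) = (\<tau> ^^ n) x"
  by (simp add: lift_def dil)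

lemma lift_0: "lift 0 x = embed_op J x"
  by (simp add: lift_def)

lemma proj_lift: "x \<in> bounded_ops \<Longrightarrow> proj n o\<^sub>L lift n x = lift n x"
  using lift_hom(5)[of id_blinfun x n] by simp

lemma adj_proj: "adj (proj n) = proj n"
  using lift_hom(3)[of id_blinfun n] by simp

lemma norm_proj_le: "norm (proj n) \<le> 1"
proof -
  have "norm (id_blinfun :: 'h \<Rightarrow>\<^sub>L 'h) \<le> 1"
    by (rule norm_blinfun_bound) simp_all
  then show ?thesis
    using norm_lift_le[of id_blinfun n] by simp
qed

lemma norm_proj_apply_le: "norm (proj n v) \<le> norm v"
  using norm_blinfun[of "proj n" v] norm_proj_le[of n]
  by (meson dual_order.trans mult_left_le_one_le norm_ge_zero)

lemma funpow_tau_id: "(\<tau> ^^ n) id_blinfun = id_blinfun"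
  by (induction n) (simp_all add: tau_id)

text \<open>As \<open>\<tau>\<close> is unital, \<open>proj n\<close> compresses to the identity; and a projection \<open>q\<close> with
  \<open>\<langle>q v, v\<rangle> = \<langle>v, v\<rangle>\<close> fixes \<open>v\<close>.\<close>

lemma proj_J: "proj n (J h) = J h"
proof -
  let ?q = "proj n" and ?v = "J h"
  have q: "?q \<in> bounded_ops" by (simp add: lift_ops)
  have 1: "cinner (?q ?v) ?v = cinner ?v ?v"
  proof -
    have "cinner (?q ?v) ?v = cinner (compress_op J ?q h) h"
      by (simp add: compress_op_apply cinner_adj_left[OF J_ops])
    also have "compress_op J ?q = id_blinfun"
      by (simp add: compress_lift funpow_tau_id)
    also have "cinner (blinfun_apply id_blinfun h) h = cinner (adj J (J h)) h"
      by (simp add: J_adj_J)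
    also have "\<dots> = cinner ?v ?v"
      by (rule cinner_adj_left[OF J_ops])
    finally show ?thesis .
  qed
  have 2: "cinner (?q ?v) (?q ?v) = cinner (?q ?v) ?v"
  proof -
    have "cinner (adj ?q (?q ?v)) ?v = cinner (?q ?v) (?q ?v)"
      by (rule cinner_adj_left[OF q])
    then show ?thesis
      using blinfun_compose_eqD[OF proj_lift[of id_blinfun n]] unfolding adj_proj by simp
  qed
  have 3: "cinner ?v (?q ?v) = cinner ?v ?v"
    using 1 cinner_commute by metis
  have "cinner (?q ?v - ?v) (?q ?v - ?v) = 0"
    by (simp add: cinner_simps 1 2 3)
  then show ?thesis by simp
qed

lemma compress_proj: "compress_op J ((proj n o\<^sub>L z) o\<^sub>L proj n) = compress_op J z"
proof -
  have "adj J o\<^sub>L proj n = adj (proj n o\<^sub>L J)"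
    by (simp add: adj_compose J_ops lift_ops adj_proj)
  also have "proj n o\<^sub>L J = J"
    by (intro blinfun_eqI) (simp add: proj_J)
  finally have "adj J (proj n k) = adj J k" for k
    by (rule blinfun_compose_eqD)
  then show ?thesis
    by (intro blinfun_eqI) (simp add: compress_op_apply proj_J)
qed

text \<open>This is \<open>\<theta>\<^sup>m\<close> applied to the fact that \<open>proj (n - m)\<close> fixes the range of \<open>J\<close>.\<close>

lemma proj_mono_lift:
  assumes "m \<le> n" "x \<in> bounded_ops"
  shows "proj n o\<^sub>L lift m x = lift m x" "lift m x o\<^sub>L proj n = lift m x"
proof -
  have *: "proj n o\<^sub>L lift m x = lift m x" if x: "x \<in> bounded_ops" for x
  proof -
    have "proj (n - m) o\<^sub>L embed_op J x = embed_op J x"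
      by (intro blinfun_eqI) (simp add: embed_op_apply proj_J)
    then have "(\<theta> ^^ m) (proj (n - m)) o\<^sub>L (\<theta> ^^ m) (embed_op J x) = (\<theta> ^^ m) (embed_op J x)"
      using funpow_endo(5)[of "proj (n - m)" "embed_op J x" m] x
      by (simp add: lift_hom embed_in_B)
    then show ?thesis
      using assms(1) by (simp add: funpow_lift) (simp add: lift_def)
  qed
  show "proj n o\<^sub>L lift m x = lift m x"
    by (rule *[OF assms(2)])
  have "adj (proj n o\<^sub>L lift m (adj x)) = adj (lift m (adj x))"
    by (subst *) (simp_all add: assms)
  then show "lift m x o\<^sub>L proj n = lift m x"
    using assms(2) by (simp add: adj_compose lift_ops adj_proj) (simp add: lift_hom lift_ops)
qed

text \<open>This is \<open>\<theta>\<^sup>m\<close> applied to the dilation identity for the power \<open>n - m\<close>.\<close>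

lemma proj_cut_lift:
  assumes "m \<le> n" "x \<in> bounded_ops"
  shows "(proj m o\<^sub>L lift n x) o\<^sub>L proj m = lift m ((\<tau> ^^ (n - m)) x)"
proof -
  have "lift m ((\<tau> ^^ (n - m)) x) = (\<theta> ^^ m) (embed_op J (compress_op J (lift (n - m) x)))"
    by (simp add: lift_def[of m] compress_lift assms)
  also have "\<dots> = (\<theta> ^^ m) ((proj 0 o\<^sub>L lift (n - m) x) o\<^sub>L proj 0)"
    by (simp add: embed_compress_op lift_0)
  also have "\<dots> = (proj m o\<^sub>L lift n x) o\<^sub>L proj m"
    using assms by (simp add: funpow_endo lift_hom B_closed funpow_lift)
  finally show ?thesis ..
qed

lemma dilation_word_fixed:
  "set xs \<subseteq> bounded_ops \<Longrightarrow> length xs \<le> n \<Longrightarrow> proj n (dilation_word J \<theta> xs h) = dilation_word J \<theta> xs h"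
proof (cases xs)
  case (Cons x ys)
  assume "set xs \<subseteq> bounded_ops" "length xs \<le> n"
  then have "proj n o\<^sub>L lift (length xs) x = lift (length xs) x"
    using Cons by (intro proj_mono_lift) auto
  moreover have "dilation_word J \<theta> xs h = lift (length xs) x (dilation_word J \<theta> ys h)"
    by (simp add: Cons lift_def)
  ultimately show ?thesis
    using blinfun_compose_eqD by simp
qed (simp add: proj_J)

text \<open>By minimality the union of the ranges of the increasing projections \<open>proj n\<close> is dense.\<close>

lemma proj_strong_limit: "(\<lambda>n. proj n k) \<longlonglongrightarrow> k"
proof -
  define E where "E = {k. \<exists>m. proj m k = k}"
  have mono: "proj n k = k" if "proj m k = k" "m \<le> n" for m n k
    using blinfun_compose_eqD[OF proj_mono_lift(1)[OF that(2) bounded_ops_id], of k] that(1) by simp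
  have "csubspace E"
    unfolding complex_vector.subspace_def
  proof (intro conjI allI ballI)
    show "0 \<in> E" by (simp add: E_def)
  next
    fix a b assume "a \<in> E" "b \<in> E"
    then obtain m n where "proj m a = a" "proj n b = b" by (auto simp: E_def)
    then have "proj (max m n) a = a" "proj (max m n) b = b"
      using mono by (meson max.cobounded1 max.cobounded2)+
    then show "a + b \<in> E"
      by (auto simp: E_def blinfun.add_right intro!: exI[of _ "max m n"])
  next
    fix c a assume "a \<in> E"
    then show "c *\<^sub>C a \<in> E"
      by (auto simp: E_def bounded_ops_scaleC lift_ops)
  qed
  moreover have "{dilation_word J \<theta> xs h | xs h. set xs \<subseteq> bounded_ops} \<subseteq> E"
    using dilation_word_fixed by (fastforce simp: E_def)
  ultimately have "cspan {dilation_word J \<theta> xs h | xs h. set xs \<subseteq> bounded_ops} \<subseteq> E"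
    by (intro complex_vector.span_minimal)
  then have "closure E = UNIV"
    using dense closure_mono by blast
  show ?thesis
  proof (rule LIMSEQ_I)
    fix e :: real assume "0 < e"
    then obtain a where a: "a \<in> E" "dist a k < e / 2"
      using \<open>closure E = UNIV\<close> by (metis UNIV_I closure_approachable half_gt_zero)
    then obtain m where m: "proj m a = a" by (auto simp: E_def)
    have "norm (proj n k - k) < e" if "m \<le> n" for n
    proof -
      have "proj n k - k = proj n (k - a) + (a - k)"
        using mono[OF m that] by (simp add: blinfun.diff_right)
      then have "norm (proj n k - k) \<le> norm (proj n (k - a)) + norm (a - k)"
        by (metis norm_triangle_ineq)
      also have "\<dots> \<le> norm (k - a) + norm (a - k)"
        by (intro add_right_mono norm_proj_apply_le)
      also have "\<dots> < e"
        using a(2) by (simp add: dist_norm norm_minus_commute)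
      finally show ?thesis .
    qed
    then show "\<exists>no. \<forall>n\<ge>no. norm (proj n k - k) < e" by blast
  qed
qed

lemma proj_cut_limit: "(\<lambda>n. proj n (blinfun_apply D (proj n k))) \<longlonglongrightarrow> blinfun_apply D k"
proof -
  have "(\<lambda>n. D (proj n k) - D k) \<longlonglongrightarrow> 0"
    using bounded_linear.tendsto[OF blinfun.bounded_linear_right[of D] proj_strong_limit[of k]]
    by (simp add: LIM_zero)
  then have 1: "(\<lambda>n. norm (D (proj n k) - D k)) \<longlonglongrightarrow> 0"
    by (rule tendsto_norm_zero)
  have "(\<lambda>n. proj n (D (proj n k) - D k)) \<longlonglongrightarrow> 0"
    by (rule Lim_null_comparison[OF _ 1]) (simp add: norm_proj_apply_le)
  from tendsto_add[OF this proj_strong_limit[of "D k"]] show ?thesis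
    by (simp add: blinfun.diff_right)
qed

end

section \<open>Simultaneous recurrence\<close>

text \<open>Dirichlet's theorem is applied to the multiples by \<open>Suc N\<close> of the angles, so that the exponent
  is at least \<open>N\<close>.\<close>

lemma unit_powers_recurrent:
  fixes C :: "complex set"
  assumes fin: "finite C" and unit: "\<And>c. c \<in> C \<Longrightarrow> norm c = 1" and e: "0 < e"
  obtains n where "N \<le> n" "\<And>c. c \<in> C \<Longrightarrow> norm (c ^ n - 1) < e"
proof -
  obtain g :: "nat \<Rightarrow> complex" where g: "bij_betw g {0..<card C} C"
    using ex_bij_betw_nat_finite[OF fin] by blast
  obtain K :: nat where K: "2 * pi / e < real K"
    using reals_Archimedean2 by blast
  have K0: "0 < K" "2 * pi / real K < e"
  proof -
    have "0 < 2 * pi / e" using e by simp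
    then have "0 < real K" using K by linarith
    then show "0 < K" "2 * pi / real K < e" using K e by (simp_all add: field_simps)
  qed
  define a where "a i = Arg (g i) / (2 * pi)" for i
  obtain q p where qp: "0 < q"
    "\<And>i. i < card C \<Longrightarrow> \<bar>of_int q * (real (Suc N) * a i) - of_int (p i)\<bar> < 1 / K"
    using Dirichlet_approx_simult[OF K0(1), of "card C" "\<lambda>i. real (Suc N) * a i"] by metis
  define n where "n = Suc N * nat q"
  have n: "real n = real (Suc N) * of_int q"
    using qp(1) by (simp add: n_def algebra_simps)
  have "N \<le> n"
  proof -
    have "1 \<le> nat q" using qp(1) by simp
    then have "Suc N * 1 \<le> n" unfolding n_def by (intro mult_le_mono) auto
    then show ?thesis by simp
  qed
  moreover have "norm (c ^ n - 1) < e" if c: "c \<in> C" for c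
  proof -
    have "c \<in> g ` {0..<card C}"
      using g c by (simp add: bij_betw_imp_surj_on)
    then obtain i where i: "i < card C" "c = g i"
      by auto
    have "cis (Arg c) = c"
      using cis_Arg[of c] unit[OF c] by (cases "c = 0") (simp_all add: sgn_div_norm)
    then have c2: "c = cis (2 * pi * a i)"
      by (simp add: a_def i(2))
    define t where "t = of_int q * (real (Suc N) * a i) - of_int (p i)"
    have "c ^ n = cis (real n * (2 * pi * a i))"
      unfolding c2 by (simp add: Complex.DeMoivre)
    also have "real n * (2 * pi * a i) = 2 * pi * t + 2 * pi * of_int (p i)"
      unfolding n t_def by (simp add: algebra_simps)
    also have "cis \<dots> = cis (2 * pi * t)"
      by (simp add: cis_multiple_2pi flip: cis_mult)
    finally have "norm (c ^ n - 1) = 2 * \<bar>sin (pi * t)\<bar>"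
      using dist_exp_i_1[of "2 * pi * t"] by (simp add: cis_conv_exp)
    also have "\<dots> \<le> 2 * \<bar>pi * t\<bar>"
      using abs_sin_x_le_abs_x[of "pi * t"] by linarith
    also have "\<dots> = 2 * pi * \<bar>t\<bar>"
      by (simp add: abs_mult)
    also have "\<dots> \<le> 2 * pi * (1 / K)"
      using qp(2)[OF i(1)] by (intro mult_left_mono) (auto simp: t_def)
    also have "\<dots> < e"
      using K0(2) by simp
    finally show ?thesis .
  qed
  ultimately show thesis by (rule that)
qed

section \<open>Peripheral eigenoperators of a dilation\<close>

abbreviation peripheral_eigen ::
    "('a::chilbert_space \<Rightarrow>\<^sub>L 'a) set \<Rightarrow> (('a \<Rightarrow>\<^sub>L 'a) \<Rightarrow> ('a \<Rightarrow>\<^sub>L 'a)) \<Rightarrow> ('a \<Rightarrow>\<^sub>L 'a) set"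
  where "peripheral_eigen A \<tau> \<equiv> {x \<in> A. \<exists>c. norm c = 1 \<and> \<tau> x = c *\<^sub>C x}"

lemma csubspace_peripheral_space: "csubspace (peripheral_space A \<tau>)"
  unfolding peripheral_space_def by (rule csubspace_closed_span)

lemma peripheral_eigen_subset: "peripheral_eigen A \<tau> \<subseteq> peripheral_space A \<tau>"
  unfolding peripheral_space_def by (rule subset_closed_span)

lemma unit_power_cnj: "norm (c :: complex) = 1 \<Longrightarrow> m \<le> n \<Longrightarrow> cnj c ^ n * c ^ (n - m) = cnj c ^ m"
proof -
  assume c: "norm c = 1" "m \<le> n"
  have "cnj c * c = 1"
    using c(1) complex_norm_square[of c] by (simp add: mult.commute)
  then have "cnj c ^ (n - m) * c ^ (n - m) = 1"
    by (simp flip: power_mult_distrib)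
  moreover have "cnj c ^ n = cnj c ^ m * cnj c ^ (n - m)"
    using c(2) by (simp flip: power_add)
  ultimately show ?thesis by (simp add: mult.assoc)
qed

text \<open>This extends identities between continuous linear maps, from the eigenoperators or from a
  basis, to the closure of their span.\<close>

lemma vanish_on_closed_span:
  fixes f :: "'a::complex_normed_vector \<Rightarrow> 'b::complex_normed_vector" and E :: "'a set"
  defines "P \<equiv> closure (cspan E)"
  assumes add: "\<And>x y. x \<in> P \<Longrightarrow> y \<in> P \<Longrightarrow> f (x + y) = f x + f y"
    and scale: "\<And>c x. x \<in> P \<Longrightarrow> f (c *\<^sub>C x) = c *\<^sub>C f x"
    and bound: "\<And>x. x \<in> P \<Longrightarrow> norm (f x) \<le> K * norm x"
    and zero: "\<And>x. x \<in> E \<Longrightarrow> f x = 0"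
    and x: "x \<in> P"
  shows "f x = 0"
proof -
  have P: "csubspace P"
    unfolding P_def by (rule csubspace_closed_span)
  note P_closed = complex_vector.subspace_0[OF P] complex_vector.subspace_add[OF P]
    complex_vector.subspace_scale[OF P] complex_vector.subspace_diff[OF P]
  have EP: "E \<subseteq> P"
    unfolding P_def by (rule subset_closed_span)
  have f0: "f 0 = 0"
    using scale[of 0 0] P_closed(1) by simp
  have "csubspace {y \<in> P. f y = 0}"
    unfolding complex_vector.subspace_def
    using P_closed by (auto simp: f0 add scale)
  then have span: "f y = 0" "y \<in> P" if "y \<in> cspan E" for y
    using complex_vector.span_minimal[of E "{y \<in> P. f y = 0}"] EP zero that by auto
  obtain X where X: "\<And>n. X n \<in> cspan E" "X \<longlonglongrightarrow> x"
    using x unfolding P_def closure_sequential by blast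
  have "norm (f x) \<le> K * norm (x - X n)" for n
  proof -
    have "f x = f (X n + (x - X n))" by simp
    also have "\<dots> = f (x - X n)"
      using X(1) span x P_closed(4) by (subst add) auto
    finally show ?thesis using bound[OF P_closed(4)[OF x span(2)[OF X(1)]]] by metis
  qed
  moreover have "(\<lambda>n. K * norm (x - X n)) \<longlonglongrightarrow> K * norm (x - x)"
    by (intro tendsto_intros X(2))
  ultimately have "norm (f x) \<le> K * norm (x - x)"
    by (intro LIMSEQ_le_const) auto
  then show ?thesis by simp
qed

context unital_dilation
begin

lemma funpow_endo_sum:
  "finite F \<Longrightarrow> (\<And>a. a \<in> F \<Longrightarrow> a \<in> B) \<Longrightarrow>
    (\<theta> ^^ n) (\<Sum>a\<in>F. r a *\<^sub>C a) = (\<Sum>a\<in>F. r a *\<^sub>C (\<theta> ^^ n) a) \<and> (\<Sum>a\<in>F. r a *\<^sub>C a) \<in> B"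
proof (induction F rule: finite_induct)
  case empty
  have "(\<theta> ^^ n) (0 *\<^sub>C id_blinfun) = 0 *\<^sub>C (\<theta> ^^ n) id_blinfun"
    by (rule funpow_endo(2)[OF B_closed(1)])
  then show ?case
    using B_closed(4)[OF B_closed(1), of 0] by simp
next
  case (insert a F)
  then show ?case
    by (simp add: funpow_endo B_closed)
qed

lemma eigen_funpow:
  assumes "z \<in> B" "\<theta> z = c *\<^sub>C z"
  shows "(\<theta> ^^ n) z = c ^ n *\<^sub>C z"
proof (induction n)
  case (Suc n)
  have "(\<theta> ^^ Suc n) z = (\<theta> ^^ n) (c *\<^sub>C z)"
    using assms(2) by (simp add: funpow_swap1)
  also have "\<dots> = c *\<^sub>C (c ^ n *\<^sub>C z)"
    by (simp only: funpow_endo(2)[OF assms(1)] Suc)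
  finally show ?case by (simp add: scaleC_scaleC)
qed simp

lemma eigen_tau_funpow:
  assumes "x \<in> bounded_ops" "\<tau> x = c *\<^sub>C x"
  shows "(\<tau> ^^ n) x = c ^ n *\<^sub>C x"
proof (induction n)
  case (Suc n)
  have "(\<tau> ^^ Suc n) x = (\<tau> ^^ n) (c *\<^sub>C x)"
    using assms(2) by (simp add: funpow_swap1)
  also have "\<dots> = compress_op J (lift n (c *\<^sub>C x))"
    by (simp add: compress_lift assms)
  also have "\<dots> = c *\<^sub>C (\<tau> ^^ n) x"
    by (simp add: lift_hom assms compress_op_scaleC J_ops compress_lift)
  finally show ?case by (simp add: Suc scaleC_scaleC)
qed simp

lemma lift_compress:
  assumes "z \<in> B"
  shows "lift n (compress_op J z) = (proj n o\<^sub>L (\<theta> ^^ n) z) o\<^sub>L proj n"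
  using assms lift_hom(1)[of id_blinfun 0]
  unfolding lift_def[of n] embed_compress_op lift_0[symmetric]
  by (simp add: funpow_endo B_closed funpow_lift)

lemma eigen_span_recurrent:
  assumes z: "z \<in> cspan (peripheral_eigen B \<theta>)" and e: "0 < e"
  obtains n where "N \<le> n" "norm ((\<theta> ^^ n) z - z) < e"
proof -
  obtain F r where F: "finite F" "F \<subseteq> peripheral_eigen B \<theta>" "z = (\<Sum>a\<in>F. r a *\<^sub>C a)"
    using z unfolding complex_vector.span_explicit by blast
  then have "\<forall>a\<in>F. \<exists>c. norm c = 1 \<and> \<theta> a = c *\<^sub>C a" by blast
  then obtain c where c: "\<And>a. a \<in> F \<Longrightarrow> norm (c a) = 1" "\<And>a. a \<in> F \<Longrightarrow> \<theta> a = c a *\<^sub>C a"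
    by metis
  define s where "s = (\<Sum>a\<in>F. norm (r a) * norm a)"
  have s: "0 \<le> s" by (simp add: s_def sum_nonneg)
  define d where "d = e / (s + 1)"
  have "0 < d" using e s by (simp add: d_def)
  then obtain n where n: "N \<le> n" "\<And>a. a \<in> F \<Longrightarrow> norm (c a ^ n - 1) < d"
    using unit_powers_recurrent[of "c ` F" d N] F(1) c(1) by (metis (no_types, lifting) finite_imageI imageE imageI)
  have "(\<theta> ^^ n) z = (\<Sum>a\<in>F. r a *\<^sub>C (\<theta> ^^ n) a)"
    unfolding F(3) using funpow_endo_sum[of F n r] F(1,2) by blast
  also have "\<dots> = (\<Sum>a\<in>F. r a *\<^sub>C c a ^ n *\<^sub>C a)"
    using F(2) c(2) eigen_funpow by (intro sum.cong) auto
  finally have "(\<theta> ^^ n) z - z = (\<Sum>a\<in>F. r a *\<^sub>C (c a ^ n - 1) *\<^sub>C a)"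
    by (simp add: F(3) complex_vector.scale_left_diff_distrib complex_vector.scale_right_diff_distrib
        flip: sum_subtractf)
  also have "norm \<dots> \<le> (\<Sum>a\<in>F. norm (r a *\<^sub>C (c a ^ n - 1) *\<^sub>C a))"
    by (rule norm_sum)
  also have "\<dots> \<le> (\<Sum>a\<in>F. d * (norm (r a) * norm a))"
  proof (rule sum_mono)
    fix a assume a: "a \<in> F"
    have "norm (r a *\<^sub>C (c a ^ n - 1) *\<^sub>C a) = norm (c a ^ n - 1) * (norm (r a) * norm a)"
      by (simp add: norm_scaleC norm_mult)
    also have "\<dots> \<le> d * (norm (r a) * norm a)"
      by (intro mult_right_mono less_imp_le[OF n(2)[OF a]]) simp
    finally show "norm (r a *\<^sub>C (c a ^ n - 1) *\<^sub>C a) \<le> d * (norm (r a) * norm a)" .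
  qed
  also have "\<dots> = d * s"
    by (simp add: s_def sum_distrib_left)
  also have "\<dots> < e"
    using e s by (simp add: d_def divide_simps)
  finally show thesis
    using that n(1) by blast
qed

lemma eigen_span_subset: "cspan (peripheral_eigen B \<theta>) \<subseteq> B"
  using B_closed by (intro complex_vector.span_minimal)
    (auto simp: complex_vector.subspace_def intro: B_closed(4)[of _ 0, simplified])

text \<open>Along a recurrent sequence of \<open>n\<close> the operator \<open>z\<close> is almost \<open>\<theta>\<^sup>n z\<close>, whose
  compression by \<open>proj n\<close> is the image of \<open>compress_op J z\<close> under a contraction; and these
  compressions converge strongly.\<close>

lemma compress_isometric_span:
  assumes z: "z \<in> cspan (peripheral_eigen B \<theta>)"
  shows "norm z \<le> norm (compress_op J z)"
proof (rule field_le_epsilon)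
  fix e :: real assume e: "0 < e"
  let ?K = "norm (compress_op J z) + e"
  have zB: "z \<in> B" using z eigen_span_subset by blast
  show "norm z \<le> ?K"
  proof (rule norm_blinfun_bound)
    fix k
    have "\<exists>n\<ge>N. norm (proj n (z (proj n k))) \<le> ?K * norm k" for N
    proof -
      obtain n where n: "N \<le> n" "norm ((\<theta> ^^ n) z - z) < e"
        using eigen_span_recurrent[OF z e] .
      have "proj n (z (proj n k)) = lift n (compress_op J z) k - proj n (((\<theta> ^^ n) z - z) (proj n k))"
        by (simp add: lift_compress zB blinfun.diff_left blinfun.diff_right)
      also have "norm \<dots> \<le> norm (lift n (compress_op J z) k)
          + norm (proj n (((\<theta> ^^ n) z - z) (proj n k)))"
        by (rule norm_triangle_ineq4)
      also have "\<dots> \<le> norm (compress_op J z) * norm k + e * norm k"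
      proof (rule add_mono)
        have "norm (lift n (compress_op J z) k) \<le> norm (lift n (compress_op J z)) * norm k"
          by (rule norm_blinfun)
        also have "\<dots> \<le> norm (compress_op J z) * norm k"
          by (intro mult_right_mono norm_lift_le compress_op_in_bounded_ops J_ops B_ops zB) simp
        finally show "norm (lift n (compress_op J z) k) \<le> norm (compress_op J z) * norm k" .
        have "norm (proj n (((\<theta> ^^ n) z - z) (proj n k))) \<le> norm (((\<theta> ^^ n) z - z) (proj n k))"
          by (rule norm_proj_apply_le)
        also have "\<dots> \<le> norm ((\<theta> ^^ n) z - z) * norm (proj n k)"
          by (rule norm_blinfun)
        also have "\<dots> \<le> e * norm k"
          using n(2) e by (intro mult_mono norm_proj_apply_le) auto
        finally show "norm (proj n (((\<theta> ^^ n) z - z) (proj n k))) \<le> e * norm k" .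
      qed
      finally show ?thesis
        using n(1) by (auto simp: algebra_simps)
    qed
    then obtain n where n: "\<And>N. N \<le> n N" "\<And>N. norm (proj (n N) (z (proj (n N) k))) \<le> ?K * norm k"
      by metis
    have "filterlim n at_top sequentially"
      by (rule filterlim_at_top_mono[OF filterlim_ident]) (simp add: n(1))
    then have "(\<lambda>N. proj (n N) (z (proj (n N) k))) \<longlonglongrightarrow> z k"
      by (rule filterlim_compose[OF proj_cut_limit])
    then show "norm (z k) \<le> ?K * norm k"
      by (rule LIMSEQ_le_const2[OF tendsto_norm]) (use n(2) in auto)
  qed (use e in simp)
qed

lemma compress_isometric:
  assumes "z \<in> peripheral_space B \<theta>"
  shows "norm (compress_op J z) = norm z"
proof -
  have "closed {z. norm z \<le> norm (compress_op J z)}"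
    by (intro closed_Collect_le continuous_intros
        bounded_linear.continuous_on[OF bounded_linear_compress_op])
  then have "peripheral_space B \<theta> \<subseteq> {z. norm z \<le> norm (compress_op J z)}"
    unfolding peripheral_space_def using compress_isometric_span by (intro closure_minimal) auto
  then show ?thesis
    using assms norm_compress_op_le[OF J_isometric, of z] by (auto intro: antisym)
qed

lemma compress_eigen:
  assumes "z \<in> B" "\<theta> z = c *\<^sub>C z"
  shows "compress_op J z \<in> bounded_ops" "\<tau> (compress_op J z) = c *\<^sub>C compress_op J z"
proof -
  show x: "compress_op J z \<in> bounded_ops"
    using assms(1) by (intro compress_op_in_bounded_ops J_ops B_ops)
  have "\<tau> (compress_op J z) = compress_op J (lift 1 (compress_op J z))"
    using compress_lift[OF x, of 1] by simp
  also have "\<dots> = compress_op J ((proj 1 o\<^sub>L \<theta> z) o\<^sub>L proj 1)"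
    using lift_compress[OF assms(1), of 1] by simp
  also have "\<dots> = c *\<^sub>C compress_op J z"
    by (simp only: compress_proj assms(2) compress_op_scaleC J_ops)
  finally show "\<tau> (compress_op J z) = c *\<^sub>C compress_op J z" .
qed

text \<open>The eigenoperator of \<open>\<theta>\<close> over \<open>x\<close> is the strong limit of \<open>c\<^sup>-\<^sup>n \<theta>\<^sup>n(x)\<close>.  The \<open>m\<close>-th
  of these operators is the compression by \<open>proj m\<close> of every later one; hence the norms at a vector
  in the range of \<open>proj m\<close> increase, and the differences are controlled by Pythagoras.  The limit
  \<open>z\<close> is an eigenoperator since \<open>\<theta> z\<close> and \<open>c z\<close> have the same compressions by every \<open>proj (Suc m)\<close>.\<close>

lemma eigen_lift_exists:
  assumes x: "x \<in> bounded_ops" and c: "norm c = 1" and eig: "\<tau> x = c *\<^sub>C x"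
  obtains z where "z \<in> B" "\<theta> z = c *\<^sub>C z" "compress_op J z = x"
proof -
  define Z where "Z n = cnj c ^ n *\<^sub>C lift n x" for n
  have ZB: "Z n \<in> B" for n
    by (simp add: Z_def B_closed lift_hom x)
  have cut: "(proj m o\<^sub>L Z n) o\<^sub>L proj m = Z m" if "m \<le> n" for m n
  proof -
    have "(proj m o\<^sub>L Z n) o\<^sub>L proj m = cnj c ^ n *\<^sub>C ((proj m o\<^sub>L lift n x) o\<^sub>L proj m)"
      by (simp add: Z_def blinfun_compose_scaleC lift_ops)
    also have "\<dots> = cnj c ^ n *\<^sub>C lift m (c ^ (n - m) *\<^sub>C x)"
      by (simp add: proj_cut_lift that x eigen_tau_funpow[OF x eig])
    also have "\<dots> = (cnj c ^ n * c ^ (n - m)) *\<^sub>C lift m x"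
      by (simp add: lift_hom x scaleC_scaleC)
    finally show ?thesis
      using that by (simp add: Z_def unit_power_cnj[OF c])
  qed
  have cut_apply: "proj m (Z n (proj m k)) = Z m k" if "m \<le> n" for m n k
    using arg_cong[OF cut[OF that], of "\<lambda>T. blinfun_apply T k"] by simp
  have Z_bd: "norm (Z n) \<le> norm x" for n
    using norm_lift_le[OF x] by (simp add: Z_def norm_scaleC norm_power c)
  have Z_apply: "norm (Z n k) \<le> norm x * norm k" for n k
    using norm_blinfun[of "Z n" k] mult_right_mono[OF Z_bd[of n], of "norm k"] by simp
  have cauchy_range: "Cauchy (\<lambda>n. Z n (proj m k))" for m k
  proof -
    let ?k = "proj m k"
    have fix_k: "proj n ?k = ?k" if "m \<le> n" for n
      using blinfun_compose_eqD[OF proj_mono_lift(1)[OF that bounded_ops_id]] by simp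
    have step: "proj n (Z n' ?k) = Z n ?k" if "m \<le> n" "n \<le> n'" for n n'
      using cut_apply[OF that(2), of ?k] fix_k[OF that(1)] by simp
    have pyth: "(norm (Z n' ?k - Z n ?k))\<^sup>2 = (norm (Z n' ?k))\<^sup>2 - (norm (Z n ?k))\<^sup>2"
      if "m \<le> n" "n \<le> n'" for n n'
    proof -
      let ?a = "Z n' ?k" and ?b = "Z n ?k"
      have b: "proj n ?b = ?b"
        using step[OF that(1) order_refl] .
      have "cinner ?a ?b = cinner ?a (proj n ?b)" by (simp add: b)
      also have "\<dots> = cinner (proj n ?a) ?b"
        using cinner_adj_left[of "proj n" ?a ?b] by (simp add: adj_proj lift_ops)
      also have "\<dots> = cinner ?b ?b"
        by (simp add: step[OF that])
      finally have "inner ?a ?b = (norm ?b)\<^sup>2"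
        by (simp add: inner_eq_Re_cinner cinner_self)
      then show ?thesis
        using norm_diff_scaleR_square[of ?a 1 ?b] by simp
    qed
    define s where "s n = (norm (Z (m + n) ?k))\<^sup>2" for n
    have "incseq s"
    proof (rule incseq_SucI)
      show "s n \<le> s (Suc n)" for n
        using pyth[of "m + n" "m + Suc n"] zero_le_power2[of "norm (Z (m + Suc n) ?k - Z (m + n) ?k)"]
        by (simp add: s_def)
    qed
    moreover have "s n \<le> (norm x * norm ?k)\<^sup>2" for n
      unfolding s_def by (intro power_mono Z_apply) simp
    ultimately have "Cauchy s"
      by (metis incseq_convergent convergent_def LIMSEQ_imp_Cauchy)
    have "Cauchy (\<lambda>n. Z (n + m) ?k)"
    proof (rule CauchyI)
      fix e :: real assume e: "0 < e"
      then obtain M where M: "\<And>i j. i \<ge> M \<Longrightarrow> j \<ge> M \<Longrightarrow> norm (s i - s j) < e\<^sup>2"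
        using CauchyD[OF \<open>Cauchy s\<close>, of "e\<^sup>2"] by auto
      have main: "norm (Z (j + m) ?k - Z (i + m) ?k) < e" if "M \<le> i" "i \<le> j" for i j
      proof -
        have "(norm (Z (j + m) ?k - Z (i + m) ?k))\<^sup>2 = s j - s i"
          using pyth[of "i + m" "j + m"] that by (simp add: s_def add.commute)
        also have "\<dots> < e\<^sup>2"
          using M[of j i] that by simp
        finally show ?thesis
          using e by (intro power_less_imp_less_base[of _ 2 e]) auto
      qed
      show "\<exists>M. \<forall>i\<ge>M. \<forall>j\<ge>M. norm (Z (i + m) ?k - Z (j + m) ?k) < e"
      proof (intro exI[of _ M] allI impI)
        fix i j assume "M \<le> i" "M \<le> j"
        then show "norm (Z (i + m) ?k - Z (j + m) ?k) < e"
          using main[of i j] main[of j i] by (cases "i \<le> j") (simp_all add: norm_minus_commute)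
      qed
    qed
    then have "convergent (\<lambda>n. Z (n + m) ?k)"
      by (simp add: Cauchy_convergent_iff)
    then have "convergent (\<lambda>n. Z n ?k)"
      using convergent_ignore_initial_segment[of "\<lambda>n. Z n ?k" m] by simp
    then show ?thesis
      by (simp add: Cauchy_convergent_iff)
  qed
  have "Cauchy (\<lambda>n. Z n k)" for k
  proof (rule CauchyI)
    fix e :: real assume e: "0 < e"
    define d where "d = e / 3 / (norm x + 1)"
    have nx: "0 < norm x + 1" by (simp add: add_nonneg_pos)
    then have d: "0 < d"
      unfolding d_def using e by (intro divide_pos_pos) auto
    have "norm x * d \<le> (norm x + 1) * d"
      using d by (intro mult_right_mono) auto
    also have "\<dots> = e / 3"
      unfolding d_def using nx by (subst times_divide_eq_right) (rule nonzero_mult_div_cancel_left, simp)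
    finally have d2: "norm x * d \<le> e / 3" .
    obtain m where m: "norm (proj m k - k) < d"
      using LIMSEQ_D[OF proj_strong_limit d, of k] by blast
    have close: "norm (Z n k - Z n (proj m k)) \<le> e / 3" for n
    proof -
      have "norm (Z n k - Z n (proj m k)) \<le> norm x * norm (k - proj m k)"
        using Z_apply[of n "k - proj m k"] by (simp add: blinfun.diff_right)
      also have "\<dots> \<le> norm x * d"
        using m by (intro mult_left_mono) (auto simp: norm_minus_commute)
      finally show ?thesis using d2 by linarith
    qed
    obtain M where M: "\<And>i j. i \<ge> M \<Longrightarrow> j \<ge> M \<Longrightarrow> norm (Z i (proj m k) - Z j (proj m k)) < e / 3"
      using CauchyD[OF cauchy_range[of m k], of "e / 3"] e by auto
    show "\<exists>M. \<forall>i\<ge>M. \<forall>j\<ge>M. norm (Z i k - Z j k) < e"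
    proof (intro exI[of _ M] allI impI)
      fix i j assume "M \<le> i" "M \<le> j"
      let ?u = "Z i k - Z i (proj m k)" and ?v = "Z i (proj m k) - Z j (proj m k)"
        and ?w = "Z j k - Z j (proj m k)"
      have "norm (Z i k - Z j k) = norm (?u + ?v - ?w)" by simp
      also have "\<dots> \<le> norm ?u + norm ?v + norm ?w"
        using norm_triangle_ineq4[of "?u + ?v" ?w] norm_triangle_ineq[of ?u ?v] by linarith
      also have "\<dots> < e"
        using close[of i] close[of j] M[OF \<open>M \<le> i\<close> \<open>M \<le> j\<close>] by linarith
      finally show "norm (Z i k - Z j k) < e" .
    qed
  qed
  then have "convergent (\<lambda>n. Z n k)" for k
    by (simp add: Cauchy_convergent_iff)
  then obtain z where z: "\<And>k. (\<lambda>n. Z n k) \<longlonglongrightarrow> blinfun_apply z k"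
    using strong_limit_exists[of Z, OF Z_bd] by blast
  have zB: "z \<in> B"
    by (rule von_neumann_algebra_strong_limit[OF vn ZB z])
  have z_cut: "(proj m o\<^sub>L z) o\<^sub>L proj m = Z m" for m
  proof (rule blinfun_eqI)
    fix k
    have "(\<lambda>n. proj m (Z n (proj m k))) \<longlonglongrightarrow> proj m (z (proj m k))"
      by (rule bounded_linear.tendsto[OF blinfun.bounded_linear_right z])
    moreover have "(\<lambda>n. proj m (Z n (proj m k))) \<longlonglongrightarrow> Z m k"
      by (rule tendsto_eventually)
        (auto simp: eventually_sequentially cut_apply intro!: exI[of _ m])
    ultimately show "((proj m o\<^sub>L z) o\<^sub>L proj m) k = Z m k"
      using LIMSEQ_unique by auto
  qed
  have th_z: "\<theta> z \<in> B"
    using funpow_endo(1)[OF zB, of 1] by simp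
  have same: "(proj (Suc m) o\<^sub>L \<theta> z) o\<^sub>L proj (Suc m) = (proj (Suc m) o\<^sub>L (c *\<^sub>C z)) o\<^sub>L proj (Suc m)" for m
  proof -
    have "(proj (Suc m) o\<^sub>L \<theta> z) o\<^sub>L proj (Suc m) = (\<theta> ^^ 1) ((proj m o\<^sub>L z) o\<^sub>L proj m)"
      using funpow_endo(5)[where n = 1] funpow_lift[of 1 m id_blinfun]
      by (simp add: B_closed lift_hom zB)
    also have "\<dots> = cnj c ^ m *\<^sub>C lift (Suc m) x"
      unfolding z_cut using funpow_endo(2)[of "lift m x" 1 "cnj c ^ m"] funpow_lift[of 1 m x]
      by (simp add: Z_def lift_hom x)
    also have "cnj c ^ m = c * cnj c ^ Suc m"
      using unit_power_cnj[OF c, of m "Suc m"] by (simp add: mult.commute mult.left_commute)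
    also have "(c * cnj c ^ Suc m) *\<^sub>C lift (Suc m) x = c *\<^sub>C ((proj (Suc m) o\<^sub>L z) o\<^sub>L proj (Suc m))"
      unfolding z_cut by (simp add: Z_def scaleC_scaleC)
    also have "\<dots> = (proj (Suc m) o\<^sub>L (c *\<^sub>C z)) o\<^sub>L proj (Suc m)"
      by (simp add: blinfun_compose_scaleC lift_ops)
    finally show ?thesis .
  qed
  have "\<theta> z = c *\<^sub>C z"
  proof (rule blinfun_eqI)
    fix k
    have eq: "proj (Suc m) (\<theta> z (proj (Suc m) k)) = proj (Suc m) (blinfun_apply (c *\<^sub>C z) (proj (Suc m) k))" for m
      using arg_cong[OF same[of m], of "\<lambda>T. blinfun_apply T k"] by simp
    have "(\<lambda>m. proj (Suc m) (\<theta> z (proj (Suc m) k))) \<longlonglongrightarrow> blinfun_apply (c *\<^sub>C z) k"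
      unfolding eq by (rule LIMSEQ_Suc[OF proj_cut_limit])
    with LIMSEQ_Suc[OF proj_cut_limit[of "\<theta> z" k]] show "\<theta> z k = blinfun_apply (c *\<^sub>C z) k"
      by (rule LIMSEQ_unique)
  qed
  moreover have "compress_op J z = x"
  proof -
    have "compress_op J z = compress_op J (Z 0)"
      using compress_proj[of 0 z] z_cut[of 0] by simp
    then show ?thesis
      by (simp add: Z_def lift_0 compress_embed_op J_isometric)
  qed
  ultimately show thesis
    using that zB by blast
qed

lemma compress_image_eigen:
  "compress_op J ` peripheral_eigen B \<theta> = peripheral_eigen bounded_ops \<tau>"
proof
  show "compress_op J ` peripheral_eigen B \<theta> \<subseteq> peripheral_eigen bounded_ops \<tau>"
    using compress_eigen by blast
  show "peripheral_eigen bounded_ops \<tau> \<subseteq> compress_op J ` peripheral_eigen B \<theta>"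
  proof
    fix x assume "x \<in> peripheral_eigen bounded_ops \<tau>"
    then obtain c where "x \<in> bounded_ops" "norm c = 1" "\<tau> x = c *\<^sub>C x" by blast
    then show "x \<in> compress_op J ` peripheral_eigen B \<theta>"
      using eigen_lift_exists by blast
  qed
qed

text \<open>The image of the complete space \<open>peripheral_space B \<theta>\<close> under the isometric compression is
  complete, hence closed.\<close>

lemma compress_bij: "bij_betw (compress_op J) (peripheral_space B \<theta>) (peripheral_space bounded_ops \<tau>)"
proof -
  let ?E = "peripheral_eigen B \<theta>" and ?F = "peripheral_eigen bounded_ops \<tau>"
  let ?P = "peripheral_space B \<theta>" and ?T = "compress_op J"
  note P = csubspace_peripheral_space[of B \<theta>]
  have "inj_on ?T ?P"
  proof (rule inj_onI)
    fix x y assume xy: "x \<in> ?P" "y \<in> ?P" "?T x = ?T y"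
    then have "x - y \<in> ?P" by (intro complex_vector.subspace_diff[OF P])
    moreover have "?T (x - y) = 0"
      using xy(3) by (simp add: linear_diff[OF bounded_linear.linear[OF bounded_linear_compress_op]])
    ultimately show "x = y"
      using compress_isometric[of "x - y"] by simp
  qed
  moreover have "?T ` ?P = peripheral_space bounded_ops \<tau>"
  proof
    have "csubspace (?T -` cspan ?F)"
      using complex_vector.subspace_span[of ?F]
      by (auto simp: complex_vector.subspace_def compress_op_add compress_op_scaleC J_ops
          linear_0[OF bounded_linear.linear[OF bounded_linear_compress_op]])
    then have "cspan ?E \<subseteq> ?T -` cspan ?F"
      using compress_image_eigen complex_vector.span_superset
      by (intro complex_vector.span_minimal) blast+
    then have "?T ` cspan ?E \<subseteq> cspan ?F" by blast
    then show "?T ` ?P \<subseteq> peripheral_space bounded_ops \<tau>"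
      unfolding peripheral_space_def
      using closure_bounded_linear_image_subset[OF bounded_linear_compress_op, of J "cspan ?E"]
        closure_mono by blast
    have "subspace ?P"
      using P by (auto simp: subspace_def complex_vector.subspace_def simp flip: scaleC_of_real)
    moreover have "complete ?P"
      by (simp add: peripheral_space_def complete_eq_closed)
    ultimately have "complete (?T ` ?P)"
      by (intro complete_isometric_image[of 1]) (auto simp: compress_isometric bounded_linear_compress_op)
    then have "closed (?T ` ?P)"
      by (simp add: complete_eq_closed)
    moreover have "csubspace (?T ` ?P)"
      unfolding complex_vector.subspace_def
    proof (intro conjI ballI allI)
      show "0 \<in> ?T ` ?P"
        using complex_vector.subspace_0[OF P] linear_0[OF bounded_linear.linear[OF bounded_linear_compress_op]]
        by (metis imageI)
    next
      fix x y assume "x \<in> ?T ` ?P" "y \<in> ?T ` ?P"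
      then show "x + y \<in> ?T ` ?P"
        using complex_vector.subspace_add[OF P] by (auto simp flip: compress_op_add)
    next
      fix d x assume "x \<in> ?T ` ?P"
      then show "d *\<^sub>C x \<in> ?T ` ?P"
        using complex_vector.subspace_scale[OF P] by (auto simp: J_ops simp flip: compress_op_scaleC)
    qed
    moreover have "?F \<subseteq> ?T ` ?P"
      using compress_image_eigen peripheral_eigen_subset[of B \<theta>] by blast
    ultimately show "peripheral_space bounded_ops \<tau> \<subseteq> ?T ` ?P"
      unfolding peripheral_space_def[of bounded_ops]
      by (intro closure_minimal complex_vector.span_minimal)
  qed
  ultimately show ?thesis by (simp add: bij_betw_def)
qed

definition Tinv :: "('h \<Rightarrow>\<^sub>L 'h) \<Rightarrow> ('k \<Rightarrow>\<^sub>L 'k)"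
  where "Tinv = inv_into (peripheral_space B \<theta>) (compress_op J)"

lemma peripheral_product_Tinv:
  "peripheral_product J B \<theta> x y = compress_op J (Tinv x o\<^sub>L Tinv y)"
  by (simp add: peripheral_product_def Tinv_def Let_def)

lemma Tinv_compress: "z \<in> peripheral_space B \<theta> \<Longrightarrow> Tinv (compress_op J z) = z"
  unfolding Tinv_def using compress_bij by (simp add: bij_betw_def)

lemma Tinv_in: "x \<in> peripheral_space bounded_ops \<tau> \<Longrightarrow> Tinv x \<in> peripheral_space B \<theta>"
  and compress_Tinv: "x \<in> peripheral_space bounded_ops \<tau> \<Longrightarrow> compress_op J (Tinv x) = x"
  unfolding Tinv_def using compress_bij
  by (auto simp: bij_betw_def f_inv_into_f intro: inv_into_into)

lemma norm_Tinv: "x \<in> peripheral_space bounded_ops \<tau> \<Longrightarrow> norm (Tinv x) = norm x"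
  using compress_isometric[OF Tinv_in] compress_Tinv by simp

lemma Tinv_add:
  "x \<in> peripheral_space bounded_ops \<tau> \<Longrightarrow> y \<in> peripheral_space bounded_ops \<tau> \<Longrightarrow>
    Tinv (x + y) = Tinv x + Tinv y"
  using Tinv_compress[of "Tinv x + Tinv y"] Tinv_in compress_Tinv
    complex_vector.subspace_add[OF csubspace_peripheral_space[of B \<theta>]]
  by (simp add: compress_op_add)

lemma Tinv_scaleC:
  "x \<in> peripheral_space bounded_ops \<tau> \<Longrightarrow> Tinv (c *\<^sub>C x) = c *\<^sub>C Tinv x"
  using Tinv_compress[of "c *\<^sub>C Tinv x"] Tinv_in compress_Tinv
    complex_vector.subspace_scale[OF csubspace_peripheral_space[of B \<theta>]]
  by (simp add: compress_op_scaleC J_ops)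

lemma peripheral_space_ops: "peripheral_space B \<theta> \<subseteq> bounded_ops"
  unfolding peripheral_space_def
  using eigen_span_subset B_closed(2) by (intro closure_minimal closed_bounded_ops) blast

lemma peripheral_product_bilinear:
  assumes x: "x \<in> peripheral_space bounded_ops \<tau>" and y: "y \<in> peripheral_space bounded_ops \<tau>"
  shows "x' \<in> peripheral_space bounded_ops \<tau> \<Longrightarrow>
      peripheral_product J B \<theta> (x + x') y = peripheral_product J B \<theta> x y + peripheral_product J B \<theta> x' y"
    and "y' \<in> peripheral_space bounded_ops \<tau> \<Longrightarrow>
      peripheral_product J B \<theta> x (y + y') = peripheral_product J B \<theta> x y + peripheral_product J B \<theta> x y'"
    and "peripheral_product J B \<theta> (c *\<^sub>C x) y = c *\<^sub>C peripheral_product J B \<theta> x y"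
    and "peripheral_product J B \<theta> x (c *\<^sub>C y) = c *\<^sub>C peripheral_product J B \<theta> x y"
    and "norm (peripheral_product J B \<theta> x y) \<le> norm x * norm y"
proof -
  have ops: "Tinv x \<in> bounded_ops"
    using Tinv_in[OF x] peripheral_space_ops by blast
  show "x' \<in> peripheral_space bounded_ops \<tau> \<Longrightarrow>
      peripheral_product J B \<theta> (x + x') y = peripheral_product J B \<theta> x y + peripheral_product J B \<theta> x' y"
    "y' \<in> peripheral_space bounded_ops \<tau> \<Longrightarrow>
      peripheral_product J B \<theta> x (y + y') = peripheral_product J B \<theta> x y + peripheral_product J B \<theta> x y'"
    "peripheral_product J B \<theta> (c *\<^sub>C x) y = c *\<^sub>C peripheral_product J B \<theta> x y"
    "peripheral_product J B \<theta> x (c *\<^sub>C y) = c *\<^sub>C peripheral_product J B \<theta> x y"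
    using x y ops
    by (simp_all add: peripheral_product_Tinv Tinv_add Tinv_scaleC blinfun_compose_algebra
        compress_op_add blinfun_compose_scaleC compress_op_scaleC J_ops)
  have "norm (peripheral_product J B \<theta> x y) \<le> norm (Tinv x o\<^sub>L Tinv y)"
    unfolding peripheral_product_Tinv by (rule norm_compress_op_le[OF J_isometric])
  also have "\<dots> \<le> norm (Tinv x) * norm (Tinv y)"
    by (rule norm_blinfun_compose)
  finally show "norm (peripheral_product J B \<theta> x y) \<le> norm x * norm y"
    by (simp add: norm_Tinv x y)
qed

text \<open>If \<open>z\<close> and \<open>w\<close> are the eigenoperators of \<open>\<theta>\<close> over \<open>x\<close> and \<open>y\<close>, then \<open>(c d)\<^sup>-\<^sup>n \<tau>\<^sup>n(x y)\<close> is the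
  compression of \<open>z p\<^sub>n w\<close> for \<open>p\<^sub>n = proj n\<close>, which tends strongly to \<open>z w\<close>.\<close>

lemma peripheral_product_eigen_limit:
  assumes x: "x \<in> bounded_ops" "norm c = 1" "\<tau> x = c *\<^sub>C x"
    and y: "y \<in> bounded_ops" "norm d = 1" "\<tau> y = d *\<^sub>C y"
  shows "(\<lambda>n. (cnj c ^ n * cnj d ^ n) *\<^sub>C (\<tau> ^^ n) (x o\<^sub>L y) h)
    \<longlonglongrightarrow> blinfun_apply (peripheral_product J B \<theta> x y) h"
proof -
  obtain z where z: "z \<in> B" "\<theta> z = c *\<^sub>C z" "compress_op J z = x"
    using eigen_lift_exists[OF x] .
  obtain w where w: "w \<in> B" "\<theta> w = d *\<^sub>C w" "compress_op J w = y"
    using eigen_lift_exists[OF y] .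
  have in_P: "u \<in> peripheral_space B \<theta>" if "u \<in> peripheral_eigen B \<theta>" for u
    using that peripheral_eigen_subset[of B \<theta>] by blast
  have T: "Tinv x = z" "Tinv y = w"
    using Tinv_compress[OF in_P, of z] Tinv_compress[OF in_P, of w] z w x(2) y(2) by auto
  have main: "(cnj c ^ n * cnj d ^ n) *\<^sub>C (\<tau> ^^ n) (x o\<^sub>L y) h = adj J (z (proj n (w (J h))))" for n
  proof -
    have "(\<tau> ^^ n) (x o\<^sub>L y) = compress_op J (lift n x o\<^sub>L lift n y)"
      using compress_lift[of "x o\<^sub>L y" n] by (simp add: x y lift_hom)
    also have "lift n x o\<^sub>L lift n y
        = (proj n o\<^sub>L ((\<theta> ^^ n) z o\<^sub>L (proj n o\<^sub>L (proj n o\<^sub>L (\<theta> ^^ n) w)))) o\<^sub>L proj n"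
      using lift_compress[OF z(1), of n] lift_compress[OF w(1), of n]
      by (simp add: z(3) w(3) blinfun_compose_assoc)
    also have "proj n o\<^sub>L (proj n o\<^sub>L (\<theta> ^^ n) w) = proj n o\<^sub>L (\<theta> ^^ n) w"
      using proj_lift[of id_blinfun n] by (simp flip: blinfun_compose_assoc)
    finally have "(\<tau> ^^ n) (x o\<^sub>L y) = compress_op J ((\<theta> ^^ n) z o\<^sub>L (proj n o\<^sub>L (\<theta> ^^ n) w))"
      by (simp only: compress_proj)
    then have "(\<tau> ^^ n) (x o\<^sub>L y) h = (c ^ n * d ^ n) *\<^sub>C adj J (z (proj n (w (J h))))"
      using z(1) B_ops
      by (simp add: compress_op_apply eigen_funpow[OF z(1,2)] eigen_funpow[OF w(1,2)]
          bounded_ops_scaleC J_ops lift_ops scaleC_scaleC)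
    moreover have "cnj c ^ n * cnj d ^ n * (c ^ n * d ^ n) = 1"
      using unit_power_cnj[OF x(2), of 0 n] unit_power_cnj[OF y(2), of 0 n]
      by (simp add: mult.commute mult.left_commute)
    ultimately show ?thesis
      by (simp add: scaleC_scaleC)
  qed
  have "(\<lambda>n. adj J (z (proj n (w (J h))))) \<longlonglongrightarrow> adj J (z (w (J h)))"
    by (intro bounded_linear.tendsto[OF blinfun.bounded_linear_right] proj_strong_limit)
  then show ?thesis
    by (simp add: main peripheral_product_Tinv T compress_op_apply)
qed

end

text \<open>Both products are bounded and bilinear, and on eigenoperators they are limits of the same
  sequence.\<close>

theorem peripheral_product_unique:
  fixes J1 :: "'h::chilbert_space \<Rightarrow>\<^sub>L 'k1::chilbert_space"
    and J2 :: "'h::chilbert_space \<Rightarrow>\<^sub>L 'k2::chilbert_space"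
  assumes 1: "unital_dilation \<tau> J1 B1 \<theta>1" and 2: "unital_dilation \<tau> J2 B2 \<theta>2"
    and x: "x \<in> peripheral_space bounded_ops \<tau>" and y: "y \<in> peripheral_space bounded_ops \<tau>"
  shows "peripheral_product J1 B1 \<theta>1 x y = peripheral_product J2 B2 \<theta>2 x y"
proof -
  let ?P = "peripheral_space bounded_ops \<tau>" and ?E = "peripheral_eigen bounded_ops \<tau>"
  let ?f = "\<lambda>x y. peripheral_product J1 B1 \<theta>1 x y - peripheral_product J2 B2 \<theta>2 x y"
  note bil = unital_dilation.peripheral_product_bilinear[OF 1]
    unital_dilation.peripheral_product_bilinear[OF 2]
  have P: "?P = closure (cspan ?E)" by (simp add: peripheral_space_def)
  have in_P: "u \<in> ?P" if "u \<in> ?E" for u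
    using that peripheral_eigen_subset[of bounded_ops \<tau>] by blast
  have zero: "?f x y = 0" if xE: "x \<in> ?E" and yE: "y \<in> ?E" for x y
  proof -
    obtain c where c: "x \<in> bounded_ops" "norm c = 1" "\<tau> x = c *\<^sub>C x"
      using xE by auto
    obtain d where d: "y \<in> bounded_ops" "norm d = 1" "\<tau> y = d *\<^sub>C y"
      using yE by auto
    have "peripheral_product J1 B1 \<theta>1 x y = peripheral_product J2 B2 \<theta>2 x y"
    proof (rule blinfun_eqI)
      fix h
      show "peripheral_product J1 B1 \<theta>1 x y h = peripheral_product J2 B2 \<theta>2 x y h"
        by (rule LIMSEQ_unique[OF unital_dilation.peripheral_product_eigen_limit[OF 1 c d]
              unital_dilation.peripheral_product_eigen_limit[OF 2 c d]])
    qed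
    then show ?thesis by simp
  qed
  have bound: "norm (?f x y) \<le> 2 * norm x * norm y" if "x \<in> ?P" "y \<in> ?P" for x y
    using norm_triangle_ineq4[of "peripheral_product J1 B1 \<theta>1 x y" "peripheral_product J2 B2 \<theta>2 x y"]
      bil(5)[OF that] bil(10)[OF that] by simp
  note vanish = vanish_on_closed_span[of ?E, folded P]
  have left: "?f x y = 0" if yE: "y \<in> ?E" and xP: "x \<in> ?P" for x y
  proof (rule vanish[where f = "\<lambda>x. ?f x y" and K = "2 * norm y"])
    fix u v c assume u: "u \<in> ?P"
    show "v \<in> ?P \<Longrightarrow> ?f (u + v) y = ?f u y + ?f v y"
      by (simp add: bil(1)[OF u in_P[OF yE]] bil(6)[OF u in_P[OF yE]])
    show "?f (c *\<^sub>C u) y = c *\<^sub>C ?f u y"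
      by (simp add: bil(3)[OF u in_P[OF yE]] bil(8)[OF u in_P[OF yE]]
          complex_vector.scale_right_diff_distrib)
    show "norm (?f u y) \<le> 2 * norm y * norm u"
      using bound[OF u in_P[OF yE]] by (simp add: mult_ac)
  qed (use zero yE xP in blast)+
  have "?f x y = 0"
  proof (rule vanish[where f = "?f x" and K = "2 * norm x"])
    fix u v c assume u: "u \<in> ?P"
    show "v \<in> ?P \<Longrightarrow> ?f x (u + v) = ?f x u + ?f x v"
      by (simp add: bil(2)[OF x u] bil(7)[OF x u])
    show "?f x (c *\<^sub>C u) = c *\<^sub>C ?f x u"
      by (simp add: bil(4)[OF x u] bil(9)[OF x u] complex_vector.scale_right_diff_distrib)
    show "norm (?f x u) \<le> 2 * norm x * norm u"
      using bound[OF x u] .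
  qed (use left x y in blast)+
  then show ?thesis by simp
qed

section \<open>Completeness of the trigonometric system\<close>

lemma borel_measurable_haarI:
  assumes "g \<in> borel_measurable borel"
  shows "g \<in> borel_measurable haar"
  unfolding measurable_cong_sets[OF sets_haar refl]
  by (rule measurable_restrict_space1[OF assms])

lemma sets_haar_iff: "A \<in> sets haar \<longleftrightarrow> (\<exists>B. B \<in> sets borel \<and> A = B \<inter> sphere 0 1)"
  by (auto simp: sets_haar sets_restrict_space)

lemma powi_measurable: "(\<lambda>z. z powi n) \<in> borel_measurable haar"
proof -
  have "(\<lambda>z::complex. z powi n) \<in> borel_measurable (restrict_space borel (sphere 0 1))"
    by (intro borel_measurable_continuous_on_restrict continuous_on_power_int continuous_on_id) auto
  then show ?thesis
    by (simp add: measurable_cong_sets[OF sets_haar refl])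
qed

lemma AE_haar_norm: "AE z in haar. norm z = 1"
  by (rule AE_I2) (simp add: space_haar)

lemma inverse_eq_cnj: "norm z = 1 \<Longrightarrow> inverse z = cnj z"
  by (simp add: inverse_complex_def cmod_def complex_eq_iff divide_simps)

lemma integrable_bounded_mult:
  fixes f g :: "complex \<Rightarrow> complex"
  assumes "integrable haar f" "g \<in> borel_measurable haar" "\<And>z. norm z = 1 \<Longrightarrow> norm (g z) \<le> K"
  shows "integrable haar (\<lambda>z. f z * g z)"
proof (rule Bochner_Integration.integrable_bound)
  show "integrable haar (\<lambda>z. K * norm (f z))"
    using assms(1) by simp
  show "(\<lambda>z. f z * g z) \<in> borel_measurable haar"
    using assms(1,2) by (intro borel_measurable_times) auto
  show "AE z in haar. norm (f z * g z) \<le> norm (K * norm (f z))"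
    using AE_haar_norm
  proof eventually_elim
    case (elim z)
    have "norm (f z * g z) \<le> norm (f z) * K"
      unfolding norm_mult by (intro mult_left_mono assms(3) elim) simp
    then show ?case by (simp add: mult.commute)
  qed
qed

text \<open>If multiplication by \<open>\<phi>\<close> preserves orthogonality to all powers, so does multiplication by
  \<open>\<phi>\<close> times any polynomial in the real and imaginary part, because these are linear combinations of
  \<open>z\<close> and \<open>z\<^sup>-\<^sup>1\<close> on the circle.\<close>

lemma annihilates_polynomials:
  fixes f :: "complex \<Rightarrow> complex" and p :: "complex \<Rightarrow> real"
  assumes f: "integrable haar f" and orth: "\<And>n::int. (\<integral>z. f z * z powi n \<partial>haar) = 0"
    and p: "real_polynomial_function p"
  shows "(\<integral>z. f z * of_real (p z) \<partial>haar) = 0"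
proof -
  define good where "good \<phi> \<longleftrightarrow> integrable haar (\<lambda>z. f z * \<phi> z) \<and> (\<forall>n::int. (\<integral>z. f z * \<phi> z * z powi n \<partial>haar) = 0)"
    for \<phi> :: "complex \<Rightarrow> complex"
  have good_int: "integrable haar (\<lambda>z. f z * \<phi> z * z powi n)" if "good \<phi>" for \<phi> n
    using that by (intro integrable_bounded_mult[of "\<lambda>z. f z * \<phi> z" _ 1] powi_measurable)
      (auto simp: good_def norm_power_int)
  have good_powi: "good (\<lambda>z. \<phi> z * z powi m)" if g: "good \<phi>" for \<phi> m
  proof -
    have "(\<integral>z. f z * (\<phi> z * z powi m) * z powi n \<partial>haar) = (\<integral>z. f z * \<phi> z * z powi (m + n) \<partial>haar)" for n
    proof (rule integral_cong_AE)
      show "AE z in haar. f z * (\<phi> z * z powi m) * z powi n = f z * \<phi> z * z powi (m + n)"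
        using AE_haar_norm
      proof eventually_elim
        case (elim z)
        then have "z \<noteq> 0" by auto
        then show ?case by (simp add: power_int_add)
      qed
      show "(\<lambda>z. f z * (\<phi> z * z powi m) * z powi n) \<in> borel_measurable haar"
        using borel_measurable_times[OF borel_measurable_integrable[OF good_int[OF g, of m]] powi_measurable[of n]]
        by (simp add: mult.assoc)
    qed (use good_int[OF g] in auto)
    then show ?thesis
      using g good_int[OF g, of m] by (simp add: good_def mult.assoc)
  qed
  have good_add: "good (\<lambda>z. \<phi> z + \<psi> z)" if "good \<phi>" "good \<psi>" for \<phi> \<psi>
    using that good_int[OF that(1)] good_int[OF that(2)]
    by (simp add: good_def distrib_left distrib_right)
  have good_scale: "good (\<lambda>z. c * \<phi> z)" if "good \<phi>" for \<phi> c
  proof -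
    have "f z * (c * \<phi> z) = c * (f z * \<phi> z)" "f z * (c * \<phi> z) * w = c * (f z * \<phi> z * w)" for z w
      by simp_all
    then show ?thesis
      using that by (simp only: good_def) simp
  qed
  have good_cong: "good \<psi>" if g: "good \<phi>" and eq: "\<And>z. norm z = 1 \<Longrightarrow> \<phi> z = \<psi> z" for \<phi> \<psi>
  proof -
    have "integrable haar (\<lambda>z. f z * \<psi> z) \<longleftrightarrow> integrable haar (\<lambda>z. f z * \<phi> z)"
      by (rule Bochner_Integration.integrable_cong) (auto simp: space_haar eq)
    moreover have "(\<integral>z. f z * \<psi> z * z powi n \<partial>haar) = (\<integral>z. f z * \<phi> z * z powi n \<partial>haar)" for n
      by (rule Bochner_Integration.integral_cong) (auto simp: space_haar eq)
    ultimately show ?thesis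
      using g by (simp add: good_def)
  qed
  have "good (\<lambda>z. \<phi> z * of_real (p z))" if "good \<phi>" for \<phi>
    using p that
  proof (induction p arbitrary: \<phi>)
    case (linear l)
    interpret l: bounded_linear l by fact
    define a b where "a = l 1" and "b = l \<i>"
    have l: "l z = a * Re z + b * Im z" for z
    proof -
      have "z = Re z *\<^sub>R 1 + Im z *\<^sub>R \<i>" by (simp add: complex_eq_iff)
      then have "l z = l (Re z *\<^sub>R 1 + Im z *\<^sub>R \<i>)" by simp
      then show ?thesis by (simp add: l.add l.scaleR a_def b_def)
    qed
    have *: "complex_of_real (l z) = ((a - \<i> * b) / 2) * z powi 1 + ((a + \<i> * b) / 2) * z powi (-1)"
      if "norm z = 1" for z
    proof -
      have "z powi (-1) = cnj z"
        using inverse_eq_cnj[OF that] by (simp add: power_int_minus)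
      then show ?thesis
        by (simp only: l power_int_1_right) (simp add: complex_eq_iff field_simps)
    qed
    have "good (\<lambda>z. (((a - \<i> * b) / 2) * (\<phi> z * z powi 1)) + (((a + \<i> * b) / 2) * (\<phi> z * z powi (-1))))"
      by (intro good_add good_scale good_powi linear)
    then show ?case
      by (rule good_cong) (simp add: * algebra_simps)
  next
    case (const c)
    then show ?case
      using good_scale[of \<phi> "of_real c"] by (simp add: mult.commute)
  next
    case (add p q)
    then show ?case
      using good_add[OF add.IH(1) add.IH(2)] by (simp add: distrib_left)
  next
    case (mult p q)
    show ?case
      using mult.IH(2)[OF mult.IH(1)[OF mult.prems]] by (simp add: mult.assoc)
  qed
  moreover have "good (\<lambda>z. 1)"
    using f orth by (simp add: good_def)
  ultimately have "good (\<lambda>z. 1 * of_real (p z))" by blast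
  then have "(\<integral>z. f z * of_real (p z) * z powi 0 \<partial>haar) = 0"
    unfolding good_def by (metis (no_types, lifting) Bochner_Integration.integral_cong mult_1)
  then show ?thesis by simp
qed

text \<open>By Stone--Weierstrass continuous functions are uniform limits of polynomials on the circle.\<close>

lemma annihilates_continuous:
  fixes f :: "complex \<Rightarrow> complex" and g :: "complex \<Rightarrow> real"
  assumes f: "integrable haar f" and orth: "\<And>n::int. (\<integral>z. f z * z powi n \<partial>haar) = 0"
    and g: "continuous_on UNIV g"
  shows "(\<integral>z. f z * of_real (g z) \<partial>haar) = 0"
proof -
  let ?I = "\<integral>z. f z * of_real (g z) \<partial>haar"
  have meas: "(\<lambda>z. complex_of_real (h z)) \<in> borel_measurable haar" if "continuous_on UNIV h"
    for h :: "complex \<Rightarrow> real"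
    using that by (intro borel_measurable_haarI borel_measurable_continuous_onI continuous_intros)
  have int: "integrable haar (\<lambda>z. f z * complex_of_real (h z))" if h: "continuous_on UNIV h"
    for h :: "complex \<Rightarrow> real"
  proof -
    have "compact (h ` sphere 0 1)"
      using h by (intro compact_continuous_image continuous_on_subset[OF h]) auto
    then obtain K where K: "\<forall>y\<in>h ` sphere 0 1. norm y \<le> K"
      using compact_imp_bounded bounded_iff by blast
    have "norm (h z) \<le> K" if "norm z = 1" for z
      using K that by simp
    then show ?thesis
      using f meas[OF h] by (intro integrable_bounded_mult[where K = K]) auto
  qed
  have "norm ?I \<le> e" if e: "0 < e" for e
  proof -
    let ?L = "\<integral>z. norm (f z) \<partial>haar"
    have L: "0 \<le> ?L" by simp
    define d where "d = e / (?L + 1)"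
    have L1: "?L + 1 > 0" using L by linarith
    then have d: "0 < d" unfolding d_def using e by (intro divide_pos_pos)
    obtain p where p: "real_polynomial_function p" "\<And>z. z \<in> sphere 0 1 \<Longrightarrow> \<bar>g z - p z\<bar> < d"
      using Stone_Weierstrass_real_polynomial_function[of "sphere 0 1" g d] g d
        continuous_on_subset[of UNIV g] by (metis compact_sphere subset_UNIV)
    have pc: "continuous_on UNIV p"
      using p(1) by (simp add: continuous_on_polymonial_function real_polynomial_function_eq)
    have "?I = ?I - (\<integral>z. f z * of_real (p z) \<partial>haar)"
      by (simp add: annihilates_polynomials[OF f orth p(1)])
    also have "\<dots> = (\<integral>z. f z * of_real (g z) - f z * of_real (p z) \<partial>haar)"
      by (rule Bochner_Integration.integral_diff[symmetric, OF int[OF g] int[OF pc]])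
    finally have "norm ?I \<le> (\<integral>z. norm (f z * of_real (g z) - f z * of_real (p z)) \<partial>haar)"
      using integral_norm_bound by metis
    also have "\<dots> \<le> (\<integral>z. d * norm (f z) \<partial>haar)"
    proof (rule integral_mono_AE)
      show "AE z in haar. norm (f z * of_real (g z) - f z * of_real (p z)) \<le> d * norm (f z)"
        using AE_haar_norm
      proof eventually_elim
        case (elim z)
        have "f z * of_real (g z) - f z * of_real (p z) = f z * of_real (g z - p z)"
          by (simp add: algebra_simps)
        also have "norm \<dots> = norm (f z) * \<bar>g z - p z\<bar>"
          unfolding norm_mult norm_of_real by simp
        also have "\<dots> \<le> norm (f z) * d"
          using p(2)[of z] elim by (intro mult_left_mono) auto
        finally show ?case by (simp add: mult.commute)
      qed
    qed (use f int[OF g] int[OF pc] in auto)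
    also have "\<dots> = d * ?L" by simp
    also have "\<dots> \<le> d * (?L + 1)" using d by (intro mult_left_mono) auto
    also have "\<dots> = e" using L1 by (simp add: d_def)
    finally show ?thesis .
  qed
  then have "norm ?I \<le> 0" by (rule field_le_epsilon[of _ 0, simplified])
  then show ?thesis by simp
qed

text \<open>The indicator of a closed set \<open>K\<close> is the limit of the continuous functions
  \<open>max 0 (1 - n dist(z, K))\<close>.\<close>

lemma annihilates_closed:
  fixes f :: "complex \<Rightarrow> complex"
  assumes f: "integrable haar f" and orth: "\<And>n::int. (\<integral>z. f z * z powi n \<partial>haar) = 0"
    and K: "closed K"
  shows "(\<integral>z. f z * indicator K z \<partial>haar) = 0"
proof (cases "K = {}")
  case False
  define g where "g n z = max 0 (1 - real n * infdist z K)" for n z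
  have gc: "continuous_on UNIV (g n)" for n
    unfolding g_def by (intro continuous_intros continuous_on_infdist)
  have lim: "(\<lambda>n. g n z) \<longlonglongrightarrow> indicator K z" for z
  proof (cases "z \<in> K")
    case True
    then show ?thesis by (simp add: g_def)
  next
    case z: False
    then have d: "0 < infdist z K"
      using K False by (simp add: infdist_pos_not_in_closed)
    then obtain N where N: "1 / infdist z K < real N"
      using reals_Archimedean2 by blast
    have "g n z = 0" if "N \<le> n" for n
    proof -
      have "1 / infdist z K < real n" using N that by linarith
      then show ?thesis using d by (simp add: g_def field_simps)
    qed
    then show ?thesis
      using z by (intro tendsto_eventually) (auto simp: eventually_sequentially)
  qed
  have "(\<lambda>n. \<integral>z. f z * of_real (g n z) \<partial>haar) \<longlonglongrightarrow> (\<integral>z. f z * indicator K z \<partial>haar)"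
  proof (rule integral_dominated_convergence[where w = "\<lambda>z. norm (f z)"])
    show "(\<lambda>z. f z * indicator K z) \<in> borel_measurable haar"
      using K by (intro borel_measurable_times[OF borel_measurable_integrable[OF f]]
          borel_measurable_haarI borel_measurable_indicator) auto
    show "(\<lambda>z. f z * of_real (g n z)) \<in> borel_measurable haar" for n
      using gc by (intro borel_measurable_times[OF borel_measurable_integrable[OF f]]
          borel_measurable_haarI borel_measurable_continuous_onI continuous_intros) auto
    show "AE z in haar. (\<lambda>n. f z * of_real (g n z)) \<longlonglongrightarrow> f z * indicator K z"
    proof (rule AE_I2)
      fix z
      have "(\<lambda>n. f z * of_real (g n z)) \<longlonglongrightarrow> f z * of_real (indicator K z)"
        by (intro tendsto_intros lim)
      then show "(\<lambda>n. f z * of_real (g n z)) \<longlonglongrightarrow> f z * indicator K z"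
        by (simp add: of_real_indicator)
    qed
    have "\<bar>g n z\<bar> \<le> 1" for n z
      by (simp add: g_def infdist_nonneg)
    then show "AE z in haar. norm (f z * of_real (g n z)) \<le> norm (f z)" for n
      by (intro AE_I2) (simp add: norm_mult mult_left_le)
  qed (use f in auto)
  moreover have "(\<integral>z. f z * of_real (g n z) \<partial>haar) = 0" for n
    by (rule annihilates_continuous[OF f orth gc])
  ultimately show ?thesis
    by (simp add: LIMSEQ_const_iff)
qed simp

text \<open>The Borel sets over which \<open>f\<close> integrates to zero form a Dynkin system that contains the closed
  sets.\<close>

lemma fourier_uniqueness:
  fixes f :: "complex \<Rightarrow> complex"
  assumes f: "integrable haar f" and orth: "\<And>n::int. (\<integral>z. f z * z powi n \<partial>haar) = 0"
  shows "AE z in haar. f z = 0"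
proof -
  have int: "integrable haar (\<lambda>z. f z * indicator B z)" if "B \<in> sets borel" for B
    using that f by (intro integrable_bounded_mult[where K = 1] borel_measurable_haarI
        borel_measurable_indicator) (auto simp: indicator_def)
  have borel: "(\<integral>z. f z * indicator B z \<partial>haar) = 0" if "B \<in> sets borel" for B
  proof -
    have B: "B \<in> sigma_sets UNIV (Collect closed)"
      using that by (simp add: borel_eq_closed sets_measure_of)
    have sets: "sigma_sets UNIV (Collect closed) = sets (borel :: complex measure)"
      by (simp add: borel_eq_closed sets_measure_of)
    show ?thesis
    proof (rule sigma_sets_induct_disjoint[where A = B and G = "Collect closed" and \<Omega> = UNIV])
      show "B \<in> sigma_sets UNIV (Collect closed)" by (rule B)
      show "Int_stable (Collect closed :: complex set set)"
        by (auto simp: Int_stable_def)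
      show "(\<integral>z. f z * indicator A z \<partial>haar) = 0" if "A \<in> Collect closed" for A
        using annihilates_closed[OF f orth] that by simp
      show "(\<integral>z. f z * indicator (UNIV - A) z \<partial>haar) = 0"
        if "A \<in> sigma_sets UNIV (Collect closed)" "(\<integral>z. f z * indicator A z \<partial>haar) = 0" for A
      proof -
        have "f z * indicator (UNIV - A) z = f z * indicator UNIV z - f z * indicator A z" for z
          by (simp add: indicator_def)
        then show ?thesis
          using that int[of UNIV] int[of A] annihilates_closed[OF f orth closed_UNIV]
          by (simp only: sets) (subst Bochner_Integration.integral_diff, auto)
      qed
      show "(\<integral>z. f z * indicator (\<Union>i. A i) z \<partial>haar) = 0"
        if A: "disjoint_family A" "range A \<subseteq> sigma_sets UNIV (Collect closed)"
          "\<And>i::nat. (\<integral>z. f z * indicator (A i) z \<partial>haar) = 0" for A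
      proof -
        have Ab: "A i \<in> sets borel" for i
          using A(2) sets by blast
        have "(\<lambda>n. \<integral>z. f z * indicator (\<Union>i<n. A i) z \<partial>haar) \<longlonglongrightarrow> (\<integral>z. f z * indicator (\<Union>i. A i) z \<partial>haar)"
        proof (rule integral_dominated_convergence[where w = "\<lambda>z. norm (f z)"])
          show "(\<lambda>z. f z * indicator (\<Union>i. A i) z) \<in> borel_measurable haar"
            using int[of "\<Union>i. A i"] Ab by auto
          show "(\<lambda>z. f z * indicator (\<Union>i<n. A i) z) \<in> borel_measurable haar" for n
            using int[of "\<Union>i<n. A i"] Ab by auto
          show "AE z in haar. (\<lambda>n. f z * indicator (\<Union>i<n. A i) z) \<longlonglongrightarrow> f z * indicator (\<Union>i. A i) z"
            by (intro AE_I2 tendsto_intros LIMSEQ_indicator_UN)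
          show "AE z in haar. norm (f z * indicator (\<Union>i<n. A i) z) \<le> norm (f z)" for n
            by (intro AE_I2) (simp add: indicator_def)
        qed (use f in auto)
        moreover have "(\<integral>z. f z * indicator (\<Union>i<n. A i) z \<partial>haar) = 0" for n
        proof -
          have "f z * indicator (\<Union>i<n. A i) z = (\<Sum>i<n. f z * indicator (A i) z)" for z
          proof -
            have "disjoint_family_on A {..<n}"
              using A(1) by (auto simp: disjoint_family_on_def)
            then have "indicator (\<Union>i<n. A i) z = (\<Sum>i<n. indicator (A i) z :: complex)"
              by (intro indicator_UN_disjoint) auto
            then show ?thesis by (simp add: sum_distrib_left)
          qed
          then have "(\<integral>z. f z * indicator (\<Union>i<n. A i) z \<partial>haar) = (\<Sum>i<n. \<integral>z. f z * indicator (A i) z \<partial>haar)"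
            by (simp only:) (rule Bochner_Integration.integral_sum, rule int[OF Ab])
          then show ?thesis by (simp add: A(3))
        qed
        ultimately show ?thesis
          by (simp add: LIMSEQ_const_iff)
      qed
    qed simp_all
  qed
  show ?thesis
  proof (rule sigma_finite_measure.density_zero[OF finite_measure.axioms(1)[OF finite_measure_haar] f])
    fix A assume A: "A \<in> sets haar"
    then obtain B where B: "B \<in> sets borel" "A = B \<inter> sphere 0 1"
      by (auto simp: sets_haar_iff)
    have "set_lebesgue_integral haar A f = (\<integral>z. f z * indicator B z \<partial>haar)"
      unfolding set_lebesgue_integral_def
      by (rule Bochner_Integration.integral_cong) (auto simp: B space_haar indicator_def)
    then show "set_lebesgue_integral haar A f = 0"
      by (simp add: borel[OF B(1)])
  qed
qed

lemma abs_l2_eq_zero_iff: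
  assumes "square_integrable f"
  shows "abs_l2 f = 0 \<longleftrightarrow> (AE z in haar. f z = 0)"
proof -
  have "abs_l2 f = abs_l2 (\<lambda>_. 0) \<longleftrightarrow> l2_rel f (\<lambda>_. 0)"
    using assms Quotient3_rel[OF Quotient3_l2, of f "\<lambda>_. 0"]
    by (simp add: l2_rel_def square_integrable_zero)
  then show ?thesis
    using assms by (simp add: zero_l2.abs_eq l2_rel_def square_integrable_zero)
qed

lemma cinner_abs_l2:
  "square_integrable f \<Longrightarrow> square_integrable g \<Longrightarrow>
    cinner (abs_l2 f) (abs_l2 g) = (\<integral>z. f z * cnj (g z) \<partial>haar)"
  by (intro cinner_l2.abs_eq) (auto simp: l2_rel_def)

lemma square_integrable_powi: "square_integrable (\<lambda>z. z powi n)"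
  using fourier_basis.rsp by (auto simp: l2_rel_def rel_fun_def)

lemma fourier_basis_abs: "fourier_basis n = abs_l2 (\<lambda>z. z powi n)"
  by (simp add: fourier_basis.abs_eq)

lemma cinner_fourier_basis_zero: "cinner (fourier_basis 0) (fourier_basis 0) = 1"
proof -
  have "(norm (fourier_basis 0))\<^sup>2 = (\<integral>z. 1 \<partial>haar)"
    unfolding fourier_basis_abs norm_l2_abs[OF square_integrable_powi] by simp
  also have "\<dots> = 1"
    by (simp add: measure_def emeasure_haar_space)
  finally show ?thesis by (simp add: cinner_self)
qed

lemma square_integrable_imp_integrable:
  assumes "square_integrable f"
  shows "integrable haar f"
  using integrable_mult_cnj[OF assms square_integrable_powi[of 0]] by simp

lemma orthogonal_fourier_basis:
  assumes "\<And>n. cinner x (fourier_basis n) = 0"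
  shows "x = 0"
proof -
  obtain f where f: "square_integrable f" "x = abs_l2 f"
    by (rule l2_abs_cases)
  have "(\<integral>z. f z * z powi n \<partial>haar) = 0" for n
  proof -
    have "(\<integral>z. f z * z powi n \<partial>haar) = (\<integral>z. f z * cnj (z powi (- n)) \<partial>haar)"
    proof (rule Bochner_Integration.integral_cong)
      fix z assume "z \<in> space haar"
      then have "norm (z powi (- n)) = 1"
        by (simp add: space_haar norm_power_int)
      then have "cnj (z powi (- n)) = z powi n"
        using inverse_eq_cnj[of "z powi (- n)"] by (simp add: power_int_minus)
      then show "f z * z powi n = f z * cnj (z powi (- n))" by simp
    qed simp
    also have "\<dots> = cinner x (fourier_basis (- n))"
      by (simp add: f fourier_basis_abs cinner_abs_l2 square_integrable_powi)
    finally show ?thesis by (simp add: assms)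
  qed
  then have "AE z in haar. f z = 0"
    using fourier_uniqueness square_integrable_imp_integrable[OF f(1)] by blast
  then show ?thesis
    using f by (simp add: abs_l2_eq_zero_iff)
qed

lemma fourier_basis_dense: "closure (cspan (range fourier_basis)) = UNIV"
proof (rule dense_csubspaceI[OF complex_vector.subspace_span])
  fix x assume "\<And>m. m \<in> cspan (range fourier_basis) \<Longrightarrow> cinner x m = 0"
  then show "x = 0"
    using orthogonal_fourier_basis complex_vector.span_base by (metis rangeI)
qed

section \<open>Multiplication operators and rotations\<close>

lemma abs_l2_eqI:
  assumes "square_integrable f" "square_integrable g" "AE z in haar. f z = g z"
  shows "abs_l2 f = abs_l2 g"
  using Quotient3_rel_abs[OF Quotient3_l2, of f g] assms by (simp add: l2_rel_def)

lemma linfty_abs_cases: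
  obtains f where "essentially_bounded f" "F = abs_linfty f"
  by (metis Quotient3_linfty Quotient3_def linfty_rel_def)

lemma linfty_mult_l2_abs:
  "essentially_bounded f \<Longrightarrow> square_integrable g \<Longrightarrow>
    linfty_mult_l2 (abs_linfty f) (abs_l2 g) = abs_l2 (\<lambda>z. f z * g z)"
  by (simp add: linfty_mult_l2.abs_eq linfty_rel_def l2_rel_def)

lemma l2_rotate_abs:
  "norm c = 1 \<Longrightarrow> square_integrable f \<Longrightarrow> l2_rotate c (abs_l2 f) = abs_l2 (\<lambda>z. f (c * z))"
  by (simp add: l2_rotate.abs_eq l2_rel_def)

lemma linfty_rotate_abs:
  "norm c = 1 \<Longrightarrow> essentially_bounded f \<Longrightarrow>
    linfty_rotate c (abs_linfty f) = abs_linfty (\<lambda>z. f (c * z))"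
  by (simp add: linfty_rotate.abs_eq linfty_rel_def)

lemma linfty_cnj_abs:
  "essentially_bounded f \<Longrightarrow> linfty_cnj (abs_linfty f) = abs_linfty (\<lambda>z. cnj (f z))"
  by (simp add: linfty_cnj.abs_eq linfty_rel_def)

lemma linfty_abs_ops:
  assumes "essentially_bounded f" "essentially_bounded g"
  shows "abs_linfty f + abs_linfty g = abs_linfty (\<lambda>z. f z + g z)"
    "abs_linfty f * abs_linfty g = abs_linfty (\<lambda>z. f z * g z)"
  using assms by (simp_all add: plus_linfty.abs_eq times_linfty.abs_eq linfty_rel_def)

lemma linfty_abs_scaleC:
  "essentially_bounded f \<Longrightarrow> c *\<^sub>C abs_linfty f = abs_linfty (\<lambda>z. c * f z)"
  by (simp add: scaleC_linfty.abs_eq linfty_rel_def)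

lemma l2_abs_add:
  "square_integrable f \<Longrightarrow> square_integrable g \<Longrightarrow> abs_l2 f + abs_l2 g = abs_l2 (\<lambda>z. f z + g z)"
  by (simp add: plus_l2.abs_eq l2_rel_def)

lemma l2_abs_scaleC:
  "square_integrable f \<Longrightarrow> c *\<^sub>C abs_l2 f = abs_l2 (\<lambda>z. c * f z)"
  by (simp add: scaleC_l2.abs_eq l2_rel_def)

lemma essentially_bounded_scale: "essentially_bounded f \<Longrightarrow> essentially_bounded (\<lambda>z. c * f z)"
  by (intro essentially_bounded_mult essentially_bounded_const)

lemma l2_operator_eqI:
  fixes S T :: "l2 \<Rightarrow>\<^sub>L 'a::real_normed_vector"
  assumes "\<And>g. square_integrable g \<Longrightarrow> S (abs_l2 g) = T (abs_l2 g)"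
  shows "S = T"
  using assms l2_abs_cases by (metis blinfun_eqI)

lemma mult_op_abs:
  "essentially_bounded f \<Longrightarrow> square_integrable g \<Longrightarrow>
    mult_op (abs_linfty f) (abs_l2 g) = abs_l2 (\<lambda>z. f z * g z)"
  by (simp add: mult_op_apply linfty_mult_l2_abs)

lemma mult_op_in_bounded_ops [simp]: "mult_op F \<in> bounded_ops"
proof (rule bounded_opsI)
  fix c x
  obtain f g where fg: "essentially_bounded f" "F = abs_linfty f" "square_integrable g" "x = abs_l2 g"
    using linfty_abs_cases l2_abs_cases by metis
  then show "mult_op F (c *\<^sub>C x) = c *\<^sub>C mult_op F x"
    by (simp add: mult_op_abs l2_abs_scaleC square_integrable_scale square_integrable_mult mult.left_commute)
qed

lemma mult_op_add: "mult_op (F + G) = mult_op F + mult_op G"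
proof (rule l2_operator_eqI)
  fix h assume h: "square_integrable h"
  obtain f g where fg: "essentially_bounded f" "F = abs_linfty f" "essentially_bounded g" "G = abs_linfty g"
    using linfty_abs_cases by metis
  show "mult_op (F + G) (abs_l2 h) = blinfun_apply (mult_op F + mult_op G) (abs_l2 h)"
    by (simp add: fg h linfty_abs_ops mult_op_abs essentially_bounded_add blinfun.add_left l2_abs_add
        square_integrable_mult distrib_right)
qed

lemma mult_op_mult: "mult_op (F * G) = mult_op F o\<^sub>L mult_op G"
proof (rule l2_operator_eqI)
  fix h assume h: "square_integrable h"
  obtain f g where fg: "essentially_bounded f" "F = abs_linfty f" "essentially_bounded g" "G = abs_linfty g"
    using linfty_abs_cases by metis
  show "mult_op (F * G) (abs_l2 h) = (mult_op F o\<^sub>L mult_op G) (abs_l2 h)"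
    by (simp add: fg h linfty_abs_ops mult_op_abs essentially_bounded_mult square_integrable_mult mult.assoc)
qed

lemma mult_op_scaleC: "mult_op (c *\<^sub>C F) = c *\<^sub>C mult_op F"
proof (rule l2_operator_eqI)
  fix h assume h: "square_integrable h"
  obtain f where f: "essentially_bounded f" "F = abs_linfty f"
    using linfty_abs_cases by metis
  show "mult_op (c *\<^sub>C F) (abs_l2 h) = blinfun_apply (c *\<^sub>C mult_op F) (abs_l2 h)"
    by (simp add: f h linfty_abs_scaleC mult_op_abs essentially_bounded_scale l2_abs_scaleC
        square_integrable_mult mult.assoc)
qed

lemma mult_op_one: "mult_op 1 = id_blinfun"
  by (rule l2_operator_eqI) (simp add: one_linfty.abs_eq mult_op_abs essentially_bounded_const)

lemma mult_op_adj: "mult_op (linfty_cnj F) = adj (mult_op F)"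
proof (rule adj_eqI[symmetric])
  fix x y
  obtain f where f: "essentially_bounded f" "F = abs_linfty f"
    using linfty_abs_cases by metis
  obtain g h where "square_integrable g" "x = abs_l2 g" "square_integrable h" "y = abs_l2 h"
    using l2_abs_cases by metis
  then show "cinner (mult_op (linfty_cnj F) x) y = cinner x (mult_op F y)"
    using f by (simp add: linfty_cnj_abs mult_op_abs essentially_bounded_cnj cinner_abs_l2
        square_integrable_mult) (simp add: mult_ac)
qed

lemma rot_op_abs:
  "norm c = 1 \<Longrightarrow> square_integrable f \<Longrightarrow> rot_op c (abs_l2 f) = abs_l2 (\<lambda>z. f (c * z))"
  by (simp add: rot_op_apply l2_rotate_abs)

lemma rot_op_compose:
  assumes "norm c = 1" "norm d = 1"
  shows "rot_op c o\<^sub>L rot_op d = rot_op (c * d)"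
  by (rule l2_operator_eqI)
    (simp add: rot_op_abs assms norm_mult square_integrable_rotate(1) mult.assoc mult.left_commute)

lemma rot_op_one: "rot_op 1 = id_blinfun"
  by (rule l2_operator_eqI) (simp add: rot_op_abs)

lemma rot_op_in_bounded_ops [simp]:
  assumes "norm c = 1"
  shows "rot_op c \<in> bounded_ops"
proof (rule bounded_opsI)
  fix d x
  obtain g where "square_integrable g" "x = abs_l2 g"
    using l2_abs_cases by metis
  then show "rot_op c (d *\<^sub>C x) = d *\<^sub>C rot_op c x"
    by (simp add: assms rot_op_abs l2_abs_scaleC square_integrable_scale square_integrable_rotate(1))
qed

lemma cnj_mult_unit: "norm c = 1 \<Longrightarrow> cnj c * c = 1" "norm c = 1 \<Longrightarrow> c * cnj c = 1"
  using complex_norm_square[of c] by (simp_all add: mult.commute)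

lemma rot_op_adj:
  assumes c: "norm c = 1"
  shows "adj (rot_op c) = rot_op (cnj c)"
proof (rule adj_eqI)
  fix x y
  have iso: "norm (rot_op c x) = norm x" for x
  proof -
    obtain f where f: "square_integrable f" "x = abs_l2 f"
      using l2_abs_cases by metis
    have "(norm (rot_op c x))\<^sup>2 = (norm x)\<^sup>2"
      using c f by (simp add: rot_op_abs norm_l2_abs square_integrable_rotate)
    then show ?thesis by simp
  qed
  have "isometric_embedding (rot_op c)"
    using c iso by (simp add: isometric_embedding_def)
  then have "adj (rot_op c) (rot_op c y) = y" for y
    by (rule isometric_embedding_adj_apply)
  then have "cinner (rot_op c x') (rot_op c y) = cinner x' y" for x'
    using cinner_adj_right[OF rot_op_in_bounded_ops[OF c], of x' "rot_op c y"] by simp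
  from this[of "rot_op (cnj c) x"] show "cinner (rot_op (cnj c) x) y = cinner x (rot_op c y)"
    using blinfun_compose_eqD[OF rot_op_compose[of c "cnj c"], of x] c
    by (simp add: cnj_mult_unit rot_op_one)
qed

lemma rot_op_mult_op:
  assumes c: "norm c = 1"
  shows "rot_op c o\<^sub>L mult_op F = mult_op (linfty_rotate c F) o\<^sub>L rot_op c"
proof (rule l2_operator_eqI)
  fix h assume h: "square_integrable h"
  obtain f where f: "essentially_bounded f" "F = abs_linfty f"
    using linfty_abs_cases by metis
  show "(rot_op c o\<^sub>L mult_op F) (abs_l2 h) = (mult_op (linfty_rotate c F) o\<^sub>L rot_op c) (abs_l2 h)"
    by (simp add: f h c mult_op_abs rot_op_abs linfty_rotate_abs essentially_bounded_rotate
        square_integrable_mult square_integrable_rotate(1))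
qed

lemma linfty_rotate_rotate:
  assumes "norm c = 1" "norm d = 1"
  shows "linfty_rotate c (linfty_rotate d F) = linfty_rotate (c * d) F"
proof -
  obtain f where f: "essentially_bounded f" "F = abs_linfty f"
    using linfty_abs_cases by metis
  then show ?thesis
    using assms by (simp add: linfty_rotate_abs essentially_bounded_rotate norm_mult mult.assoc mult.left_commute)
qed

lemma linfty_rotate_one: "linfty_rotate 1 F = F"
proof -
  obtain f where f: "essentially_bounded f" "F = abs_linfty f"
    using linfty_abs_cases by metis
  then show ?thesis by (simp add: linfty_rotate_abs)
qed

lemma linfty_rotate_hom:
  assumes c: "norm c = 1"
  shows "linfty_rotate c (F + G) = linfty_rotate c F + linfty_rotate c G"
    "linfty_rotate c (F * G) = linfty_rotate c F * linfty_rotate c G"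
    "linfty_rotate c (linfty_cnj F) = linfty_cnj (linfty_rotate c F)"
    "linfty_rotate c (d *\<^sub>C F) = d *\<^sub>C linfty_rotate c F"
proof -
  obtain f g where fg: "essentially_bounded f" "F = abs_linfty f" "essentially_bounded g" "G = abs_linfty g"
    using linfty_abs_cases by metis
  show "linfty_rotate c (F + G) = linfty_rotate c F + linfty_rotate c G"
    "linfty_rotate c (F * G) = linfty_rotate c F * linfty_rotate c G"
    "linfty_rotate c (linfty_cnj F) = linfty_cnj (linfty_rotate c F)"
    "linfty_rotate c (d *\<^sub>C F) = d *\<^sub>C linfty_rotate c F"
    by (simp_all add: fg c linfty_abs_ops linfty_abs_scaleC linfty_rotate_abs essentially_bounded_rotate linfty_cnj_abs
        essentially_bounded_cnj essentially_bounded_add essentially_bounded_mult essentially_bounded_scale)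
qed

lemma rotation_action_dynamical_system: "circle_cstar_dynamical_system rotation_action"
proof -
  have bij: "bij (rotation_action c)" if "norm c = 1" for c
  proof (rule o_bij[of "linfty_rotate c"])
    have "c \<noteq> 0" using that by auto
    then show "linfty_rotate c \<circ> rotation_action c = id" "rotation_action c \<circ> linfty_rotate c = id"
      using that by (auto simp: fun_eq_iff rotation_action_def linfty_rotate_rotate norm_inverse linfty_rotate_one)
  qed
  then show ?thesis
    unfolding circle_cstar_dynamical_system_def
    by (auto simp: rotation_action_def linfty_rotate_hom norm_inverse linfty_rotate_one
        linfty_rotate_rotate fun_eq_iff mult.commute)
qed

lemma rotation_action_covariant: "covariant_representation rotation_action mult_op rot_rep"
proof -
  have unit: "unitary_op (rot_rep c)" if c: "norm c = 1" for c
    using c by (simp add: unitary_op_def rot_rep_def rot_op_adj rot_op_compose cnj_mult_unit rot_op_one)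
  have cov: "(rot_rep c o\<^sub>L mult_op F) o\<^sub>L adj (rot_rep c) = mult_op (rotation_action c F)" if c: "norm c = 1" for c F
    using c by (simp add: rot_rep_def rot_op_adj rot_op_mult_op blinfun_compose_assoc rot_op_compose
        cnj_mult_unit rot_op_one rotation_action_def inverse_eq_cnj)
  show ?thesis
    unfolding covariant_representation_def
    by (auto simp: unit cov mult_op_add mult_op_mult mult_op_one mult_op_adj mult_op_scaleC)
      (simp add: rot_rep_def rot_op_compose)
qed

section \<open>The bilateral shift and its commutant\<close>

lemma essentially_bounded_powi: "essentially_bounded (\<lambda>z. z powi n)"
  unfolding essentially_bounded_def
  using powi_measurable AE_haar_norm by (auto intro!: exI[of _ 1] elim!: eventually_mono simp: norm_power_int)

text \<open>The symbol is written as a power so that multiplications by \<open>z\<close> and by its inverse are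
  treated alike.\<close>

definition bilateral_shift :: "l2 \<Rightarrow>\<^sub>L l2"
  where "bilateral_shift = mult_op (abs_linfty (\<lambda>z. z powi 1))"

lemma mult_op_powi_basis: "mult_op (abs_linfty (\<lambda>z. z powi m)) (fourier_basis n) = fourier_basis (m + n)"
proof -
  have "AE z in haar. z powi m * z powi n = z powi (m + n)"
    using AE_haar_norm by eventually_elim (subst power_int_add, auto)
  then show ?thesis
    unfolding fourier_basis_abs mult_op_abs[OF essentially_bounded_powi square_integrable_powi]
    by (intro abs_l2_eqI square_integrable_mult essentially_bounded_powi square_integrable_powi)
qed

lemma bounded_ops_eqI_dense:
  fixes S T :: "'a::chilbert_space \<Rightarrow>\<^sub>L 'b::chilbert_space"
  assumes ops: "S \<in> bounded_ops" "T \<in> bounded_ops" and dense: "closure (cspan E) = UNIV"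
    and eq: "\<And>x. x \<in> E \<Longrightarrow> S x = T x"
  shows "S = T"
proof (rule blinfun_eqI)
  fix x
  have "blinfun_apply (S - T) x = 0"
  proof (rule vanish_on_closed_span[of E _ "norm (S - T)"])
    show "blinfun_apply (S - T) (c *\<^sub>C y) = c *\<^sub>C blinfun_apply (S - T) y" for c y
      using ops by (simp add: bounded_ops_scaleC)
    show "x \<in> closure (cspan E)" by (simp add: dense)
    show "y \<in> E \<Longrightarrow> blinfun_apply (S - T) y = 0" for y
      by (simp add: blinfun.diff_left eq)
  qed (simp_all only: blinfun.add_right norm_blinfun)
  then show "S x = T x" by (simp add: blinfun.diff_left)
qed

lemma l2_ops_eqI:
  fixes S T :: "l2 \<Rightarrow>\<^sub>L 'b::chilbert_space"
  assumes "S \<in> bounded_ops" "T \<in> bounded_ops" "\<And>n. S (fourier_basis n) = T (fourier_basis n)"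
  shows "S = T"
  using assms(3) by (intro bounded_ops_eqI_dense[OF assms(1,2) fourier_basis_dense]) auto

lemma bilateral_shift_ops [simp]: "bilateral_shift \<in> bounded_ops"
  by (simp add: bilateral_shift_def)

lemma bilateral_shift_basis: "bilateral_shift (fourier_basis n) = fourier_basis (n + 1)"
  by (simp add: bilateral_shift_def mult_op_powi_basis add.commute del: power_int_1_right)

lemma adj_bilateral_shift: "adj bilateral_shift = mult_op (abs_linfty (\<lambda>z. z powi (- 1)))"
proof -
  have "abs_linfty (\<lambda>z. cnj (z powi 1)) = abs_linfty (\<lambda>z. z powi (- 1))"
  proof -
    have "AE z in haar. cnj (z powi 1) = z powi (- 1)"
      using AE_haar_norm
    proof eventually_elim
      case (elim z)
      then show ?case using inverse_eq_cnj[of z] by (simp add: power_int_minus)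
    qed
    then have "linfty_rel (\<lambda>z. cnj (z powi 1)) (\<lambda>z. z powi (- 1))"
      unfolding linfty_rel_def by (intro conjI essentially_bounded_cnj essentially_bounded_powi)
    then show ?thesis
      by (rule Quotient3_rel_abs[OF Quotient3_linfty])
  qed
  then show ?thesis
    unfolding bilateral_shift_def mult_op_adj[symmetric] linfty_cnj_abs[OF essentially_bounded_powi]
    by simp
qed

lemma adj_bilateral_shift_basis: "adj bilateral_shift (fourier_basis n) = fourier_basis (n - 1)"
  unfolding adj_bilateral_shift mult_op_powi_basis by (simp add: algebra_simps)

lemma bilateral_shift_unitary:
  "adj bilateral_shift o\<^sub>L bilateral_shift = id_blinfun" "bilateral_shift o\<^sub>L adj bilateral_shift = id_blinfun"
  by (auto intro!: l2_ops_eqI simp: bilateral_shift_basis adj_bilateral_shift_basis)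

text \<open>\<open>T\<close> also commutes with the inverse of the shift, so negative indices are reached as well.\<close>

lemma commuting_with_shift_basis:
  assumes "T \<in> bounded_ops" "T o\<^sub>L bilateral_shift = bilateral_shift o\<^sub>L T"
  shows "T (fourier_basis n) = mult_op (abs_linfty (\<lambda>z. z powi n)) (T (fourier_basis 0))"
proof -
  let ?U = bilateral_shift
  let ?M = "\<lambda>n. mult_op (abs_linfty (\<lambda>z. z powi n))"
  have TU: "T (?U x) = ?U (T x)" for x
    using blinfun_compose_eqD[OF assms(2)] by simp
  have UU: "?U (adj ?U x) = x" "adj ?U (?U x) = x" for x
    using blinfun_compose_eqD[OF bilateral_shift_unitary(1)] blinfun_compose_eqD[OF bilateral_shift_unitary(2)]
    by simp_all
  have TV: "T (adj ?U x) = adj ?U (T x)" for x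
    using TU[of "adj ?U x"] UU by metis
  have M: "?U (?M n x) = ?M (n + 1) x" "adj ?U (?M n x) = ?M (n - 1) x" for n x
  proof -
    have "?U o\<^sub>L ?M n = ?M (n + 1)" "adj ?U o\<^sub>L ?M n = ?M (n - 1)"
      by (auto intro!: l2_ops_eqI simp: mult_op_powi_basis bilateral_shift_basis
          adj_bilateral_shift_basis algebra_simps)
    then show "?U (?M n x) = ?M (n + 1) x" "adj ?U (?M n x) = ?M (n - 1) x"
      using blinfun_compose_eqD by blast+
  qed
  show ?thesis
  proof (induction n rule: int_induct[where k = 0])
    case base
    have "?M 0 = id_blinfun"
      by (intro l2_ops_eqI) (simp_all add: mult_op_powi_basis del: power_int_0_right)
    then show ?case by (simp del: power_int_0_right)
  next
    case (step1 i)
    then show ?case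
      using TU[of "fourier_basis i"] M(1)[of i] by (simp add: bilateral_shift_basis)
  next
    case (step2 i)
    then show ?case
      using TV[of "fourier_basis i"] M(2)[of i] by (simp add: adj_bilateral_shift_basis)
  qed
qed

text \<open>An operator \<open>T\<close> commuting with the bilateral shift multiplies trigonometric polynomials by
  \<open>f = T 1\<close>; hence \<open>T\<^sup>* h = h cnj f\<close> for bounded \<open>h\<close>.  For \<open>h\<close> the indicator of
  \<open>{norm f > norm T}\<close> the bound on \<open>T\<^sup>* h\<close> forces that set to be null.\<close>

lemma commutant_bilateral_shift:
  assumes T: "T \<in> bounded_ops" "T o\<^sub>L bilateral_shift = bilateral_shift o\<^sub>L T"
  obtains F where "T = mult_op F"
proof -
  obtain f where f: "square_integrable f" "T (fourier_basis 0) = abs_l2 f"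
    using l2_abs_cases by metis
  have [measurable]: "f \<in> borel_measurable haar"
    using f(1) by (simp add: square_integrable_def)
  have Te: "T (fourier_basis n) = abs_l2 (\<lambda>z. z powi n * f z)" for n
    using commuting_with_shift_basis[OF T, of n] by (simp add: f mult_op_abs essentially_bounded_powi)
  have "(\<lambda>z. cnj (f z)) \<in> borel_measurable haar"
    by (rule measurable_compose[of f haar borel cnj])
      (auto intro!: borel_measurable_continuous_onI continuous_intros)
  then have cf: "square_integrable (\<lambda>z. cnj (f z))"
    using f(1) by (simp add: square_integrable_def)
  have adjT: "adj T (abs_l2 h) = abs_l2 (\<lambda>z. h z * cnj (f z))"
    if h: "essentially_bounded h" "square_integrable h" for h
  proof -
    let ?w = "abs_l2 (\<lambda>z. h z * cnj (f z))"
    have "cinner (fourier_basis n) (adj T (abs_l2 h) - ?w) = 0" for n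
    proof -
      have "cinner (fourier_basis n) (adj T (abs_l2 h)) = cinner (T (fourier_basis n)) (abs_l2 h)"
        by (rule cinner_adj_right[OF T(1)])
      also have "\<dots> = (\<integral>z. z powi n * f z * cnj (h z) \<partial>haar)"
        unfolding Te by (intro cinner_abs_l2 square_integrable_mult essentially_bounded_powi f h)
      also have "\<dots> = cinner (fourier_basis n) ?w"
        unfolding fourier_basis_abs
        by (subst cinner_abs_l2) (simp_all add: square_integrable_powi square_integrable_mult h cf mult_ac)
      finally show ?thesis by (simp add: cinner_diff_right)
    qed
    then have "cinner (adj T (abs_l2 h) - ?w) (fourier_basis n) = 0" for n
      using cinner_commute by (metis complex_cnj_zero)
    then show ?thesis
      using orthogonal_fourier_basis by (metis eq_iff_diff_eq_0)
  qed
  define C where "C = norm T"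
  define A where "A = {z \<in> space haar. C < norm (f z)}"
  have A: "A \<in> sets haar" unfolding A_def by measurable
  have AE_le: "AE z in haar. norm (f z) \<le> C"
  proof -
    let ?h = "indicator A :: complex \<Rightarrow> complex"
    have h_meas: "?h \<in> borel_measurable haar"
      using A by measurable
    have hb: "essentially_bounded ?h"
      unfolding essentially_bounded_def using h_meas
      by (auto intro!: exI[of _ 1] AE_I2 simp: indicator_def)
    have hs: "square_integrable ?h"
      by (rule square_integrable_bound[where g = "\<lambda>_. 1"])
        (use h_meas finite_measure.integrable_const[OF finite_measure_haar] in \<open>auto intro!: AE_I2 simp: indicator_def\<close>)
    have i1: "integrable haar (\<lambda>z. (norm (?h z * cnj (f z)))\<^sup>2)"
      using square_integrable_mult[OF hb cf] by (simp add: square_integrable_def)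
    have i2: "integrable haar (\<lambda>z. C\<^sup>2 * (norm (?h z))\<^sup>2)"
      using hs by (simp add: square_integrable_def)
    have "norm (adj T (abs_l2 ?h)) \<le> C * norm (abs_l2 ?h)"
      using norm_blinfun[of "adj T" "abs_l2 ?h"] T(1) by (simp add: C_def)
    then have "(norm (adj T (abs_l2 ?h)))\<^sup>2 \<le> (C * norm (abs_l2 ?h))\<^sup>2"
      by (intro power_mono) auto
    then have le: "(\<integral>z. (norm (?h z * cnj (f z)))\<^sup>2 \<partial>haar) \<le> (\<integral>z. C\<^sup>2 * (norm (?h z))\<^sup>2 \<partial>haar)"
      unfolding adjT[OF hb hs] power_mult_distrib
      by (simp add: norm_l2_abs square_integrable_mult hb cf hs)
    define k where "k z = (norm (?h z * cnj (f z)))\<^sup>2 - C\<^sup>2 * (norm (?h z))\<^sup>2" for z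
    have C0: "0 \<le> C" by (simp add: C_def)
    have k: "k z = (if z \<in> A then (norm (f z))\<^sup>2 - C\<^sup>2 else 0)" for z
      by (simp add: k_def indicator_def)
    have k_pos: "0 < k z" if "z \<in> A" for z
      using that C0 power_strict_mono[of C "norm (f z)" 2] by (simp add: k A_def)
    then have k0: "0 \<le> k z" for z
      by (cases "z \<in> A") (auto simp: k intro: less_imp_le)
    have ki: "integrable haar k"
      unfolding k_def using i1 i2 by (rule Bochner_Integration.integrable_diff)
    have "(\<integral>z. k z \<partial>haar) \<le> 0"
      unfolding k_def using le i1 i2 by simp
    moreover have "0 \<le> (\<integral>z. k z \<partial>haar)"
      by (rule integral_nonneg_AE) (simp add: k0)
    ultimately have "(\<integral>z. k z \<partial>haar) = 0" by linarith
    then have "AE z in haar. k z = 0"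
      using integral_nonneg_eq_0_iff_AE[OF ki] k0 by simp
    then show ?thesis
      using AE_space
    proof eventually_elim
      case (elim z)
      then show ?case using k_pos[of z] by (cases "norm (f z) \<le> C") (auto simp: A_def)
    qed
  qed
  then have fb: "essentially_bounded f"
    by (auto simp: essentially_bounded_def)
  have "T = mult_op (abs_linfty f)"
  proof (rule l2_ops_eqI[OF T(1) mult_op_in_bounded_ops])
    fix n
    have "mult_op (abs_linfty f) (fourier_basis n) = abs_l2 (\<lambda>z. f z * z powi n)"
      unfolding fourier_basis_abs by (rule mult_op_abs[OF fb square_integrable_powi])
    then show "T (fourier_basis n) = mult_op (abs_linfty f) (fourier_basis n)"
      by (simp add: Te mult.commute)
  qed
  then show thesis by (rule that)
qed

lemma rot_op_bilateral_shift:
  assumes c: "norm c = 1"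
  shows "rot_op c o\<^sub>L bilateral_shift = c *\<^sub>C (bilateral_shift o\<^sub>L rot_op c)"
proof (rule l2_operator_eqI)
  fix h assume h: "square_integrable h"
  have "essentially_bounded (\<lambda>z. z)"
    using essentially_bounded_powi[of 1] by simp
  then show "(rot_op c o\<^sub>L bilateral_shift) (abs_l2 h) = blinfun_apply (c *\<^sub>C (bilateral_shift o\<^sub>L rot_op c)) (abs_l2 h)"
    using h c by (simp add: bilateral_shift_def mult_op_abs rot_op_abs square_integrable_mult
        square_integrable_rotate(1) l2_abs_scaleC mult.assoc)
qed

section \<open>The shift on the Hardy space and its minimal dilation\<close>

definition hardy_incl :: "hardy \<Rightarrow>\<^sub>L l2"
  where "hardy_incl = Blinfun Rep_hardy"

lemma hardy_incl_apply: "hardy_incl h = Rep_hardy h"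
proof -
  have "bounded_linear Rep_hardy"
    by (rule bounded_linear_intro[where K = 1])
      (simp_all add: plus_hardy.rep_eq scaleR_hardy.rep_eq norm_hardy.rep_eq)
  then show ?thesis by (simp add: hardy_incl_def bounded_linear_Blinfun_apply)
qed

lemma hardy_incl_isometric: "isometric_embedding hardy_incl"
  by (auto simp: isometric_embedding_def hardy_incl_apply norm_hardy.rep_eq scaleC_hardy.rep_eq
      intro!: bounded_opsI)

lemma hardy_incl_ops [simp]: "hardy_incl \<in> bounded_ops"
  using hardy_incl_isometric by (simp add: isometric_embedding_def)

lemmas adj_hardy_incl_apply [simp] = isometric_embedding_adj_apply[OF hardy_incl_isometric]

lemma hardy_incl_basis: "hardy_incl (hardy_basis n) = fourier_basis (int n)"
proof -
  have "fourier_basis (int n) \<in> cspan (range (\<lambda>n::nat. fourier_basis (int n)))"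
    by (intro complex_vector.span_base rangeI)
  then have "fourier_basis (int n) \<in> hardy_space"
    unfolding hardy_space_def by (rule closure_subset[THEN subsetD])
  then show ?thesis
    by (simp add: hardy_incl_apply hardy_basis_def Abs_hardy_inverse)
qed

lemma adj_hardy_incl_basis: "adj hardy_incl (fourier_basis (int n)) = hardy_basis n"
  by (simp flip: hardy_incl_basis)

lemma hardy_basis_dense: "closure (cspan (range hardy_basis)) = UNIV"
proof (rule dense_csubspaceI[OF complex_vector.subspace_span])
  fix x assume x: "\<And>m. m \<in> cspan (range hardy_basis) \<Longrightarrow> cinner x m = 0"
  let ?x = "Rep_hardy x"
  let ?N = "{m. cinner ?x m = 0}"
  have "cinner ?x (fourier_basis (int n)) = 0" for n
  proof -
    have "cinner x (hardy_basis n) = 0"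
      by (intro x complex_vector.span_base) simp
    then show ?thesis
      by (simp add: cinner_hardy.rep_eq flip: hardy_incl_basis) (simp add: hardy_incl_apply)
  qed
  then have "cspan (range (\<lambda>n::nat. fourier_basis (int n))) \<subseteq> ?N"
    by (intro complex_vector.span_minimal) (auto simp: complex_vector.subspace_def cinner_simps)
  moreover have "closed ?N"
    by (intro closed_Collect_eq continuous_intros
        bounded_linear.continuous_on[OF bounded_bilinear.bounded_linear_right[OF bounded_bilinear_cinner]])
  ultimately have "hardy_space \<subseteq> ?N"
    unfolding hardy_space_def by (intro closure_minimal)
  then have "cinner ?x ?x = 0"
    using Rep_hardy[of x] by blast
  then have "cinner x x = 0"
    by (simp only: cinner_hardy.rep_eq)
  then show "x = 0" by simp
qed

lemma hardy_ops_eqI: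
  fixes S T :: "hardy \<Rightarrow>\<^sub>L 'b::chilbert_space"
  assumes "S \<in> bounded_ops" "T \<in> bounded_ops" "\<And>n. S (hardy_basis n) = T (hardy_basis n)"
  shows "S = T"
  using assms(3) by (intro bounded_ops_eqI_dense[OF assms(1,2) hardy_basis_dense]) auto

lemma unilateral_shift_eq: "unilateral_shift = compress_op hardy_incl bilateral_shift"
  unfolding unilateral_shift_def
proof (rule the_equality)
  have basis: "compress_op hardy_incl bilateral_shift (hardy_basis n) = hardy_basis (Suc n)" for n
    using adj_hardy_incl_basis[of "Suc n"]
    by (simp add: compress_op_apply hardy_incl_basis bilateral_shift_basis add.commute)
  moreover have ops: "compress_op hardy_incl bilateral_shift \<in> bounded_ops"
    by (simp add: compress_op_in_bounded_ops)
  ultimately show "compress_op hardy_incl bilateral_shift \<in> bounded_ops \<and>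
      (\<forall>n. compress_op hardy_incl bilateral_shift (hardy_basis n) = hardy_basis (Suc n))"
    by blast
  fix S :: "hardy \<Rightarrow>\<^sub>L hardy"
  assume "S \<in> bounded_ops \<and> (\<forall>n. S (hardy_basis n) = hardy_basis (Suc n))"
  then show "S = compress_op hardy_incl bilateral_shift"
    using ops basis by (intro hardy_ops_eqI) auto
qed

lemma unilateral_shift_ops [simp]: "unilateral_shift \<in> bounded_ops"
  by (simp add: unilateral_shift_eq compress_op_in_bounded_ops)

lemma unilateral_shift_basis: "unilateral_shift (hardy_basis n) = hardy_basis (Suc n)"
  using adj_hardy_incl_basis[of "Suc n"]
  by (simp add: unilateral_shift_eq compress_op_apply hardy_incl_basis bilateral_shift_basis add.commute)

lemma hardy_incl_shift: "hardy_incl o\<^sub>L unilateral_shift = bilateral_shift o\<^sub>L hardy_incl"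
  by (rule hardy_ops_eqI)
    (simp_all add: unilateral_shift_basis hardy_incl_basis bilateral_shift_basis add.commute)

text \<open>The adjoint of the inclusion is the orthogonal projection onto the Hardy space.\<close>

lemma hardy_compression_eq: "hardy_compression X = compress_op hardy_incl X"
proof -
  have proj: "orth_proj hardy_space v = Rep_hardy (adj hardy_incl v)" for v
    unfolding orth_proj_def
  proof (rule the_equality)
    let ?y = "Rep_hardy (adj hardy_incl v)"
    have y: "?y \<in> hardy_space" by (rule Rep_hardy)
    have orth: "cinner (v - ?y) m = 0" if "m \<in> hardy_space" for m
    proof -
      obtain h where h: "m = hardy_incl h"
        using \<open>m \<in> hardy_space\<close> by (metis Abs_hardy_inverse hardy_incl_apply)
      have "cinner (hardy_incl (adj hardy_incl v)) (hardy_incl h) = cinner v (hardy_incl h)"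
        using cinner_adj_left[OF hardy_incl_ops, of v h]
          cinner_adj_right[OF hardy_incl_ops, of "adj hardy_incl v" "hardy_incl h"] by simp
      then show ?thesis
        by (simp add: h cinner_diff_left) (simp add: hardy_incl_apply)
    qed
    show "?y \<in> hardy_space \<and> (\<forall>m\<in>hardy_space. cinner (v - ?y) m = 0)"
      using y orth by blast
    fix y' assume y': "y' \<in> hardy_space \<and> (\<forall>m\<in>hardy_space. cinner (v - y') m = 0)"
    then have "y' - ?y \<in> hardy_space"
      using y complex_vector.subspace_diff[OF csubspace_hardy_space] by blast
    then have "cinner (v - ?y) (y' - ?y) - cinner (v - y') (y' - ?y) = 0"
      using orth y' by simp
    then have "cinner (y' - ?y) (y' - ?y) = 0"
      by (simp add: cinner_diff_left[symmetric])
    then show "y' = ?y" by simp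
  qed
  have "(\<lambda>h. Abs_hardy (orth_proj hardy_space (X (orth_proj hardy_space (Rep_hardy h)))))
      = blinfun_apply (compress_op hardy_incl X)"
    by (simp add: proj Rep_hardy_inverse compress_op_apply fun_eq_iff flip: hardy_incl_apply)
      (simp add: hardy_incl_apply Rep_hardy_inverse)
  then show ?thesis
    by (simp add: hardy_compression_def blinfun_apply_inverse)
qed

definition shift_conj :: "(l2 \<Rightarrow>\<^sub>L l2) \<Rightarrow> (l2 \<Rightarrow>\<^sub>L l2)"
  where "shift_conj X = (adj bilateral_shift o\<^sub>L X) o\<^sub>L bilateral_shift"

lemma bilateral_shift_cancel [simp]:
  "adj bilateral_shift (bilateral_shift x) = x" "bilateral_shift (adj bilateral_shift x) = x"
  using blinfun_compose_eqD[OF bilateral_shift_unitary(1)] blinfun_compose_eqD[OF bilateral_shift_unitary(2)]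
  by simp_all

lemma shift_conj_apply: "shift_conj X x = adj bilateral_shift (X (bilateral_shift x))"
  by (simp add: shift_conj_def)

lemma shift_conj_ops [simp]: "X \<in> bounded_ops \<Longrightarrow> shift_conj X \<in> bounded_ops"
  by (simp add: shift_conj_def)

lemma shift_conj_adj: "X \<in> bounded_ops \<Longrightarrow> shift_conj (adj X) = adj (shift_conj X)"
  by (simp add: shift_conj_def adj_compose blinfun_compose_assoc)

lemma shift_conj_endomorphism: "unital_star_endomorphism bounded_ops shift_conj"
  unfolding unital_star_endomorphism_def
  by (auto simp: shift_conj_adj)
    (auto intro!: blinfun_eqI simp: shift_conj_apply blinfun.add_left blinfun.add_right
      bounded_ops_scaleC)

lemma funpow_shift_conj_apply:
  "(shift_conj ^^ n) X x = (blinfun_apply (adj bilateral_shift) ^^ n) (X ((blinfun_apply bilateral_shift ^^ n) x))"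
proof (induction n arbitrary: x)
  case (Suc n)
  then show ?case
    by (simp add: shift_conj_apply) (simp add: funpow_swap1)
qed simp

lemma compress_shift_conj:
  "compress_op hardy_incl (shift_conj X) = shift_map (compress_op hardy_incl X)"
proof -
  have S: "hardy_incl (unilateral_shift h) = bilateral_shift (hardy_incl h)" for h
    using blinfun_compose_eqD[OF hardy_incl_shift] by simp
  have "adj unilateral_shift o\<^sub>L adj hardy_incl = adj hardy_incl o\<^sub>L adj bilateral_shift"
    using arg_cong[OF hardy_incl_shift, of adj] by (simp add: adj_compose)
  then have S': "adj unilateral_shift (adj hardy_incl k) = adj hardy_incl (adj bilateral_shift k)" for k
    using blinfun_compose_eqD by fastforce
  show ?thesis
    by (intro blinfun_eqI) (simp add: shift_map_def compress_op_apply shift_conj_apply S S')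
qed

lemma funpow_compress_shift_conj:
  "compress_op hardy_incl ((shift_conj ^^ n) X) = (shift_map ^^ n) (compress_op hardy_incl X)"
  by (induction n) (simp_all add: compress_shift_conj)

lemma shift_map_id: "shift_map id_blinfun = id_blinfun"
proof -
  have "compress_op hardy_incl id_blinfun = id_blinfun"
    by (intro blinfun_eqI) (simp add: compress_op_apply)
  moreover have "shift_conj id_blinfun = id_blinfun"
    by (intro blinfun_eqI) (simp add: shift_conj_apply)
  ultimately show ?thesis
    using compress_shift_conj[of id_blinfun] by simp
qed

lemma op_le_conj:
  assumes "op_le S T" "V \<in> bounded_ops"
  shows "op_le ((adj V o\<^sub>L S) o\<^sub>L V) ((adj V o\<^sub>L T) o\<^sub>L V)"
  unfolding op_le_def
proof
  fix x
  have "blinfun_apply (((adj V o\<^sub>L T) o\<^sub>L V) - ((adj V o\<^sub>L S) o\<^sub>L V)) x = adj V (blinfun_apply (T - S) (V x))"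
    by (simp add: blinfun.diff_left blinfun.diff_right)
  then show "\<exists>r\<ge>0. cinner (blinfun_apply (((adj V o\<^sub>L T) o\<^sub>L V) - ((adj V o\<^sub>L S) o\<^sub>L V)) x) x = complex_of_real r"
    using assms by (simp add: op_le_def cinner_adj_left)
qed

text \<open>Conjugation by a unitary operator is an order automorphism, so it preserves suprema.\<close>

lemma shift_conj_normal: "normal_on bounded_ops shift_conj"
proof -
  let ?U = bilateral_shift
  have sa: "shift_conj X \<in> selfadjoint_part bounded_ops" if "X \<in> selfadjoint_part bounded_ops" for X
    using that shift_conj_adj[of X] by (simp add: selfadjoint_part_def)
  have mono: "op_le (shift_conj X) (shift_conj Y)" if "op_le X Y" for X Y
    using op_le_conj[OF that bilateral_shift_ops] by (simp add: shift_conj_def)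
  define unconj where "unconj X = (?U o\<^sub>L X) o\<^sub>L adj ?U" for X
  have unconj_mono: "op_le (unconj X) (unconj Y)" if "op_le X Y" for X Y
    using op_le_conj[OF that, of "adj ?U"] by (simp add: unconj_def)
  have inv: "unconj (shift_conj X) = X" "shift_conj (unconj X) = X" for X
    by (auto intro!: blinfun_eqI simp: unconj_def shift_conj_apply)
  have unconj_sa: "unconj X \<in> selfadjoint_part bounded_ops" if "X \<in> selfadjoint_part bounded_ops" for X
    using that by (simp add: selfadjoint_part_def unconj_def adj_compose blinfun_compose_assoc)
  have "is_op_sup bounded_ops (shift_conj ` D) (shift_conj s)" if "is_op_sup bounded_ops D s" for D s
    unfolding is_op_sup_def
  proof (intro conjI ballI impI)
    show "shift_conj s \<in> selfadjoint_part bounded_ops"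
      using that sa by (simp add: is_op_sup_def)
    show "op_le d (shift_conj s)" if "d \<in> shift_conj ` D" for d
      using that \<open>is_op_sup bounded_ops D s\<close> mono by (auto simp: is_op_sup_def)
    fix t assume t: "t \<in> selfadjoint_part bounded_ops" "\<forall>d\<in>shift_conj ` D. op_le d t"
    have "op_le d (unconj t)" if "d \<in> D" for d
      using unconj_mono[of "shift_conj d" t] t(2) that by (simp add: inv)
    then have "op_le s (unconj t)"
      using that unconj_sa[OF t(1)] by (simp add: is_op_sup_def)
    then show "op_le (shift_conj s) t"
      using mono[of s "unconj t"] by (simp add: inv)
  qed
  then show ?thesis
    by (simp add: normal_on_def)
qed

lemma von_neumann_algebra_bounded_ops: "von_neumann_algebra bounded_ops"
  unfolding von_neumann_algebra_def
proof (intro conjI ballI)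
  show "commutant (commutant bounded_ops) = bounded_ops"
    using commutant_subset[of "commutant bounded_ops"] by (auto simp: commutant_def)
qed auto

lemma funpow_shift_incl:
  "(blinfun_apply bilateral_shift ^^ n) (hardy_incl h) = hardy_incl ((blinfun_apply unilateral_shift ^^ n) h)"
proof (induction n)
  case (Suc n)
  then show ?case
    using blinfun_compose_eqD[OF hardy_incl_shift] by simp
qed simp

lemma funpow_adj_shift_cancel:
  "(blinfun_apply (adj bilateral_shift) ^^ n) ((blinfun_apply bilateral_shift ^^ n) x) = x"
proof (induction n arbitrary: x)
  case (Suc n)
  then show ?case by (simp add: funpow_swap1)
qed simp

lemma funpow_shift_basis:
  "(blinfun_apply bilateral_shift ^^ n) (fourier_basis k) = fourier_basis (k + int n)"
  "(blinfun_apply (adj bilateral_shift) ^^ n) (fourier_basis k) = fourier_basis (k - int n)"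
  by (induction n) (simp_all add: bilateral_shift_basis adj_bilateral_shift_basis algebra_simps)

definition rank_one :: "hardy \<Rightarrow> hardy \<Rightarrow> (hardy \<Rightarrow>\<^sub>L hardy)"
  where "rank_one u v = Blinfun (\<lambda>h. cinner h v *\<^sub>C u)"

lemma rank_one_apply: "rank_one u v h = cinner h v *\<^sub>C u"
proof -
  have "bounded_linear (\<lambda>h. cinner h v *\<^sub>C u)"
  proof (rule bounded_linear_intro[where K = "norm v * norm u"])
    show "cinner (r *\<^sub>R x) v *\<^sub>C u = r *\<^sub>R (cinner x v *\<^sub>C u)" for r x
      by (simp add: cinner_scaleC_left scaleC_scaleC flip: scaleC_of_real)
    show "norm (cinner x v *\<^sub>C u) \<le> norm x * (norm v * norm u)" for x
      using mult_right_mono[OF norm_cinner_le[of x v], of "norm u"] by (simp add: norm_scaleC mult.assoc)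
  qed (simp add: cinner_add_left scaleC_add_left)
  then show ?thesis by (simp add: rank_one_def bounded_linear_Blinfun_apply)
qed

lemma rank_one_ops [simp]: "rank_one u v \<in> bounded_ops"
  by (rule bounded_opsI) (simp add: rank_one_apply cinner_scaleC_left scaleC_scaleC)

text \<open>Rank one operators on the Hardy space reach only the \<open>fourier_basis k\<close> with \<open>k \<ge> 0\<close>; their
  translates under the endomorphism reach all of them.  This is what makes the dilation minimal:
  these operators move \<open>fourier_basis 0\<close> to every basis vector, and only scalars commute with all
  of them.\<close>

lemma lifted_rank_one:
  assumes "0 \<le> k + int n"
  shows "(shift_conj ^^ n) (embed_op hardy_incl (rank_one (hardy_basis (nat (k + int n))) (hardy_basis n))) x
    = cinner x (fourier_basis 0) *\<^sub>C fourier_basis k"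
proof -
  have adj_funpow: "cinner ((blinfun_apply bilateral_shift ^^ n) x) ((blinfun_apply bilateral_shift ^^ n) y) = cinner x y" for x y
  proof (induction n)
    case (Suc n)
    have "cinner (bilateral_shift a) (bilateral_shift b) = cinner a b" for a b
      using cinner_adj_right[OF bilateral_shift_ops, of a "bilateral_shift b"] by simp
    with Suc show ?case by simp
  qed simp
  have scale: "(blinfun_apply (adj bilateral_shift) ^^ n) (c *\<^sub>C y) = c *\<^sub>C (blinfun_apply (adj bilateral_shift) ^^ n) y" for c y n
    by (induction n) (simp_all add: bounded_ops_scaleC)
  let ?y = "(blinfun_apply bilateral_shift ^^ n) x"
  have "cinner (adj hardy_incl ?y) (hardy_basis n) = cinner ?y (fourier_basis (int n))"
    by (simp add: cinner_adj_left hardy_incl_basis)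
  also have "fourier_basis (int n) = (blinfun_apply bilateral_shift ^^ n) (fourier_basis 0)"
    by (simp add: funpow_shift_basis)
  also have "cinner ?y \<dots> = cinner x (fourier_basis 0)"
    by (rule adj_funpow)
  finally show ?thesis
    using assms
    by (simp add: funpow_shift_conj_apply embed_op_apply rank_one_apply bounded_ops_scaleC
        hardy_incl_basis scale funpow_shift_basis)
qed

lemma shift_conj_generates:
  "von_neumann_generated {(shift_conj ^^ n) (embed_op hardy_incl x) | n x. x \<in> bounded_ops} = bounded_ops"
  (is "von_neumann_generated ?G = _")
proof
  have "(shift_conj ^^ n) X \<in> bounded_ops" if "X \<in> bounded_ops" for n X
    by (induction n) (simp_all add: that)
  then have "?G \<subseteq> bounded_ops"
    using embed_op_hom(1)[OF hardy_incl_isometric] by blast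
  then show "von_neumann_generated ?G \<subseteq> bounded_ops"
    unfolding von_neumann_generated_def using von_neumann_algebra_bounded_ops by blast
  have "bounded_ops \<subseteq> M" if M: "von_neumann_algebra M" "?G \<subseteq> M" for M
  proof
    fix S :: "l2 \<Rightarrow>\<^sub>L l2" assume S: "S \<in> bounded_ops"
    have "S o\<^sub>L T = T o\<^sub>L S" if T: "T \<in> commutant M" for T
    proof -
      define c where "c = cinner (T (fourier_basis 0)) (fourier_basis 0)"
      have T_ops: "T \<in> bounded_ops" using T commutant_subset by blast
      have basis: "T (fourier_basis k) = c *\<^sub>C fourier_basis k" for k
      proof -
        define n where "n = nat \<bar>k\<bar>"
        have n: "0 \<le> k + int n" by (simp add: n_def)
        let ?R = "(shift_conj ^^ n) (embed_op hardy_incl (rank_one (hardy_basis (nat (k + int n))) (hardy_basis n)))"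
        have "?R \<in> M" using M(2) rank_one_ops by blast
        then have "?R o\<^sub>L T = T o\<^sub>L ?R" using T by (rule commutantD[rotated])
        then have "?R (T (fourier_basis 0)) = T (?R (fourier_basis 0))"
          using blinfun_compose_eqD by fastforce
        then show ?thesis
          by (simp add: lifted_rank_one[OF n] cinner_fourier_basis_zero bounded_ops_scaleC[OF T_ops] c_def)
      qed
      have "T = c *\<^sub>C id_blinfun"
        by (rule l2_ops_eqI) (simp_all add: T_ops basis)
      then show ?thesis
        by (simp add: S blinfun_compose_scaleC)
    qed
    then have "S \<in> commutant (commutant M)"
      using S unfolding commutant_def[of "commutant M"] by (simp add: eq_commute)
    then show "S \<in> M"
      using M(1) by (simp add: von_neumann_algebra_def)
  qed
  then show "bounded_ops \<subseteq> von_neumann_generated ?G"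
    unfolding von_neumann_generated_def by blast
qed

text \<open>The words of length zero yield the basis vectors with nonnegative index.  For index \<open>- n\<close> with
  \<open>n > 0\<close> a word of length \<open>n\<close> is needed; all its letters but the outermost one are the identity,
  because these fix the Hardy space.\<close>

lemma shift_words_dense:
  "closure (cspan {dilation_word hardy_incl shift_conj xs h | xs h. set xs \<subseteq> bounded_ops}) = UNIV"
  (is "closure (cspan ?W) = _")
proof -
  have ids: "dilation_word hardy_incl shift_conj (replicate n id_blinfun) h = hardy_incl h" for n h
  proof (induction n)
    case (Suc n)
    have len: "dilation_word hardy_incl shift_conj (replicate (Suc n) id_blinfun) h
      = (shift_conj ^^ Suc n) (embed_op hardy_incl id_blinfun) (hardy_incl h)"
      using Suc by simp
    show ?case
      unfolding len funpow_shift_conj_apply funpow_shift_incl embed_op_apply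
      using funpow_adj_shift_cancel[of "Suc n" "hardy_incl h"]
      by (simp only: adj_hardy_incl_apply blinfun_apply_id_blinfun id_apply funpow_shift_incl)
  qed simp
  have "fourier_basis k \<in> ?W" for k
  proof (cases "0 \<le> k")
    case True
    then have "dilation_word hardy_incl shift_conj [] (hardy_basis (nat k)) = fourier_basis k"
      by (simp add: hardy_incl_basis)
    then show ?thesis
      by (intro CollectI exI[of _ "[]"] exI[of _ "hardy_basis (nat k)"]) simp
  next
    case False
    define m where "m = nat (- k - 1)"
    have k: "k = - int (Suc m)" using False by (simp add: m_def)
    let ?x = "rank_one (hardy_basis 0) (hardy_basis (Suc m))"
    let ?xs = "?x # replicate m id_blinfun"
    have "dilation_word hardy_incl shift_conj ?xs (hardy_basis 0)
        = (shift_conj ^^ Suc m) (embed_op hardy_incl ?x) (fourier_basis 0)"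
      using ids[of m "hardy_basis 0"] hardy_incl_basis[of 0] by simp
    also have "\<dots> = cinner (fourier_basis 0) (fourier_basis 0) *\<^sub>C fourier_basis k"
      using lifted_rank_one[of k "Suc m" "fourier_basis 0"] k by simp
    also have "cinner (fourier_basis 0) (fourier_basis 0) = 1"
      by (rule cinner_fourier_basis_zero)
    finally have "dilation_word hardy_incl shift_conj ?xs (hardy_basis 0) = fourier_basis k"
      by simp
    moreover have "set ?xs \<subseteq> bounded_ops" by auto
    ultimately show ?thesis by (metis (mono_tags, lifting) mem_Collect_eq)
  qed
  then have "range fourier_basis \<subseteq> ?W" by blast
  then have "closure (cspan (range fourier_basis)) \<subseteq> closure (cspan ?W)"
    by (intro closure_mono complex_vector.span_mono)
  then show ?thesis
    using fourier_basis_dense by blast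
qed

lemma shift_minimal_dilation: "minimal_dilation bounded_ops shift_map hardy_incl bounded_ops shift_conj"
  unfolding minimal_dilation_def
proof (intro conjI)
  note iso = hardy_incl_isometric
  show "embed_op hardy_incl ` bounded_ops = (\<lambda>z. embed_op hardy_incl (compress_op hardy_incl z)) ` bounded_ops"
  proof
    show "embed_op hardy_incl ` bounded_ops \<subseteq> (\<lambda>z. embed_op hardy_incl (compress_op hardy_incl z)) ` bounded_ops"
    proof
      fix y assume "y \<in> embed_op hardy_incl ` bounded_ops"
      then obtain x where x: "x \<in> bounded_ops" "y = embed_op hardy_incl x" by blast
      then have "y = embed_op hardy_incl (compress_op hardy_incl y)"
        by (simp add: compress_embed_op[OF iso])
      then show "y \<in> (\<lambda>z. embed_op hardy_incl (compress_op hardy_incl z)) ` bounded_ops"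
        using embed_op_hom(1)[OF iso x(1)] x(2) by blast
    qed
    show "(\<lambda>z. embed_op hardy_incl (compress_op hardy_incl z)) ` bounded_ops \<subseteq> embed_op hardy_incl ` bounded_ops"
      using compress_op_in_bounded_ops[OF hardy_incl_ops] by blast
  qed
  show "\<forall>x\<in>bounded_ops. \<forall>n. (shift_map ^^ n) x = compress_op hardy_incl ((shift_conj ^^ n) (embed_op hardy_incl x))"
    by (simp add: funpow_compress_shift_conj compress_embed_op[OF iso])
qed (rule hardy_incl_isometric von_neumann_algebra_bounded_ops shift_conj_endomorphism
    shift_conj_normal shift_words_dense shift_conj_generates[symmetric])+

interpretation shift: unital_dilation shift_map hardy_incl bounded_ops shift_conj
  by unfold_locales (rule shift_minimal_dilation, rule shift_map_id)

section \<open>The generated algebra as a peripheral space\<close>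

lemma peripheral_eigen_closed_algebra:
  assumes X: "X \<in> peripheral_eigen bounded_ops shift_conj" and Y: "Y \<in> peripheral_eigen bounded_ops shift_conj"
  shows "X o\<^sub>L Y \<in> peripheral_eigen bounded_ops shift_conj" "adj X \<in> peripheral_eigen bounded_ops shift_conj"
proof -
  obtain c where c: "X \<in> bounded_ops" "norm c = 1" "shift_conj X = c *\<^sub>C X" using X by auto
  obtain d where d: "Y \<in> bounded_ops" "norm d = 1" "shift_conj Y = d *\<^sub>C Y" using Y by auto
  have "shift_conj (X o\<^sub>L Y) = shift_conj X o\<^sub>L shift_conj Y"
    by (intro blinfun_eqI) (simp add: shift_conj_apply)
  also have "\<dots> = (c * d) *\<^sub>C (X o\<^sub>L Y)"
    using c d by (simp add: blinfun_compose_scaleC scaleC_scaleC mult.commute)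
  finally show "X o\<^sub>L Y \<in> peripheral_eigen bounded_ops shift_conj"
    using c d by (auto intro!: exI[of _ "c * d"] simp: norm_mult)
  have "shift_conj (adj X) = cnj c *\<^sub>C adj X"
    using c by (simp add: shift_conj_adj adj_scaleC)
  then show "adj X \<in> peripheral_eigen bounded_ops shift_conj"
    using c by (auto intro!: exI[of _ "cnj c"])
qed

text \<open>Products are treated one factor at a time: for fixed \<open>X \<in> E\<close> the operators \<open>Y\<close> for which \<open>X Y\<close>
  lies in the closed span of \<open>E\<close> form a closed subspace.\<close>

lemma cstar_subalgebra_closed_span:
  fixes E :: "('a::chilbert_space \<Rightarrow>\<^sub>L 'a) set"
  assumes E: "E \<subseteq> bounded_ops" and mult: "\<And>X Y. X \<in> E \<Longrightarrow> Y \<in> E \<Longrightarrow> X o\<^sub>L Y \<in> E"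
    and adj: "\<And>X. X \<in> E \<Longrightarrow> adj X \<in> E"
  shows "cstar_subalgebra (closure (cspan E))"
proof -
  let ?P = "closure (cspan E)"
  have P: "csubspace ?P"
    by (rule csubspace_closed_span)
  note P_closed = complex_vector.subspace_0[OF P] complex_vector.subspace_add[OF P]
    complex_vector.subspace_scale[OF P]
  have EP: "E \<subseteq> ?P"
    by (rule subset_closed_span)
  have minimal: "?P \<subseteq> C" if "E \<subseteq> C" "csubspace C" "closed C" for C
    using that by (intro closure_minimal complex_vector.span_minimal)
  have ops: "?P \<subseteq> bounded_ops"
    by (rule minimal[OF E csubspace_bounded_ops closed_bounded_ops])
  have left: "X o\<^sub>L Y \<in> ?P" if X: "X \<in> E" and Y: "Y \<in> ?P" for X Y
  proof -
    have "?P \<subseteq> {Y. X o\<^sub>L Y \<in> ?P}"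
    proof (rule minimal)
      show "E \<subseteq> {Y. X o\<^sub>L Y \<in> ?P}"
        using mult[OF X] EP by blast
      show "csubspace {Y. X o\<^sub>L Y \<in> ?P}"
        using P_closed X E blinfun_compose_zeros
        by (auto simp: complex_vector.subspace_def blinfun_compose_algebra blinfun_compose_scaleC subset_iff)
      have "continuous_on UNIV (\<lambda>Y. X o\<^sub>L Y)"
        by (intro bounded_linear.continuous_on[OF
              bounded_bilinear.bounded_linear_right[OF bounded_bilinear_blinfun_compose]] continuous_on_id)
      then show "closed {Y. X o\<^sub>L Y \<in> ?P}"
        using continuous_closed_preimage[of UNIV "\<lambda>Y. X o\<^sub>L Y" ?P] by (simp add: vimage_def)
    qed
    then show ?thesis using Y by blast
  qed
  have both: "X o\<^sub>L Y \<in> ?P" if X: "X \<in> ?P" and Y: "Y \<in> ?P" for X Y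
  proof -
    have "?P \<subseteq> {X. X o\<^sub>L Y \<in> ?P}"
    proof (rule minimal)
      show "E \<subseteq> {X. X o\<^sub>L Y \<in> ?P}"
        using left Y by blast
      show "csubspace {X. X o\<^sub>L Y \<in> ?P}"
        using P_closed blinfun_compose_zeros
        by (auto simp: complex_vector.subspace_def blinfun_compose_algebra blinfun_compose_scaleC)
      have "continuous_on UNIV (\<lambda>X. X o\<^sub>L Y)"
        by (intro bounded_linear.continuous_on[OF
              bounded_bilinear.bounded_linear_left[OF bounded_bilinear_blinfun_compose]] continuous_on_id)
      then show "closed {X. X o\<^sub>L Y \<in> ?P}"
        using continuous_closed_preimage[of UNIV "\<lambda>X. X o\<^sub>L Y" ?P] by (simp add: vimage_def)
    qed
    then show ?thesis using X by blast
  qed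
  have adj_P: "adj X \<in> ?P" if X: "X \<in> ?P" for X
  proof -
    have "?P \<subseteq> {X \<in> bounded_ops. adj X \<in> ?P}"
    proof (rule minimal)
      show "E \<subseteq> {X \<in> bounded_ops. adj X \<in> ?P}"
        using E adj EP by blast
      have "adj (0 :: 'a \<Rightarrow>\<^sub>L 'a) = 0"
        by (rule adj_eqI) simp
      then show "csubspace {X \<in> bounded_ops. adj X \<in> ?P}"
        using P_closed by (auto simp: complex_vector.subspace_def adj_add adj_scaleC)
      show "closed {X \<in> bounded_ops. adj X \<in> ?P}"
        unfolding closed_sequential_limits
      proof (intro allI impI)
        fix X l assume *: "(\<forall>n. X n \<in> {X \<in> bounded_ops. adj X \<in> ?P}) \<and> X \<longlonglongrightarrow> l"
        then have l: "l \<in> bounded_ops"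
          using closed_sequentially[OF closed_bounded_ops, of X l] by blast
        have "norm (adj (X n) - adj l) = norm (X n - l)" for n
        proof -
          have "adj (X n) - adj l = adj (X n - l)"
            by (rule adj_eqI[symmetric]) (use * l in \<open>simp add: blinfun.diff_left cinner_simps cinner_adj_left\<close>)
          then show ?thesis using * l by simp
        qed
        then have "(\<lambda>n. adj (X n)) \<longlonglongrightarrow> adj l"
          using * by (simp add: tendsto_iff dist_norm)
        then have "adj l \<in> ?P"
          using closed_sequentially[of ?P "\<lambda>n. adj (X n)"] * by blast
        then show "l \<in> {X \<in> bounded_ops. adj X \<in> ?P}"
          using l by blast
      qed
    qed
    then show ?thesis using X by blast
  qed
  show ?thesis
    unfolding cstar_subalgebra_def using ops P both adj_P by auto
qed

text \<open>An eigenoperator becomes an element of the commutant of the bilateral shift after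
  multiplication by a rotation with the inverse eigenvalue.\<close>

lemma eigen_factorization:
  assumes X: "X \<in> bounded_ops" and c: "norm c = 1" and eig: "shift_conj X = c *\<^sub>C X"
  obtains F where "X = mult_op F o\<^sub>L rot_op c"
proof -
  let ?U = bilateral_shift
  have XU: "X (?U x) = c *\<^sub>C ?U (X x)" for x
  proof -
    have "?U (shift_conj X x) = X (?U x)"
      by (simp add: shift_conj_apply)
    then show ?thesis
      by (simp add: eig bounded_ops_scaleC)
  qed
  have cc: "norm (cnj c) = 1" using c by simp
  let ?T = "X o\<^sub>L rot_op (cnj c)"
  have T: "?T \<in> bounded_ops" using X cc by simp
  have "?T o\<^sub>L ?U = ?U o\<^sub>L ?T"
  proof (rule blinfun_eqI)
    fix x
    have "rot_op (cnj c) (?U x) = cnj c *\<^sub>C ?U (rot_op (cnj c) x)"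
      using blinfun_compose_eqD[OF rot_op_bilateral_shift[OF cc], of x] by simp
    then show "(?T o\<^sub>L ?U) x = (?U o\<^sub>L ?T) x"
      using c by (simp add: bounded_ops_scaleC X XU scaleC_scaleC cnj_mult_unit)
  qed
  then obtain F where "?T = mult_op F"
    using commutant_bilateral_shift[OF T] by blast
  then have "mult_op F o\<^sub>L rot_op c = X o\<^sub>L (rot_op (cnj c) o\<^sub>L rot_op c)"
    by (simp flip: blinfun_compose_assoc)
  also have "\<dots> = X"
    using c by (simp add: rot_op_compose cnj_mult_unit rot_op_one)
  finally show thesis using that by metis
qed

lemma generated_algebra_eq_peripheral:
  "cstar_generated (range mult_op \<union> rot_rep ` sphere 0 1) = peripheral_space bounded_ops shift_conj"
  (is "cstar_generated ?G = _")
proof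
  let ?E = "peripheral_eigen bounded_ops shift_conj"
  have "mult_op F \<in> ?E" for F
  proof -
    have "mult_op F o\<^sub>L bilateral_shift = bilateral_shift o\<^sub>L mult_op F"
      by (simp add: bilateral_shift_def flip: mult_op_mult) (simp add: mult.commute)
    then have "mult_op F (bilateral_shift x) = bilateral_shift (mult_op F x)" for x
      using blinfun_compose_eqD by fastforce
    then have "shift_conj (mult_op F) = 1 *\<^sub>C mult_op F"
      by (intro blinfun_eqI) (simp add: shift_conj_apply)
    then show ?thesis by (auto intro!: exI[of _ 1])
  qed
  moreover have "rot_rep c \<in> ?E" if "norm c = 1" for c
  proof -
    have cc: "norm (cnj c) = 1" using that by simp
    have "shift_conj (rot_op (cnj c)) = cnj c *\<^sub>C rot_op (cnj c)"
      using blinfun_compose_eqD[OF rot_op_bilateral_shift[OF cc]]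
      by (intro blinfun_eqI) (simp add: shift_conj_apply bounded_ops_scaleC)
    then show ?thesis
      using that by (auto simp: rot_rep_def intro!: exI[of _ "cnj c"])
  qed
  ultimately have "?G \<subseteq> ?E" by auto
  also have "?E \<subseteq> closure (cspan ?E)"
    by (rule subset_closed_span)
  finally have "?G \<subseteq> closure (cspan ?E)" .
  moreover have "cstar_subalgebra (closure (cspan ?E))"
    by (rule cstar_subalgebra_closed_span) (blast, (rule peripheral_eigen_closed_algebra; assumption)+)
  ultimately show "cstar_generated ?G \<subseteq> peripheral_space bounded_ops shift_conj"
    unfolding cstar_generated_def peripheral_space_def by blast
  have "peripheral_space bounded_ops shift_conj \<subseteq> C" if C: "cstar_subalgebra C" "?G \<subseteq> C" for C
  proof -
    have "?E \<subseteq> C"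
    proof
      fix X assume "X \<in> ?E"
      then obtain c where c: "X \<in> bounded_ops" "norm c = 1" "shift_conj X = c *\<^sub>C X" by auto
      obtain F where F: "X = mult_op F o\<^sub>L rot_op c"
        using eigen_factorization[OF c] .
      have "rot_op c = rot_rep (cnj c)" by (simp add: rot_rep_def)
      then have "mult_op F \<in> C" "rot_op c \<in> C"
        using C(2) c(2) by auto
      then show "X \<in> C"
        using C(1) F by (simp add: cstar_subalgebra_def)
    qed
    then show ?thesis
      unfolding peripheral_space_def using C(1)
      by (intro closure_minimal complex_vector.span_minimal) (simp_all add: cstar_subalgebra_def)
  qed
  then show "peripheral_space bounded_ops shift_conj \<subseteq> cstar_generated ?G"
    unfolding cstar_generated_def by blast
qed

text \<open>For the concrete dilation this is the general theory, with \<open>hardy_compression\<close> as its compression.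
  The target product may be computed from any other dilation by \<open>peripheral_product_unique\<close>.\<close>

lemma hardy_compression_star_isomorphism:
  fixes J :: "hardy \<Rightarrow>\<^sub>L 'k::chilbert_space"
  assumes "minimal_dilation bounded_ops shift_map J B \<theta>"
  shows "star_isomorphism hardy_compression (peripheral_space bounded_ops shift_conj)
    (peripheral_space bounded_ops shift_map) (peripheral_product J B \<theta>)"
proof -
  let ?P = "peripheral_space bounded_ops shift_conj" and ?T = "compress_op hardy_incl"
  have other: "unital_dilation shift_map J B \<theta>"
    using assms shift_map_id by unfold_locales
  have in_tau: "?T X \<in> peripheral_space bounded_ops shift_map" if "X \<in> ?P" for X
    using shift.compress_bij that by (auto simp: bij_betw_def)
  have prod: "?T (X o\<^sub>L Y) = peripheral_product J B \<theta> (?T X) (?T Y)" if "X \<in> ?P" "Y \<in> ?P" for X Y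
  proof -
    have "?T (X o\<^sub>L Y) = peripheral_product hardy_incl bounded_ops shift_conj (?T X) (?T Y)"
      by (simp add: shift.peripheral_product_Tinv shift.Tinv_compress that)
    also have "\<dots> = peripheral_product J B \<theta> (?T X) (?T Y)"
      by (rule peripheral_product_unique[OF shift.unital_dilation_axioms other in_tau in_tau]) (rule that)+
    finally show ?thesis .
  qed
  have eq: "hardy_compression = ?T"
    by (rule ext) (rule hardy_compression_eq)
  show ?thesis
    unfolding star_isomorphism_def eq
    using shift.compress_bij shift.compress_isometric prod shift.peripheral_space_ops
    by (auto simp: compress_op_adj compress_op_scaleC compress_op_add subset_iff)
qed

theorem theorem3p3:
  shows
    "circle_cstar_dynamical_system rotation_action \<and>
     covariant_representation rotation_action mult_op rot_rep \<and>
     (\<exists>(J :: hardy \<Rightarrow>\<^sub>L l2) B \<theta>. minimal_dilation bounded_ops shift_map J B \<theta>) \<and>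
     (\<forall>(J :: hardy \<Rightarrow>\<^sub>L 'k::chilbert_space) B \<theta>.
        minimal_dilation bounded_ops shift_map J B \<theta> \<longrightarrow>
        star_isomorphism hardy_compression
          (cstar_generated (range mult_op \<union> rot_rep ` sphere 0 1))
          (peripheral_space bounded_ops shift_map)
          (peripheral_product J B \<theta>))"
  unfolding generated_algebra_eq_peripheral
  using rotation_action_dynamical_system rotation_action_covariant shift_minimal_dilation
    hardy_compression_star_isomorphism by blast

end
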